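(* Let $f\colon X\to X$ be an invertible transformation preserving an ergodic Borel probability measure $\mu$, and let $\mathcal A$ be a cocycle over $f$ with generator $A\colon X\to\mathbb{R}^{d\times d}$ satisfying $\int_X\log^+\lVert A(x)\rVert\,d\mu(x)<+\infty$, with Lyapunov exponents $-\infty\le\lambda_1<\dots<\lambda_k$ and Oseledets splitting $\mathbb{R}^d=E_1(x)\oplus\dots\oplus E_k(x)$. Take $i\in\{1,\dots,k\}$ and let $$E^1(x)=\bigoplus_{j=1}^iE_j(x),\qquad E^2(x)=\bigoplus_{j=i+1}^kE_j(x).$$ Then there exists an ($f$-invariant) Borel set $\Lambda\subset X$ with $\mu(\Lambda)=1$ such that for each $\epsilon>0$ there are measurable functions $C,K\colon\Lambda\to(0,\infty)$ with the property that for every $x\in\Lambda$: (1) for each $v\in E^1(x)$ and $n\ge0$, $\lVert\mathcal A(x,n)v\rVert\le C(x)e^{(\lambda_i+\epsilon)n}\lVert v\rVert$, where, if $i=1$ and $\lambda_1=-\infty$, $\lambda_1$ is replaced by any number that belongs to the interval $(-\infty,\lambda_2)$; (2) for each $v\in E^2(x)$ and $n\ge0$, $\lVert\mathcal A(x,n)v\rVert\ge\frac1{C(x)}e^{(\lambda_{i+1}-\epsilon)n}\lVert v\rVert$; (3) for each $u\in E^1(x)$ and $v\in E^2(x)$, $\lVert u\rVert\le K(x)\lVert u+v\rVert$ and $\lVert v\rVert\le K(x)\lVert u+v\rVert$; (4) for each $n\in\mathbb Z$, $C(f^n(x))\le C(x)e^{\epsilon|n|}$ and $K(f^n(x))\le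 K(x)e^{\epsilon|n|}$.
   Context: $X$ carries its Borel $\sigma$-algebra; $f$ is bijective and measurable with measurable inverse. The cocycle over $f$ with measurable generator $A$ is $\mathcal A(x,n)=A(f^{n-1}(x))\cdots A(f(x))A(x)$ for $n\ge1$, $\mathcal A(x,0)=\mathrm{Id}$. The norm on $\mathbb{R}^d$ is Euclidean and matrices carry the operator norm. Lyapunov exponents and Oseledets splitting: by the (known) semi-invertible multiplicative ergodic theorem, whenever $f\colon X\to X$ is bijective and measurable with measurable inverse and preserves an ergodic Borel probability measure $\mu$, and $A\colon X\to\mathbb{R}^{d\times d}$ is measurable with $\int_X\log^+\lVert A(x)\rVert\,d\mu(x)<+\infty$, there exist numbers $-\infty\le\lambda_1<\dots<\lambda_k$ (Lyapunov exponents) and, for $\mu$-a.e. $x$, a unique measurable decomposition $\mathbb{R}^d=E_1(x)\oplus\dots\oplus E_k(x)$ (Oseledets splitting) such that $A(x)E_i(x)\subset E_i(f(x))$, with equality if $\lambda_i>-\infty$, and $\lim_{n\to\infty}\frac1n\log\lVert\mathcal A(x,n)v\rVert=\lambda_i$ for every $v\in E_i(x)\setminus\{0\}$ and every $i$ (with $\log 0=-\infty$). Conventions: when $i=k$, $E^2(x)=\{0\}$ and (2) is vacuous; when $k=1$, the interval $(-\infty,\lambda_2)$ is read as $\mathbb{R}$. When $\lambda_1=-\infty$ is replaced by a number, the function $C$ may depend on that number. *)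

theory Defs
  imports "HOL-Probability.Probability"
begin

definition ergodic_pres :: "'x measure \<Rightarrow> ('x \<Rightarrow> 'x) \<Rightarrow> bool" where
  "ergodic_pres M f \<longleftrightarrow>
     f \<in> measurable M M \<and> distr M M f = M \<and>
     (\<forall>B\<in>sets M. f -` B \<inter> space M = B \<longrightarrow> measure M B = 0 \<or> measure M B = 1)"

text \<open>Integer iterates of a bijection of the whole type.\<close>

definition int_iter :: "('x \<Rightarrow> 'x) \<Rightarrow> int \<Rightarrow> 'x \<Rightarrow> 'x" where
  "int_iter f n = (if 0 \<le> n then f ^^ nat n else inv f ^^ nat (- n))"

primrec cocycle ::
    "('x \<Rightarrow> 'x) \<Rightarrow> ('x \<Rightarrow> real^'d^'d) \<Rightarrow> 'x \<Rightarrow> nat \<Rightarrow> real^'d^'d" where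
  "cocycle f A x 0 = mat 1"
| "cocycle f A x (Suc n) = A ((f ^^ n) x) ** cocycle f A x n"

text \<open>The class norm of \<^typ>\<open>real^'d^'d\<close> is the Frobenius norm, hence the use of \<^const>\<open>onorm\<close>.\<close>

definition op_norm :: "real^'d^'d \<Rightarrow> real" where
  "op_norm B = onorm (\<lambda>v. B *v v)"

text \<open>Since \<^term>\<open>ln 0 = (0::real)\<close> by convention, the value at 0 is 0, as it should be.\<close>

definition log_plus :: "real \<Rightarrow> real" where
  "log_plus r = max 0 (ln r)"

text \<open>Logarithm on the nonnegative reals with value \<open>-\<infinity>\<close> at 0.\<close>

definition elog :: "real \<Rightarrow> ereal" where
  "elog r = (if r = 0 then - \<infinity> else ereal (ln r))"

text \<open>Internal direct sum: the whole space is the direct sum of \<open>V j\<close> for \<open>j \<in> J\<close>.\<close>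

definition direct_sum_decomp :: "nat set \<Rightarrow> (nat \<Rightarrow> (real^'d) set) \<Rightarrow> bool" where
  "direct_sum_decomp J V \<longleftrightarrow>
     (\<forall>j\<in>J. subspace (V j)) \<and>
     (\<forall>v. \<exists>!w. w \<in> (\<Pi>\<^sub>E j\<in>J. V j) \<and> v = (\<Sum>j\<in>J. w j))"

definition partial_sum :: "nat set \<Rightarrow> (nat \<Rightarrow> (real^'d) set) \<Rightarrow> (real^'d) set" where
  "partial_sum J V = {(\<Sum>j\<in>J. w j) | w. \<forall>j\<in>J. w j \<in> V j}"

text \<open>
  The Grassmannian carries the gap metric, i.e. the distance of orthogonal projections. A
  subspace-valued map is therefore Borel measurable iff the orthogonal projection onto its value
  depends measurably on the point; \<^term>\<open>closest_point V v\<close> is the orthogonal projection of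
  \<open>v\<close> onto the subspace \<open>V\<close>.
\<close>

definition measurable_subspaces :: "'x measure \<Rightarrow> ('x \<Rightarrow> (real^'d) set) \<Rightarrow> bool" where
  "measurable_subspaces M V \<longleftrightarrow>
     (\<forall>x\<in>space M. subspace (V x)) \<and>
     (\<forall>v. (\<lambda>x. closest_point (V x) v) \<in> borel_measurable M)"

text \<open>
  \<open>lam 1 < \<dots> < lam k\<close> are Lyapunov exponents and \<open>E 1 x \<oplus> \<dots> \<oplus> E k x\<close> is an Oseledets
  splitting. Only \<open>lam 1\<close> can be \<open>-\<infinity>\<close>, by strict monotonicity. The values of \<open>lam\<close> and
  \<open>E\<close> at indices outside \<open>{1..k}\<close>, and of \<open>E\<close> outside a set of full measure, are irrelevant.
\<close>

definition oseledets_splitting ::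
    "'x measure \<Rightarrow> ('x \<Rightarrow> 'x) \<Rightarrow> ('x \<Rightarrow> real^'d^'d) \<Rightarrow> nat \<Rightarrow> (nat \<Rightarrow> ereal)
      \<Rightarrow> (nat \<Rightarrow> 'x \<Rightarrow> (real^'d) set) \<Rightarrow> bool" where
  "oseledets_splitting M f A k lam E \<longleftrightarrow>
     strict_mono_on {1..k} lam \<and> (\<forall>j\<in>{1..k}. lam j < \<infinity>) \<and>
     (\<exists>\<Omega>\<in>sets M. measure M \<Omega> = 1 \<and>
        (\<forall>j\<in>{1..k}. measurable_subspaces (restrict_space M \<Omega>) (E j)) \<and>
        (\<forall>x\<in>\<Omega>.
           direct_sum_decomp {1..k} (\<lambda>j. E j x) \<and>
           (\<forall>j\<in>{1..k}.
              (\<lambda>v. A x *v v) ` E j x \<subseteq> E j (f x) \<and>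
              (lam j > - \<infinity> \<longrightarrow> (\<lambda>v. A x *v v) ` E j x = E j (f x)) \<and>
              (\<forall>v \<in> E j x - {0}.
                 (\<lambda>n. elog (norm (cocycle f A x n *v v)) / ereal (real n))
                   \<longlonglongrightarrow> lam j))))"

text \<open>
  The real numbers \<open>r\<close> allowed as exponential rate on \<open>E 1 x \<oplus> \<dots> \<oplus> E i x\<close>: the exponent
  \<open>lam i\<close> itself, or, if this is \<open>lam 1 = -\<infinity>\<close>, any number below \<open>lam 2\<close> (any number at
  all if there is no second exponent).
\<close>

definition admissible_rate :: "nat \<Rightarrow> (nat \<Rightarrow> ereal) \<Rightarrow> nat \<Rightarrow> real \<Rightarrow> bool" where
  "admissible_rate k lam i r \<longleftrightarrow>
     (if i = 1 \<and> lam 1 = - \<infinity> then (2 \<le> k \<longrightarrow> ereal r < lam 2) else ereal r = lam i)"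

end

theory Submission
  imports Defs
begin

text \<open>
  Everything is expressed through the projections \<open>P j\<close> onto \<open>E j\<close> along the other summands. They
  commute with the cocycle, so a lower bound \<open>exp (- H)\<close> for \<open>A\<close> on \<open>E j\<close> gives
  \<open>norm (P j x) \<le> const * exp (H x) * norm (A x) * norm (P j (f x))\<close>. A nonnegative function \<open>g\<close> with
  \<open>g \<le> g \<circ> f + h\<close> and \<open>h\<close> integrable grows subexponentially along almost every orbit: \<open>g \<circ> f - g\<close> is
  then integrable with integral 0, and the maximal ergodic argument applies. The same principle
  applies to the constants in the growth estimates on each \<open>E j\<close>; the required functions are the
  suprema of \<open>g (f^n x) - \<epsilon> |n|\<close>.

  The exponents are only given vector by vector, so the main point is that on \<open>E j\<close> with
  \<open>\<lambda>_j > - \<infinity>\<close> the lower bound is uniform and \<open>H\<close> is integrable. Let \<open>V q n\<close> be the largest expansion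
  of \<open>q\<close>-dimensional volumes in \<open>E j\<close> under the \<open>n\<close>-th iterate. These are submultiplicative, so for
  the largest \<open>q\<close> for which \<open>V q n\<close> has exponent \<open>q \<lambda>_j\<close>, \<open>V (q + 1) n\<close> has exponent strictly below
  \<open>(q + 1) \<lambda>_j\<close>. If \<open>q < dim (E j)\<close>, this gap makes the slow directions of the iterates converge
  (Ruelle's argument) to a vector with exponent below \<open>\<lambda>_j\<close>, which is impossible. Hence
  \<open>q = dim (E j)\<close>, and \<open>V q n / V 1 n ^ (q - 1)\<close> bounds the iterate from below.
\<close>

text \<open>No integrable bound on an inverse of \<open>A\<close> along a subbundle is given, so the
  logarithms of angles and constants have no two-sided control to start with. The principle for
  subexponential growth therefore rests on a one-sided inequality, which already forces the
  coboundary to be integrable. The integrability of \<open>H\<close> is a consequence of lower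
  growth: if the mean of \<open>ln (V q 1)\<close> were \<open>- \<infinity>\<close>, sums along
  orbits would push \<open>V q n\<close> below every exponential, against its exponent
  \<open>q * \<lambda>_j\<close>. Volumes enter because lower bounds for the vectors of a basis say
  nothing about their combinations. An exponent \<open>- \<infinity>\<close> admits no integrable
  \<open>H\<close> at all. It can only belong to \<open>E 1\<close>, whose projection is the
  identity minus the others, so the estimates are arranged to use step bounds for the other summands
  alone.\<close>

subsection \<open>Sums along orbits and tempered functions\<close>

lemma exp_growth_contradiction:
  assumes "\<forall>\<^sub>F n in sequentially. exp (\<sigma> * real n) \<le> C * exp (\<sigma>' * real n)" "\<sigma>' < \<sigma>"
  shows False
proof -
  have "\<forall>\<^sub>F n in sequentially. exp ((\<sigma> - \<sigma>') * real n) \<le> C"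
    using assms(1)
    by eventually_elim (simp add: left_diff_distrib exp_diff pos_divide_le_eq)
  moreover have "filterlim (\<lambda>n. exp ((\<sigma> - \<sigma>') * real n)) at_top sequentially"
    using assms(2) by (intro filterlim_compose[OF exp_at_top] filterlim_tendsto_pos_mult_at_top[OF tendsto_const] filterlim_real_sequentially) auto
  then have "\<forall>\<^sub>F n in sequentially. exp ((\<sigma> - \<sigma>') * real n) > C"
    by (simp add: filterlim_at_top_dense)
  ultimately have "\<forall>\<^sub>F n in sequentially. False" by eventually_elim simp
  then show ?thesis by simp
qed

locale ergodic_bij = prob_space M for M :: "'x measure" +
  fixes f :: "'x \<Rightarrow> 'x"
  assumes space_UNIV: "space M = UNIV"
    and bij_f: "bij f"
    and f_meas [measurable]: "f \<in> measurable M M"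
    and inv_f_meas [measurable]: "inv f \<in> measurable M M"
    and ergodic: "ergodic_pres M f"
begin

lemma distr_f: "distr M M f = M"
  using ergodic by (auto simp: ergodic_pres_def)

text \<open>Every result of the locale thereby also applies to backward orbits, as two-sided
  temperedness requires.\<close>

lemma ergodic_inv: "ergodic_bij M (inv f)"
proof
  have d: "distr M M (inv f) = M"
  proof -
    have "distr M M (inv f) = distr (distr M M f) M (inv f)"
      by (simp add: distr_f)
    also have "\<dots> = distr M M (inv f \<circ> f)"
      by (rule distr_distr) simp_all
    also have "inv f \<circ> f = id"
      using bij_f by (simp add: bij_is_inj)
    finally show ?thesis
      by (simp add: id_def distr_id)
  qed
  show "ergodic_pres M (inv f)"
    unfolding ergodic_pres_def
  proof (intro conjI d inv_f_meas ballI impI)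
    fix B assume B: "B \<in> sets M" "inv f -` B \<inter> space M = B"
    then have "f -` B = B"
      using bij_f space_UNIV
      by (metis Int_UNIV_right bij_betw_def bij_vimage_eq_inv_image inv_inv_eq inj_vimage_image_eq bij_imp_bij_inv)
    then show "measure M B = 0 \<or> measure M B = 1"
      using ergodic B(1) space_UNIV by (auto simp: ergodic_pres_def)
  qed
qed (use space_UNIV bij_f in \<open>auto simp: bij_imp_bij_inv inv_inv_eq\<close>)

lemma integral_f:
  fixes g :: "'x \<Rightarrow> real"
  assumes [measurable]: "g \<in> borel_measurable M"
  shows "(\<integral>x. g (f x) \<partial>M) = (\<integral>x. g x \<partial>M)"
  using integral_distr[OF f_meas assms] by (simp add: distr_f)

lemma integrable_f:
  fixes g :: "'x \<Rightarrow> real"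
  assumes "integrable M g"
  shows "integrable M (\<lambda>x. g (f x))"
  using integrable_distr[OF f_meas, of g] assms by (simp add: distr_f)

lemma AE_f:
  assumes "AE x in M. Q x"
  shows "AE x in M. Q (f x)"
proof -
  obtain N where N: "N \<in> sets M" "emeasure M N = 0" "{x. \<not> Q x} \<subseteq> N"
    using assms space_UNIV by (auto elim!: AE_E)
  have "emeasure M (f -` N) = 0"
    using emeasure_distr[OF f_meas N(1)] N(2) by (simp add: distr_f space_UNIV)
  moreover have "f -` N \<in> sets M"
    using measurable_sets[OF f_meas N(1)] by (simp add: space_UNIV)
  ultimately show ?thesis
    using N(3) by (intro AE_I[where N = "f -` N"]) auto
qed

lemma funpow_meas [measurable]: "f ^^ n \<in> measurable M M"
  by (induction n) auto

lemma AE_funpow: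
  assumes "AE x in M. Q x"
  shows "AE x in M. Q ((f ^^ n) x)"
  using assms
proof (induction n arbitrary: Q)
  case (Suc n)
  show ?case using Suc.IH[OF AE_f[OF Suc.prems]] by simp
qed simp

lemma invariant_set_cases:
  assumes "B \<in> sets M" "\<And>x. f x \<in> B \<longleftrightarrow> x \<in> B"
  shows "(AE x in M. x \<notin> B) \<or> (AE x in M. x \<in> B)"
proof -
  have "measure M B = 0 \<or> measure M B = 1"
    using ergodic assms by (auto simp: ergodic_pres_def space_UNIV)
  then show ?thesis
    using prob_eq_0[OF assms(1)] prob_eq_1[OF assms(1)] by (auto simp: assms)
qed

text \<open>The maximum of the Birkhoff sums of \<open>h\<close> over 0 to \<open>n\<close> steps.
  The recursion through \<open>f x\<close> is the identity on which the maximal ergodic argument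
  turns.\<close>

primrec max_sum :: "('x \<Rightarrow> real) \<Rightarrow> nat \<Rightarrow> 'x \<Rightarrow> real" where
  "max_sum h 0 x = 0"
| "max_sum h (Suc n) x = max 0 (h x + max_sum h n (f x))"

lemma max_sum_nonneg: "0 \<le> max_sum h n x"
  by (cases n) auto

lemma max_sum_Suc: "max_sum h n x \<le> max_sum h (Suc n) x"
proof (induction n arbitrary: x)
  case (Suc n)
  have "max_sum h n (f x) \<le> max_sum h (Suc n) (f x)" by (rule Suc)
  then have "max 0 (h x + max_sum h n (f x)) \<le> max 0 (h x + max_sum h (Suc n) (f x))"
    by (intro max.mono) auto
  then show ?case by (simp only: max_sum.simps(2))
qed simp

lemma max_sum_mono: "m \<le> n \<Longrightarrow> max_sum h m x \<le> max_sum h n x"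
  by (rule lift_Suc_mono_le[of "\<lambda>n. max_sum h n x"]) (auto intro: max_sum_Suc simp del: max_sum.simps)

lemma birkhoff_sum_Suc: "(\<Sum>j<Suc n. h ((f ^^ j) x)) = h x + (\<Sum>j<n. h ((f ^^ j) (f x)))"
  unfolding sum.lessThan_Suc_shift by (simp add: funpow_swap1)

lemma birkhoff_sum_le_max_sum: "(\<Sum>j<n. h ((f ^^ j) x)) \<le> max_sum h n x"
proof (induction n arbitrary: x)
  case (Suc n)
  show ?case
    unfolding birkhoff_sum_Suc using Suc[of "f x"] by simp
qed simp

lemma max_sum_meas [measurable]:
  assumes [measurable]: "h \<in> borel_measurable M"
  shows "max_sum h n \<in> borel_measurable M"
proof (induction n)
  case (Suc n)
  note Suc [measurable]
  show ?case by simp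
qed simp

lemma max_sum_integrable:
  assumes "integrable M h"
  shows "integrable M (max_sum h n)"
proof (induction n)
  case (Suc n)
  show ?case using integrable_f[OF Suc] assms by simp
qed simp

text \<open>On the invariant set where \<^term>\<open>max_sum h n x\<close> is unbounded in \<open>n\<close>, the differences
  \<^term>\<open>max_sum h (Suc n) x - max_sum h n (f x)\<close> tend to \<^term>\<open>h x\<close>, but their integrals are
  nonnegative.\<close>

proposition birkhoff_sums_bounded:
  fixes h :: "'x \<Rightarrow> real"
  assumes h: "integrable M h" and neg: "(\<integral>x. h x \<partial>M) < 0"
  shows "AE x in M. bdd_above (range (\<lambda>n. \<Sum>j<n. h ((f ^^ j) x)))"
proof -
  note hm [measurable] = borel_measurable_integrable[OF h]
  define B where "B = {x. \<forall>m::nat. \<exists>n. max_sum h n x > real m}"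
  have "{x \<in> space M. \<forall>m::nat. \<exists>n. max_sum h n x > real m} \<in> sets M"
    by measurable
  then have Bm: "B \<in> sets M" by (simp add: B_def space_UNIV)
  \<comment> \<open>Unboundedness is unaffected by adding or removing the single finite value
    \<open>h x\<close>.\<close>
  have inv: "f x \<in> B \<longleftrightarrow> x \<in> B" for x
  proof
    assume *: "f x \<in> B"
    show "x \<in> B" unfolding B_def
    proof (intro CollectI allI)
      fix m :: nat
      obtain m' :: nat where m': "real m - h x \<le> real m'" using real_arch_simple by blast
      obtain n where "max_sum h n (f x) > real m'" using * by (auto simp: B_def)
      then have "max_sum h (Suc n) x > real m" using m' by simp
      then show "\<exists>n. max_sum h n x > real m" by blast
    qed
  next
    assume *: "x \<in> B"
    show "f x \<in> B" unfolding B_def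
    proof (intro CollectI allI)
      fix m :: nat
      obtain m' :: nat where m': "real m + \<bar>h x\<bar> \<le> real m'" using real_arch_simple by blast
      obtain n where n: "max_sum h n x > real m'" using * by (auto simp: B_def)
      then obtain n' where "n = Suc n'" by (cases n) auto
      with n m' have "max_sum h n' (f x) > real m" by (auto simp: max_def split: if_splits)
      then show "\<exists>n. max_sum h n (f x) > real m" by blast
    qed
  qed
  have "\<not> (AE x in M. x \<in> B)"
  proof
    assume AEB: "AE x in M. x \<in> B"
    define ph where "ph n x = max_sum h (Suc n) x - max_sum h n (f x)" for n x
    have "(\<lambda>n. \<integral>x. ph n x \<partial>M) \<longlonglongrightarrow> (\<integral>x. h x \<partial>M)"
    proof (rule integral_dominated_convergence[where w = "\<lambda>x. \<bar>h x\<bar>"])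
      show "AE x in M. (\<lambda>n. ph n x) \<longlonglongrightarrow> h x"
      proof (use AEB in eventually_elim)
        fix x assume "x \<in> B"
        then have "f x \<in> B" using inv by simp
        obtain m' :: nat where m': "- h x \<le> real m'" using real_arch_simple by blast
        obtain n where n: "max_sum h n (f x) > real m'" using \<open>f x \<in> B\<close> by (auto simp: B_def)
        have "ph k x = h x" if "k \<ge> n" for k
          using max_sum_mono[OF that, of h "f x"] n m' by (simp add: ph_def max_def)
        then show "(\<lambda>n. ph n x) \<longlonglongrightarrow> h x"
          by (intro tendsto_eventually) (auto simp: eventually_sequentially)
      qed
      \<comment> \<open>The difference equals \<open>h x\<close> unless
        \<open>h x + max_sum h n (f x)\<close> is negative; then it is
        \<open>- max_sum h n (f x)\<close>, which lies between \<open>h x\<close> and 0.\<close>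
      show "AE x in M. norm (ph n x) \<le> \<bar>h x\<bar>" for n
        using max_sum_nonneg[of h n] by (intro AE_I2) (auto simp: ph_def max_def)
    qed (use h in \<open>auto simp: ph_def[abs_def] simp del: max_sum.simps\<close>)
    moreover have "(\<integral>x. ph n x \<partial>M) \<ge> 0" for n
    proof -
      have "(\<integral>x. ph n x \<partial>M) = (\<integral>x. max_sum h (Suc n) x \<partial>M) - (\<integral>x. max_sum h n x \<partial>M)"
        unfolding ph_def
        using max_sum_integrable[OF h] integrable_f[OF max_sum_integrable[OF h]]
        by (subst Bochner_Integration.integral_diff)
           (auto simp: integral_f simp del: max_sum.simps)
      moreover have "(\<integral>x. max_sum h n x \<partial>M) \<le> (\<integral>x. max_sum h (Suc n) x \<partial>M)"
        by (intro integral_mono max_sum_integrable h max_sum_Suc)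
      ultimately show ?thesis by simp
    qed
    ultimately have "(\<integral>x. h x \<partial>M) \<ge> 0"
      by (intro LIMSEQ_le_const) auto
    then show False using neg by simp
  qed
  then have "AE x in M. x \<notin> B" using invariant_set_cases[OF Bm inv] by blast
  then show ?thesis
  proof eventually_elim
    fix x assume "x \<notin> B"
    then obtain m where m: "\<And>n. max_sum h n x \<le> real m" by (auto simp: B_def not_less)
    show "bdd_above (range (\<lambda>n. \<Sum>j<n. h ((f ^^ j) x)))"
      by (intro bdd_aboveI2[where M = "real m"] order.trans[OF birkhoff_sum_le_max_sum m])
  qed
qed

end

text \<open>Equivalent to a nonpositive limit superior of \<open>g (f^n x) / |n|\<close> as
  \<open>|n|\<close> tends to infinity. Boundedness is the form that makes the supremum in
  \<open>tempered_envelope\<close> genuine.\<close>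

definition tempered :: "('x \<Rightarrow> 'x) \<Rightarrow> ('x \<Rightarrow> real) \<Rightarrow> 'x \<Rightarrow> bool" where
  "tempered f g x \<longleftrightarrow>
     (\<forall>\<delta>>0. bdd_above (range (\<lambda>n::int. g (int_iter f n x) - \<delta> * \<bar>real_of_int n\<bar>)))"

section \<open>Coboundaries and two-sided temperedness\<close>

context ergodic_bij
begin

text \<open>Truncations of \<open>g\<close> are integrable, so their coboundaries have integral 0.
  Truncation only shrinks differences, so these coboundaries are still bounded below by
  \<open>- h\<close>; Fatou's lemma then makes the coboundary of \<open>g\<close> integrable
  although \<open>g\<close> itself need not be, and dominated convergence carries the integral 0 to
  the limit.\<close>

lemma coboundary_integral_zero:
  fixes g h :: "'x \<Rightarrow> real"
  assumes [measurable]: "g \<in> borel_measurable M" and g0: "\<And>x. 0 \<le> g x"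
    and h: "integrable M h" and h0: "\<And>x. 0 \<le> h x"
    and le: "AE x in M. g x \<le> g (f x) + h x"
  shows "integrable M (\<lambda>x. g (f x) - g x)" and "(\<integral>x. g (f x) - g x \<partial>M) = 0"
proof -
  note hm [measurable] = borel_measurable_integrable[OF h]
  define ph where "ph n x = min (g (f x)) (real n) - min (g x) (real n)" for n x
  have ph_meas [measurable]: "ph n \<in> borel_measurable M" for n
    unfolding ph_def[abs_def] by measurable
  have mint: "integrable M (\<lambda>x. min (g x) (real n))" for n
    by (rule integrable_const_bound[where B = "real n"]) (use g0 in auto)
  have mint': "integrable M (\<lambda>x. min (g (f x)) (real n))" for n
    by (rule integrable_const_bound[where B = "real n"]) (use g0 in auto)
  have ph_int: "integrable M (ph n)" for n
    unfolding ph_def[abs_def] using mint mint' by simp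
  have ph0: "(\<integral>x. ph n x \<partial>M) = 0" for n
    unfolding ph_def using mint mint' integral_f[of "\<lambda>x. min (g x) (real n)"]
    by (subst Bochner_Integration.integral_diff) auto
  have ph_lim: "(\<lambda>n. ph n x) \<longlonglongrightarrow> g (f x) - g x" for x
  proof -
    obtain N :: nat where N: "max (g x) (g (f x)) \<le> real N" using real_arch_simple by blast
    have "ph k x = g (f x) - g x" if "k \<ge> N" for k
      using N that by (auto simp: ph_def)
    then show ?thesis
      by (intro tendsto_eventually) (auto simp: eventually_sequentially)
  qed
  have ph_ge: "AE x in M. \<forall>n. 0 \<le> ph n x + h x"
    using le
  proof eventually_elim
    case (elim x)
    then show ?case using h0[of x] g0[of x] by (auto simp: ph_def min_def)
  qed
  have "(\<integral>\<^sup>+x. ennreal (g (f x) - g x + h x) \<partial>M)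
      = (\<integral>\<^sup>+x. liminf (\<lambda>n. ennreal (ph n x + h x)) \<partial>M)"
  proof (intro nn_integral_cong)
    fix x
    have "(\<lambda>n. ennreal (ph n x + h x)) \<longlonglongrightarrow> ennreal (g (f x) - g x + h x)"
      by (intro tendsto_ennrealI tendsto_add ph_lim tendsto_const)
    then show "ennreal (g (f x) - g x + h x) = liminf (\<lambda>n. ennreal (ph n x + h x))"
      by (simp add: lim_imp_Liminf)
  qed
  also have "\<dots> \<le> liminf (\<lambda>n. \<integral>\<^sup>+x. ennreal (ph n x + h x) \<partial>M)"
    by (rule nn_integral_liminf) measurable
  also have "(\<lambda>n. \<integral>\<^sup>+x. ennreal (ph n x + h x) \<partial>M) = (\<lambda>n. ennreal (\<integral>x. h x \<partial>M))"
  proof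
    fix n
    have "(\<integral>\<^sup>+x. ennreal (ph n x + h x) \<partial>M) = ennreal (\<integral>x. ph n x + h x \<partial>M)"
      using ph_ge by (intro nn_integral_eq_integral) (auto simp: ph_int h elim: AE_mp)
    also have "(\<integral>x. ph n x + h x \<partial>M) = (\<integral>x. h x \<partial>M)"
      by (simp add: ph_int h ph0)
    finally show "(\<integral>\<^sup>+x. ennreal (ph n x + h x) \<partial>M) = ennreal (\<integral>x. h x \<partial>M)" .
  qed
  finally have fin: "(\<integral>\<^sup>+x. ennreal (g (f x) - g x + h x) \<partial>M) < \<infinity>"
    by (simp add: Liminf_const order.strict_trans1)
  have nn: "AE x in M. 0 \<le> g (f x) - g x + h x"
    using le by eventually_elim simp
  have "integrable M (\<lambda>x. g (f x) - g x + h x)"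
    using fin nn by (intro integrableI_nonneg) auto
  then have "integrable M (\<lambda>x. (g (f x) - g x + h x) - h x)"
    using h by (rule Bochner_Integration.integrable_diff)
  then show i: "integrable M (\<lambda>x. g (f x) - g x)" by simp
  have "(\<lambda>n. \<integral>x. ph n x \<partial>M) \<longlonglongrightarrow> (\<integral>x. g (f x) - g x \<partial>M)"
  proof (rule integral_dominated_convergence[where w = "\<lambda>x. \<bar>g (f x) - g x\<bar>"])
    show "AE x in M. norm (ph n x) \<le> \<bar>g (f x) - g x\<bar>" for n
      by (intro AE_I2) (auto simp: ph_def min_def)
  qed (use i ph_lim in auto)
  then show "(\<integral>x. g (f x) - g x \<partial>M) = 0"
    by (simp add: ph0 LIMSEQ_const_iff)
qed

text \<open>The sums of the coboundary telescope to \<open>g (f^n x) - g x\<close>. Subtracting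
  \<open>1 / (m + 1)\<close> makes the mean negative, hence the sums bounded above, and countably
  many \<open>m\<close> cover all \<open>\<delta>\<close>.\<close>

lemma forward_tempered:
  fixes g :: "'x \<Rightarrow> real"
  assumes [measurable]: "g \<in> borel_measurable M"
    and "integrable M (\<lambda>x. g (f x) - g x)" "(\<integral>x. g (f x) - g x \<partial>M) = 0"
  shows "AE x in M. \<forall>\<delta>>0. bdd_above (range (\<lambda>n::nat. g ((f ^^ n) x) - \<delta> * real n))"
proof -
  have "AE x in M. bdd_above (range (\<lambda>n. \<Sum>j<n. (g (f ((f ^^ j) x)) - g ((f ^^ j) x) - inverse (Suc m))))" for m
  proof (rule birkhoff_sums_bounded)
    show "integrable M (\<lambda>x. g (f x) - g x - inverse (real (Suc m)))"
      using assms(2) by simp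
    show "(\<integral>x. g (f x) - g x - inverse (real (Suc m)) \<partial>M) < 0"
      using assms(2,3) by (subst Bochner_Integration.integral_diff) (auto simp: prob_space)
  qed
  then have "AE x in M. \<forall>m. bdd_above (range (\<lambda>n. \<Sum>j<n. (g (f ((f ^^ j) x)) - g ((f ^^ j) x) - inverse (Suc m))))"
    by (simp add: AE_all_countable)
  then show ?thesis
  proof (eventually_elim, intro allI impI)
    fix x and \<delta> :: real assume *: "\<forall>m. bdd_above (range (\<lambda>n. \<Sum>j<n. (g (f ((f ^^ j) x)) - g ((f ^^ j) x) - inverse (Suc m))))"
      and "0 < \<delta>"
    obtain m where m: "inverse (Suc m) < \<delta>" using reals_Archimedean[OF \<open>0 < \<delta>\<close>] by auto
    have tel: "(\<Sum>j<n. (g (f ((f ^^ j) x)) - g ((f ^^ j) x) - inverse (Suc m)))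
        = g ((f ^^ n) x) - g x - inverse (Suc m) * real n" for n
      by (induction n) (auto simp: algebra_simps)
    obtain B where B: "\<And>n. g ((f ^^ n) x) - g x - inverse (Suc m) * real n \<le> B"
      using spec[OF *, of m] unfolding tel bdd_above_def by (auto simp del: of_nat_Suc)
    show "bdd_above (range (\<lambda>n::nat. g ((f ^^ n) x) - \<delta> * real n))"
    proof (intro bdd_aboveI2)
      fix n
      have "inverse (Suc m) * real n \<le> \<delta> * real n" using m by (intro mult_right_mono) auto
      with B[of n] show "g ((f ^^ n) x) - \<delta> * real n \<le> B + g x" by linarith
    qed
  qed
qed

text \<open>One inequality controls both time directions: the coboundary along \<open>inv f\<close>
  is minus the original one composed with \<open>inv f\<close>, so it is again integrable with
  integral 0.\<close>

lemma AE_tempered: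
  fixes g h :: "'x \<Rightarrow> real"
  assumes [measurable]: "g \<in> borel_measurable M" and g0: "\<And>x. 0 \<le> g x"
    and h: "integrable M h" and h0: "\<And>x. 0 \<le> h x"
    and le: "AE x in M. g x \<le> g (f x) + h x"
  shows "AE x in M. tempered f g x"
proof -
  interpret I: ergodic_bij M "inv f" by (rule ergodic_inv)
  note cob = coboundary_integral_zero[OF assms]
  have fi: "f (inv f x) = x" for x using bij_f by (simp add: bij_is_surj surj_f_inv_f)
  have "integrable M (\<lambda>x. - (g (f (inv f x)) - g (inv f x)))"
    using I.integrable_f[OF cob(1)] by (rule integrable_minus)
  then have i1: "integrable M (\<lambda>x. g (inv f x) - g x)" by (simp add: fi)
  have "(\<integral>x. - (g (f (inv f x)) - g (inv f x)) \<partial>M) = 0"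
    using I.integral_f[of "\<lambda>x. g (f x) - g x"] cob(2) by (simp only: integral_minus) simp
  then have i2: "(\<integral>x. g (inv f x) - g x \<partial>M) = 0" by (simp add: fi)
  from forward_tempered[OF assms(1) cob] I.forward_tempered[OF assms(1) i1 i2]
  show ?thesis
  proof eventually_elim
    case (elim x)
    show ?case unfolding tempered_def
    proof (intro allI impI)
      fix \<delta> :: real assume "\<delta> > 0"
      obtain B1 B2 where B: "\<And>n. g ((f ^^ n) x) - \<delta> * real n \<le> B1" "\<And>n. g ((inv f ^^ n) x) - \<delta> * real n \<le> B2"
        using elim[rule_format, OF \<open>\<delta> > 0\<close>] by (auto simp: bdd_above_def)
      show "bdd_above (range (\<lambda>n::int. g (int_iter f n x) - \<delta> * \<bar>real_of_int n\<bar>))"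
      proof (intro bdd_aboveI2)
        fix n :: int
        show "g (int_iter f n x) - \<delta> * \<bar>real_of_int n\<bar> \<le> max B1 B2"
          using B(1)[of "nat n"] B(2)[of "nat (- n)"] by (auto simp: int_iter_def)
      qed
    qed
  qed
qed

lemma inv_inv: "inv (inv f) = f"
  using bij_f by (rule inv_inv_eq)

text \<open>Read at \<open>inv f x\<close>, the reversed inequality has the form required by
  \<open>AE_tempered\<close> for \<open>inv f\<close>, and temperedness is symmetric in
  time.\<close>

lemma AE_tempered':
  fixes g h :: "'x \<Rightarrow> real"
  assumes "g \<in> borel_measurable M" "\<And>x. 0 \<le> g x" "integrable M h" "\<And>x. 0 \<le> h x"
    and le: "AE x in M. g (f x) \<le> g x + h x"
  shows "AE x in M. tempered f g x"
proof -
  interpret I: ergodic_bij M "inv f" by (rule ergodic_inv)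
  have fi: "f (inv f x) = x" for x using bij_f by (simp add: bij_is_surj surj_f_inv_f)
  have "AE x in M. tempered (inv f) g x"
    using I.AE_f[OF le] assms(1-4)
    by (intro I.AE_tempered[where h = "\<lambda>x. h (inv f x)"] I.integrable_f) (auto simp: fi)
  then show ?thesis
  proof eventually_elim
    case (elim x)
    have it: "int_iter f n x = int_iter (inv f) (- n) x" for n
      by (auto simp: int_iter_def inv_inv)
    show ?case unfolding tempered_def
    proof (intro allI impI)
      fix \<delta> :: real assume "\<delta> > 0"
      then obtain B where B: "\<And>n. g (int_iter (inv f) n x) - \<delta> * \<bar>real_of_int n\<bar> \<le> B"
        using elim by (auto simp: tempered_def bdd_above_def)
      show "bdd_above (range (\<lambda>n::int. g (int_iter f n x) - \<delta> * \<bar>real_of_int n\<bar>))"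
        using B[of "- _"] by (intro bdd_aboveI2[where M = B]) (auto simp: it)
    qed
  qed
qed

section \<open>Recurrence, integer iterates and invariant sets of full measure\<close>

lemma birkhoff_sum_add:
  "(\<Sum>j<k + m. h ((f ^^ j) x)) = (\<Sum>j<k. h ((f ^^ j) x)) + (\<Sum>j<m. (h ((f ^^ j) ((f ^^ k) x)) :: real))"
  by (induction m) (auto simp: funpow_add add.commute)

text \<open>With \<open>c\<close> half the measure of \<open>Z\<close>, the function
  \<open>c - indicator Z\<close> has mean \<open>- c\<close>, so its sums are bounded above; along
  an orbit avoiding \<open>Z\<close> they would equal \<open>c * n\<close>.\<close>

lemma AE_recurrent:
  assumes Z [measurable]: "Z \<in> sets M" and pos: "\<not> (AE x in M. x \<notin> Z)"
  shows "AE x in M. \<exists>k. (f ^^ k) x \<in> Z"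
proof -
  have mz: "measure M Z > 0"
    using pos prob_eq_0[OF Z] by (simp add: zero_less_measure_iff measure_le_0_iff)
  define c where "c = measure M Z / 2"
  have "AE x in M. bdd_above (range (\<lambda>n. \<Sum>j<n. c - indicator Z ((f ^^ j) x)))"
  proof (rule birkhoff_sums_bounded)
    have i: "integrable M (indicat_real Z)"
      by (rule integrable_real_indicator) (auto simp: emeasure_eq_measure)
    then show "integrable M (\<lambda>x. c - indicat_real Z x)" by simp
    show "(\<integral>x. c - indicat_real Z x \<partial>M) < 0"
      using i mz by (subst Bochner_Integration.integral_diff) (auto simp: c_def prob_space)
  qed
  then show ?thesis
  proof eventually_elim
    case (elim x)
    then obtain B where B: "\<And>n. (\<Sum>j<n. c - indicator Z ((f ^^ j) x)) \<le> B"
      by (auto simp: bdd_above_def)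
    show ?case
    proof (rule ccontr)
      assume "\<nexists>k. (f ^^ k) x \<in> Z"
      then have le: "c * real n \<le> B" for n using B[of n] by (simp add: mult.commute)
      obtain n :: nat where "B / c < real n" using reals_Archimedean2 by blast
      then show False using le[of n] mz by (simp add: c_def field_simps)
    qed
  qed
qed

lemma int_iter_f: "int_iter f n (f x) = int_iter f (n + 1) x"
proof (cases "n \<ge> 0")
  case True
  then show ?thesis by (simp add: int_iter_def nat_add_distrib funpow_swap1)
next
  case False
  then obtain m where m: "nat (- n) = Suc m" by (cases "nat (- n)") auto
  then have "nat (- (n + 1)) = m" by simp
  moreover have "inv f (f x) = x" using bij_f by (simp add: bij_is_inj)
  ultimately have "(inv f ^^ nat (- n)) (f x) = (inv f ^^ nat (- (n + 1))) x"
    unfolding m by (simp only: funpow_Suc_right o_apply)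
  moreover have "int_iter f (n + 1) x = (inv f ^^ nat (- (n + 1))) x"
    using False by (cases "n = - 1") (auto simp: int_iter_def)
  ultimately show ?thesis using False by (simp add: int_iter_def)
qed

lemma int_iter_0 [simp]: "int_iter f 0 x = x"
  by (simp add: int_iter_def)

lemma int_iter_funpow: "int_iter f n ((f ^^ m) x) = int_iter f (n + int m) x"
proof (induction m arbitrary: n)
  case (Suc m)
  have "int_iter f n ((f ^^ Suc m) x) = int_iter f (n + 1) ((f ^^ m) x)"
    by (simp add: int_iter_f)
  then show ?case by (simp add: Suc algebra_simps)
qed simp

lemma int_iter_add: "int_iter f n (int_iter f m x) = int_iter f (n + m) x"
proof (cases "m \<ge> 0")
  case True
  then show ?thesis using int_iter_funpow[of n "nat m" x] by (simp add: int_iter_def[of f m])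
next
  case False
  define y where "y = int_iter f m x"
  have "(f ^^ k) ((inv f ^^ k) x) = x" for k
  proof (induction k)
    case (Suc k)
    have "f (inv f y) = y" for y using bij_f by (simp add: bij_is_surj surj_f_inv_f)
    then have "(f ^^ Suc k) ((inv f ^^ Suc k) x) = (f ^^ k) ((inv f ^^ k) x)"
      by (simp only: funpow_Suc_right[of k f] funpow.simps(2)[of k "inv f"] o_apply)
    then show ?case using Suc by simp
  qed simp
  then have "x = (f ^^ nat (- m)) y" using False by (simp add: y_def int_iter_def)
  then have "int_iter f (n + m) x = int_iter f (n + m + int (nat (- m))) y"
    using int_iter_funpow by simp
  then show ?thesis using False by (simp add: y_def)
qed

lemma int_iter_meas [measurable]: "int_iter f n \<in> measurable M M"
proof -
  interpret I: ergodic_bij M "inv f" by (rule ergodic_inv)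
  show ?thesis by (simp add: int_iter_def funpow_meas I.funpow_meas)
qed

lemma AE_int_iter:
  assumes "AE x in M. Q x"
  shows "AE x in M. Q (int_iter f n x)"
proof -
  interpret I: ergodic_bij M "inv f" by (rule ergodic_inv)
  show ?thesis using AE_funpow[OF assms] I.AE_funpow[OF assms] by (simp add: int_iter_def)
qed

text \<open>Discarding all points whose two-sided orbit meets the null set costs countably many null
  sets and leaves an exactly invariant set.\<close>

lemma AE_invariant_set:
  assumes "AE x in M. Q x"
  obtains \<Lambda> where "\<Lambda> \<in> sets M" "\<And>x. f x \<in> \<Lambda> \<longleftrightarrow> x \<in> \<Lambda>" "AE x in M. x \<in> \<Lambda>" "\<And>x. x \<in> \<Lambda> \<Longrightarrow> Q x"
proof -
  obtain N where N: "N \<in> sets M" "emeasure M N = 0" "{x. \<not> Q x} \<subseteq> N"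
    using assms space_UNIV by (auto elim!: AE_E)
  define L where "L = {x. \<forall>n::int. int_iter f n x \<notin> N}"
  have "{x \<in> space M. \<forall>n::int. int_iter f n x \<notin> N} \<in> sets M" using N(1) by measurable
  then have "L \<in> sets M" by (simp add: L_def space_UNIV)
  moreover have "f x \<in> L \<longleftrightarrow> x \<in> L" for x
  proof -
    have "(\<forall>n::int. int_iter f (n + 1) x \<notin> N) \<longleftrightarrow> (\<forall>n::int. int_iter f n x \<notin> N)"
      by (metis diff_add_cancel)
    then show ?thesis by (simp add: L_def int_iter_f)
  qed
  moreover have AEN: "AE x in M. x \<notin> N" using N(1,2) by (intro AE_not_in null_setsI)
  moreover have "AE x in M. x \<in> L"
    using AE_int_iter[OF AEN] by (simp add: L_def AE_all_countable)
  moreover have "Q x" if "x \<in> L" for x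
    using N(3) that[unfolded L_def, simplified, rule_format, of 0] by auto
  ultimately show ?thesis using that by blast
qed

end

subsection \<open>Submultiplicative cocycles\<close>

text \<open>Models the norm of an exterior power of the cocycle. The axioms are multiplicative
  because \<open>V\<close> may vanish, and \<open>V 0 x\<close> is only bounded by 1 because volumes
  of order above the dimension are 0.\<close>

locale submult_cocycle = ergodic_bij +
  fixes V :: "nat \<Rightarrow> 'a \<Rightarrow> real" and h :: "'a \<Rightarrow> real"
  assumes V_meas [measurable]: "V n \<in> borel_measurable M"
    and V_nonneg: "0 \<le> V n x"
    and V_0: "V 0 x \<le> 1"
    and V_add: "V (n + m) x \<le> V n x * V m ((f ^^ n) x)"
    and V_1: "V 1 x \<le> exp (h x)"
    and h_int: "integrable M h"
    and h_nonneg: "0 \<le> h x"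
begin

lemma V_Suc: "V (Suc n) x \<le> V 1 x * V n (f x)"
  using V_add[of 1 n x] by simp

lemma V_le_birkhoff:
  assumes "\<And>x. V 1 x \<le> exp (g x)"
  shows "V n x \<le> exp (\<Sum>j<n. g ((f ^^ j) x))"
proof (induction n arbitrary: x)
  case 0
  then show ?case using V_0 by simp
next
  case (Suc n)
  have "V (Suc n) x \<le> V 1 x * V n (f x)" by (rule V_Suc)
  also have "\<dots> \<le> exp (g x) * exp (\<Sum>j<n. g ((f ^^ j) (f x)))"
    by (intro mult_mono Suc assms V_nonneg) auto
  also have "\<dots> = exp (\<Sum>j<Suc n. g ((f ^^ j) x))"
    by (simp only: birkhoff_sum_Suc exp_add)
  finally show ?case .
qed

lemma AE_growth_of_mean:
  assumes g: "integrable M g" and "\<And>x. V 1 x \<le> exp (g x)" and "(\<integral>x. g x \<partial>M) < \<sigma>"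
  shows "AE x in M. \<exists>C. \<forall>n. V n x \<le> C * exp (\<sigma> * real n)"
proof -
  have "AE x in M. bdd_above (range (\<lambda>n. \<Sum>j<n. g ((f ^^ j) x) - \<sigma>))"
    by (rule birkhoff_sums_bounded) (use g assms(3) in \<open>auto simp: prob_space\<close>)
  then show ?thesis
  proof eventually_elim
    case (elim x)
    then obtain B where B: "\<And>n. (\<Sum>j<n. g ((f ^^ j) x) - \<sigma>) \<le> B"
      by (auto simp: bdd_above_def)
    show ?case
    proof (intro exI allI)
      fix n
      have "V n x \<le> exp (\<Sum>j<n. g ((f ^^ j) x))" by (rule V_le_birkhoff[OF assms(2)])
      also have "\<dots> \<le> exp (B + \<sigma> * real n)" using B[of n] by (simp add: sum_subtractf mult.commute)
      finally show "V n x \<le> exp B * exp (\<sigma> * real n)" by (simp add: exp_add)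
    qed
  qed
qed

text \<open>Jump along an orbit by the times \<open>n\<close> from the hypothesis while these are at most \<open>L\<close>, and by
  single steps otherwise; for large \<open>L\<close> the cost of the latter has small mean.\<close>

proposition AE_growth:
  assumes small: "AE x in M. \<exists>n\<ge>1. V n x \<le> exp (\<rho> * real n)" and "\<rho> < \<rho>'"
  shows "AE x in M. \<exists>C. \<forall>n. V n x \<le> C * exp (\<rho>' * real n)"
proof -
  note hm [measurable] = borel_measurable_integrable[OF h_int]
  \<comment> \<open>The summand \<open>\<bar>\<rho>\<bar>\<close> ensures that a single step costs
    at most \<open>\<rho> + h' x\<close>.\<close>
  define h' where "h' x = h x + \<bar>\<rho>\<bar>" for x
  have h'i: "integrable M h'" unfolding h'_def[abs_def] using h_int by simp
  note [measurable] = borel_measurable_integrable[OF h'i]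
  have h'0: "0 \<le> h' x" for x using h_nonneg[of x] by (simp add: h'_def)
  define G where "G L x \<longleftrightarrow> (\<exists>n\<in>{1..L}. V n x \<le> exp (\<rho> * real n))" for L x
  have [measurable]: "Measurable.pred M (G L)" for L unfolding G_def[abs_def] by measurable
  \<comment> \<open>A point is free of charge only if a good jump of length at most \<open>L\<close>
    starts there and its one-step cost is at most \<open>L\<close>. The second condition matters
    near the end of an orbit segment, where the jump would overshoot and single steps are taken
    after all.\<close>
  define H where "H L x = (if G L x \<and> h' x \<le> real L then 0 else h' x)" for L :: nat and x
  have [measurable]: "H L \<in> borel_measurable M" for L unfolding H_def[abs_def] by measurable
  have H0: "0 \<le> H L x" for L x using h'0 by (simp add: H_def)
  have Hi: "integrable M (H L)" for L
    by (rule Bochner_Integration.integrable_bound[OF h'i]) (auto simp: H_def)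
  have "(\<lambda>L. \<integral>x. H L x \<partial>M) \<longlonglongrightarrow> (\<integral>x. 0 \<partial>M)"
  proof (rule integral_dominated_convergence[where w = h'])
    show "AE x in M. (\<lambda>L. H L x) \<longlonglongrightarrow> 0"
      using small
    proof eventually_elim
      case (elim x)
      then obtain n where n: "n \<ge> 1" "V n x \<le> exp (\<rho> * real n)" by blast
      obtain m :: nat where m: "h' x \<le> real m" using real_arch_simple by blast
      have "H L x = 0" if "L \<ge> max n m" for L
        using n m that by (auto simp: H_def G_def)
      then show ?case by (intro tendsto_eventually eventually_sequentiallyI)
    qed
  qed (use h'i h'0 in \<open>auto simp: H_def\<close>)
  then have "eventually (\<lambda>L. (\<integral>x. H L x \<partial>M) < \<rho>' - \<rho>) sequentially"
    using \<open>\<rho> < \<rho>'\<close> by (intro order_tendstoD(2)) auto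
  then obtain L where L: "(\<integral>x. H L x \<partial>M) < \<rho>' - \<rho>" by (auto simp: eventually_sequentially)
  define S where "S n x = (\<Sum>j<n. H L ((f ^^ j) x))" for n x
  have S_le: "S (n - k) ((f ^^ k) x) \<le> S n x" if "k \<le> n" for n k x
    using birkhoff_sum_add[of "H L" x k "n - k"] that H0 by (simp add: S_def sum_nonneg)
  \<comment> \<open>The term \<open>real L * real L\<close> pays for the fewer than \<open>L\<close>
    last steps, at most \<open>L\<close> each.\<close>
  have main: "V n x \<le> exp (\<rho> * real n + S n x + real L * real L)" for n x
  proof (induction n arbitrary: x rule: less_induct)
    case (less n)
    show ?case
    proof (cases "n = 0")
      case True
      have "V 0 x \<le> exp 0" using V_0 by simp
      also have "\<dots> \<le> exp (real L * real L)" unfolding exp_le_cancel_iff by simp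
      finally show ?thesis by (simp add: True S_def)
    next
      case False
      show ?thesis
      proof (cases "G L x")
        case True
        then obtain k where k: "1 \<le> k" "k \<le> L" "V k x \<le> exp (\<rho> * real k)" by (auto simp: G_def)
        show ?thesis
        proof (cases "k \<le> n")
          case True
          have "V n x \<le> V k x * V (n - k) ((f ^^ k) x)" using V_add[of k "n - k" x] True by simp
          also have "\<dots> \<le> exp (\<rho> * real k) * exp (\<rho> * real (n - k) + S (n - k) ((f ^^ k) x) + real L * real L)"
            using k less.IH[of "n - k"] False by (intro mult_mono V_nonneg) auto
          also have "\<dots> = exp (\<rho> * real n + S (n - k) ((f ^^ k) x) + real L * real L)"
            using True by (simp add: exp_add[symmetric] of_nat_diff algebra_simps)
          also have "\<dots> \<le> exp (\<rho> * real n + S n x + real L * real L)"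
            unfolding exp_le_cancel_iff using S_le[OF True, of x] by simp
          finally show ?thesis .
        next
          case False
          then have n: "n \<le> L" using k by simp
          have "h y \<le> \<rho> + H L y + real L" for y
            by (auto simp: H_def h'_def)
          then have "(\<Sum>j<n. h ((f ^^ j) x)) \<le> (\<Sum>j<n. \<rho> + H L ((f ^^ j) x) + real L)"
            by (intro sum_mono) auto
          also have "\<dots> = \<rho> * real n + S n x + real n * real L"
            by (simp add: sum.distrib S_def mult.commute)
          also have "\<dots> \<le> \<rho> * real n + S n x + real L * real L"
            using n by (simp add: mult_right_mono)
          finally show ?thesis
            using V_le_birkhoff[OF V_1, of n x] by (meson exp_le_cancel_iff order.trans)
        qed
      next
        case nG: False
        obtain m where m: "n = Suc m" using False by (cases n) auto
        have "V n x \<le> V 1 x * V m (f x)" unfolding m by (rule V_Suc)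
        also have "\<dots> \<le> exp (h x) * exp (\<rho> * real m + S m (f x) + real L * real L)"
          using less.IH[of m] m V_1 by (intro mult_mono V_nonneg) auto
        also have "\<dots> = exp (h x + \<rho> * real m + S m (f x) + real L * real L)"
          by (simp add: exp_add[symmetric] algebra_simps)
        also have "\<dots> \<le> exp (\<rho> * real n + S n x + real L * real L)"
        proof -
          have "h x \<le> \<rho> + H L x" using nG by (simp add: H_def h'_def)
          moreover have "S n x = H L x + S m (f x)"
            unfolding S_def m birkhoff_sum_Suc ..
          ultimately show ?thesis by (simp add: m algebra_simps)
        qed
        finally show ?thesis .
      qed
    qed
  qed
  have "AE x in M. bdd_above (range (\<lambda>n. \<Sum>j<n. H L ((f ^^ j) x) - (\<rho>' - \<rho>)))"
    by (rule birkhoff_sums_bounded) (use L Hi in \<open>auto simp: prob_space\<close>)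
  then show ?thesis
  proof eventually_elim
    case (elim x)
    then obtain B where B: "\<And>n. (\<Sum>j<n. H L ((f ^^ j) x) - (\<rho>' - \<rho>)) \<le> B"
      by (auto simp: bdd_above_def)
    show ?case
    proof (intro exI allI)
      fix n
      have "S n x \<le> B + (\<rho>' - \<rho>) * real n"
        using B[of n] by (simp add: sum_subtractf S_def mult.commute)
      then have "V n x \<le> exp (B + real L * real L + \<rho>' * real n)"
        by (intro order.trans[OF main]) (simp add: algebra_simps)
      then show "V n x \<le> exp (B + real L * real L) * exp (\<rho>' * real n)" by (simp add: exp_add)
    qed
  qed
qed

text \<open>Replaces the existence of the limit in the subadditive ergodic theorem. If
  \<open>V n x < exp (\<sigma> * n)\<close> happens for infinitely many \<open>n\<close> on a set of
  positive measure, almost every orbit enters this set; a long stretch from there outweighs the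
  initial segment at the price of a slightly larger rate, and \<open>AE_growth\<close>
  applies.\<close>

lemma AE_growth_dichotomy:
  assumes "\<sigma> < \<rho>"
  shows "(AE x in M. \<forall>\<^sub>F n in sequentially. exp (\<sigma> * real n) \<le> V n x) \<or>
         (AE x in M. \<exists>C. \<forall>n. V n x \<le> C * exp (\<rho> * real n))"
proof -
  define Z where "Z = {x \<in> space M. \<forall>n0. \<exists>n\<ge>n0. V n x < exp (\<sigma> * real n)}"
  have Z: "Z \<in> sets M" unfolding Z_def by measurable
  show ?thesis
  proof (cases "AE x in M. x \<notin> Z")
    case True
    then have "AE x in M. \<forall>\<^sub>F n in sequentially. exp (\<sigma> * real n) \<le> V n x"
      by eventually_elim (auto simp: Z_def space_UNIV eventually_sequentially not_less)
    then show ?thesis by blast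
  next
    case False
    obtain \<sigma>' where \<sigma>': "\<sigma> < \<sigma>'" "\<sigma>' < \<rho>" using dense[OF assms] by blast
    have "AE x in M. \<exists>n\<ge>1. V n x \<le> exp (\<sigma>' * real n)"
      using AE_recurrent[OF Z False]
    proof eventually_elim
      case (elim x)
      then obtain k where k: "(f ^^ k) x \<in> Z" by blast
      \<comment> \<open>From \<open>m\<close> on, the gap between \<open>\<sigma>\<close> and
        \<open>\<sigma>'\<close> absorbs the factor \<open>V k x\<close>; adding 1 keeps the
        logarithm meaningful if this factor vanishes.\<close>
      obtain m :: nat where m: "(ln (V k x + 1) - \<sigma>' * real k) / (\<sigma>' - \<sigma>) < real m"
        using reals_Archimedean2 by blast
      obtain n where n: "n \<ge> max 1 m" "V n ((f ^^ k) x) < exp (\<sigma> * real n)"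
        using k unfolding Z_def by blast
      have "ln (V k x + 1) - \<sigma>' * real k < real m * (\<sigma>' - \<sigma>)"
        using m \<sigma>' by (simp add: pos_divide_less_eq)
      also have "\<dots> \<le> real n * (\<sigma>' - \<sigma>)" using n \<sigma>' by (intro mult_right_mono) auto
      finally have *: "ln (V k x + 1) + \<sigma> * real n \<le> \<sigma>' * real (k + n)"
        by (simp add: algebra_simps)
      have "V (k + n) x \<le> V k x * V n ((f ^^ k) x)" by (rule V_add)
      also have "\<dots> \<le> (V k x + 1) * exp (\<sigma> * real n)"
        using n by (intro mult_mono V_nonneg) (auto intro: add_nonneg_nonneg V_nonneg)
      also have "\<dots> = exp (ln (V k x + 1) + \<sigma> * real n)"
        using V_nonneg[of k x] by (simp add: exp_add)
      also have "\<dots> \<le> exp (\<sigma>' * real (k + n))" using * by simp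
      finally show ?case using n by (intro exI[of _ "k + n"]) auto
    qed
    then show ?thesis using AE_growth[OF _ \<sigma>'(2)] by blast
  qed
qed

text \<open>If a truncated mean exceeded the integral of \<open>h\<close> minus
  \<open>\<sigma>\<close>, the one-step bound \<open>V1\<close> would have mean below
  \<open>\<sigma>\<close>, and \<open>V n\<close> would grow at a rate below
  \<open>\<sigma>\<close>. So the truncated means are bounded, and monotone convergence gives
  integrability.\<close>

lemma integrable_neg_log:
  assumes lower_const: "AE x in M. \<forall>\<^sub>F n in sequentially. exp (\<sigma> * real n) \<le> V n x"
  shows "integrable M (\<lambda>x. max 0 (- ln (V 1 x)))"
proof -
  note hm [measurable] = borel_measurable_integrable[OF h_int]
  define u where "u x = max 0 (- ln (V 1 x))" for x
  have [measurable]: "u \<in> borel_measurable M" unfolding u_def[abs_def] by measurable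
  have u0: "0 \<le> u x" for x by (simp add: u_def)
  have mi: "integrable M (\<lambda>x. min (u x) (real m))" for m
    by (rule integrable_const_bound[where B = "real m"]) (use u0 in auto)
  have V1: "V 1 x \<le> exp (h x - min (u x) (real m))" for x m
  proof (cases "V 1 x = 0")
    case False
    then have pos: "V 1 x > 0" using V_nonneg[of 1 x] by simp
    have "ln (V 1 x) \<le> ln (exp (h x))" using V_1[of x] pos by (subst ln_le_cancel_iff) auto
    then have "ln (V 1 x) \<le> h x" by simp
    then have "ln (V 1 x) \<le> h x - min (u x) (real m)"
      using h_nonneg[of x] by (auto simp: u_def)
    then have "exp (ln (V 1 x)) \<le> exp (h x - min (u x) (real m))" by (simp only: exp_le_cancel_iff)
    then show ?thesis using pos by (simp only: exp_ln)
  qed simp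
  have bnd: "(\<integral>x. min (u x) (real m) \<partial>M) \<le> (\<integral>x. h x \<partial>M) - \<sigma>" for m
  proof (rule ccontr)
    assume "\<not> ?thesis"
    then have "(\<integral>x. h x - min (u x) (real m) \<partial>M) < \<sigma>" using mi h_int by simp
    then obtain \<sigma>' where s: "(\<integral>x. h x - min (u x) (real m) \<partial>M) < \<sigma>'" "\<sigma>' < \<sigma>" using dense by blast
    have "AE x in M. \<exists>C. \<forall>n. V n x \<le> C * exp (\<sigma>' * real n)"
      by (rule AE_growth_of_mean[OF _ V1 s(1)]) (use mi h_int in auto)
    with lower_const have "AE x in M. False"
    proof eventually_elim
      case (elim x)
      then obtain C where C: "\<And>n. V n x \<le> C * exp (\<sigma>' * real n)" by blast
      have "\<forall>\<^sub>F n in sequentially. exp (\<sigma> * real n) \<le> C * exp (\<sigma>' * real n)"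
        using elim(1) by eventually_elim (rule order.trans[OF _ C])
      then show ?case using s(2) by (rule exp_growth_contradiction)
    qed
    then show False by simp
  qed
  have "integrable M u"
  proof (rule integrable_monotone_convergence[where f = "\<lambda>m x. min (u x) (real m)" and x = "lim (\<lambda>m. \<integral>x. min (u x) (real m) \<partial>M)"])
    show "AE x in M. mono (\<lambda>m. min (u x) (real m))" by (auto simp: mono_def)
    show "AE x in M. (\<lambda>m. min (u x) (real m)) \<longlonglongrightarrow> u x"
    proof (intro AE_I2)
      fix x
      obtain N :: nat where N: "u x \<le> real N" using real_arch_simple by blast
      have "min (u x) (real k) = u x" if "k \<ge> N" for k using N that by auto
      then show "(\<lambda>m. min (u x) (real m)) \<longlonglongrightarrow> u x"
        by (intro tendsto_eventually) (auto simp: eventually_sequentially)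
    qed
    have "incseq (\<lambda>m. \<integral>x. min (u x) (real m) \<partial>M)"
      by (intro incseq_SucI integral_mono mi) auto
    then have "convergent (\<lambda>m. \<integral>x. min (u x) (real m) \<partial>M)"
      using bnd by (metis incseq_convergent convergent_def)
    then show "(\<lambda>m. \<integral>x. min (u x) (real m) \<partial>M) \<longlonglongrightarrow> lim (\<lambda>m. \<integral>x. min (u x) (real m) \<partial>M)"
      by (simp add: convergent_LIMSEQ_iff)
  qed (use mi in auto)
  then show ?thesis by (simp add: u_def[abs_def])
qed

end

subsection \<open>Volumes of frames\<close>

text \<open>The component of \<open>v\<close> orthogonal to the span of the list. If
  \<open>w\<close> depends on \<open>ws\<close>, its residue is 0 and division by 0 makes the
  correction vanish, so dependent lists require no separate treatment.\<close>

primrec gs_residue :: "'a::real_inner list \<Rightarrow> 'a \<Rightarrow> 'a" where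
  "gs_residue [] v = v"
| "gs_residue (w # ws) v =
     gs_residue ws v - ((gs_residue ws v \<bullet> gs_residue ws w) / (gs_residue ws w \<bullet> gs_residue ws w)) *\<^sub>R gs_residue ws w"

text \<open>The volume of the parallelepiped spanned by the list, as a product of heights. This
  replaces exterior powers by induction over lists.\<close>

primrec gram_vol :: "'a::real_inner list \<Rightarrow> real" where
  "gram_vol [] = 1"
| "gram_vol (v # vs) = norm (gs_residue vs v) * gram_vol vs"

lemma gs_residue_diff_span: "v - gs_residue ws v \<in> span (set ws)"
proof (induction ws arbitrary: v)
  case (Cons w ws)
  define b where "b = gs_residue ws w"
  have mono: "span (set ws) \<subseteq> span (set (w # ws))" by (intro span_mono) auto
  have "w - b \<in> span (set (w # ws))" using Cons[of w] mono by (auto simp: b_def)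
  moreover have "w \<in> span (set (w # ws))" by (intro span_base) simp
  ultimately have b: "b \<in> span (set (w # ws))"
    using span_diff by (metis add_diff_cancel_left' diff_add_cancel)
  have "v - gs_residue ws v \<in> span (set (w # ws))" using Cons[of v] mono by auto
  then have "(v - gs_residue ws v) + ((gs_residue ws v \<bullet> b) / (b \<bullet> b)) *\<^sub>R b \<in> span (set (w # ws))"
    by (intro span_add span_scale b)
  then show ?case by (simp add: b_def algebra_simps)
qed simp

lemma gs_residue_orthogonal: "s \<in> span (set ws) \<Longrightarrow> gs_residue ws v \<bullet> s = 0"
proof (induction ws arbitrary: v s)
  case (Cons w ws)
  define b where "b = gs_residue ws w"
  define a where "a = gs_residue ws v"
  obtain k where k: "s - k *\<^sub>R w \<in> span (set ws)"
    using Cons.prems by (auto simp: span_insert)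
  have "w - b \<in> span (set ws)" unfolding b_def by (rule gs_residue_diff_span)
  then have t: "s - k *\<^sub>R w + k *\<^sub>R (w - b) \<in> span (set ws)"
    by (intro span_add[OF k] span_scale)
  define t where "t = s - k *\<^sub>R w + k *\<^sub>R (w - b)"
  have s: "s = t + k *\<^sub>R b" by (simp add: t_def algebra_simps)
  have at: "a \<bullet> t = 0" "b \<bullet> t = 0" using Cons.IH t by (auto simp: a_def b_def t_def)
  have "(a - ((a \<bullet> b) / (b \<bullet> b)) *\<^sub>R b) \<bullet> b = 0"
    by (cases "b = 0") (auto simp: inner_diff_left)
  then show ?case unfolding s
    by (simp add: a_def[symmetric] b_def[symmetric] inner_add_right inner_diff_left at)
qed simp

lemma gs_residue_unique:
  assumes "v - r \<in> span (set ws)" "\<And>s. s \<in> span (set ws) \<Longrightarrow> r \<bullet> s = 0"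
  shows "gs_residue ws v = r"
proof -
  define d where "d = gs_residue ws v - r"
  have "d = (v - r) - (v - gs_residue ws v)" by (simp add: d_def)
  also have "\<dots> \<in> span (set ws)" by (intro span_diff assms(1) gs_residue_diff_span)
  finally have "d \<in> span (set ws)" .
  then have "gs_residue ws v \<bullet> d = 0" "r \<bullet> d = 0"
    using gs_residue_orthogonal assms(2) by auto
  then have "d \<bullet> d = 0" by (simp add: d_def inner_diff_left)
  then show ?thesis by (simp add: d_def)
qed

lemma gs_residue_cong:
  assumes "span (set vs) = span (set ws)"
  shows "gs_residue vs = gs_residue ws"
proof
  fix v
  show "gs_residue vs v = gs_residue ws v"
    using gs_residue_unique[of v "gs_residue ws v" vs] gs_residue_diff_span[of v ws] gs_residue_orthogonal[of _ ws v]
    by (simp add: assms)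
qed

lemma gs_residue_scale_add:
  assumes "s \<in> span (set ws)"
  shows "gs_residue ws (c *\<^sub>R v + s) = c *\<^sub>R gs_residue ws v"
proof (rule gs_residue_unique)
  have "c *\<^sub>R (v - gs_residue ws v) + s \<in> span (set ws)"
    by (intro span_add span_scale gs_residue_diff_span assms)
  then show "c *\<^sub>R v + s - c *\<^sub>R gs_residue ws v \<in> span (set ws)"
    by (simp add: algebra_simps)
qed (simp add: gs_residue_orthogonal)

lemma norm_gs_residue_le:
  assumes "s \<in> span (set ws)"
  shows "norm (gs_residue ws v) \<le> norm (v - s)"
proof -
  define t where "t = v - gs_residue ws v - s"
  have "t \<in> span (set ws)" unfolding t_def by (intro span_diff gs_residue_diff_span assms)
  then have "gs_residue ws v \<bullet> t = 0" by (rule gs_residue_orthogonal)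
  then have "(norm (gs_residue ws v + t))\<^sup>2 = (norm (gs_residue ws v))\<^sup>2 + (norm t)\<^sup>2"
    by (intro norm_add_Pythagorean) (simp add: orthogonal_def)
  then have "(norm (gs_residue ws v))\<^sup>2 \<le> (norm (v - s))\<^sup>2" by (simp add: t_def)
  then show ?thesis by (rule power2_le_imp_le) simp
qed

lemma norm_gs_residue_le_norm: "norm (gs_residue ws v) \<le> norm v"
  using norm_gs_residue_le[OF span_zero, of ws v] by simp

lemma gram_vol_nonneg: "0 \<le> gram_vol vs"
  by (induction vs) auto

text \<open>Up to the common factor \<open>gram_vol ws\<close>, the square of either side is the
  Gram determinant of the residues of \<open>v\<close> and \<open>w\<close>, which is
  symmetric.\<close>

lemma gram_vol_swap: "gram_vol (v # w # ws) = gram_vol (w # v # ws)"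
proof -
  define a where "a = gs_residue ws v"
  define b where "b = gs_residue ws w"
  have sq: "(norm (a - ((a \<bullet> b) / (b \<bullet> b)) *\<^sub>R b) * norm b)\<^sup>2 = (a \<bullet> a) * (b \<bullet> b) - (a \<bullet> b)\<^sup>2"
    for a b :: 'a
  proof (cases "b = 0")
    case False
    then show ?thesis
      unfolding power_mult_distrib power2_norm_eq_inner
      by (simp add: inner_diff_left inner_diff_right inner_commute[of b a] field_simps power2_eq_square)
  qed simp
  have "(norm (a - ((a \<bullet> b) / (b \<bullet> b)) *\<^sub>R b) * norm b)\<^sup>2 = (norm (b - ((b \<bullet> a) / (a \<bullet> a)) *\<^sub>R a) * norm a)\<^sup>2"
    unfolding sq by (simp add: inner_commute mult.commute)
  then have "norm (a - ((a \<bullet> b) / (b \<bullet> b)) *\<^sub>R b) * norm b = norm (b - ((b \<bullet> a) / (a \<bullet> a)) *\<^sub>R a) * norm a"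
    by (rule power2_eq_imp_eq) auto
  then show ?thesis by (simp add: a_def b_def mult.assoc[symmetric])
qed

lemma gram_vol_move: "gram_vol (v # us @ ws) = gram_vol (us @ v # ws)"
proof (induction us)
  case (Cons u us)
  have "gs_residue (v # us @ ws) = gs_residue (us @ v # ws)"
    by (rule gs_residue_cong) (simp add: insert_commute)
  then have "gram_vol (u # us @ v # ws) = gram_vol (u # v # us @ ws)"
    using Cons by simp
  then show ?case using gram_vol_swap[of v u "us @ ws"] by simp
qed simp

lemma gram_vol_snoc: "gram_vol (vs @ [w]) = gram_vol (w # vs)"
  using gram_vol_move[of w vs "[]"] by simp

text \<open>Height by height: \<open>T\<close> maps the foot of a height into the new span, so the
  new height is at most the norm of the image of the old one, which stays in
  \<open>E\<close>.\<close>

lemma gram_vol_image_le: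
  assumes T: "linear T" and B: "\<And>v. v \<in> E \<Longrightarrow> norm (T v) \<le> B * norm v" and E: "subspace E" "set vs \<subseteq> E" "0 \<le> B"
  shows "gram_vol (map T vs) \<le> B ^ length vs * gram_vol vs"
  using E(2)
proof (induction vs)
  case (Cons v vs)
  have span: "T s \<in> span (set (map T vs))" if "s \<in> span (set vs)" for s
    using that linear_span_image[OF T, of "set vs"] by auto
  define s where "s = v - gs_residue vs v"
  have s: "s \<in> span (set vs)" unfolding s_def by (rule gs_residue_diff_span)
  have rE: "gs_residue vs v \<in> E"
  proof -
    have "s \<in> E" using s Cons.prems span_minimal[OF _ E(1), of "set vs"] by auto
    then have "v - s \<in> E" using Cons.prems by (intro subspace_diff E(1)) auto
    then show ?thesis by (simp add: s_def)
  qed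
  have "norm (gs_residue (map T vs) (T v)) \<le> norm (T v - T s)"
    by (intro norm_gs_residue_le span s)
  also have "T v - T s = T (gs_residue vs v)"
    by (simp add: s_def linear_diff[OF T])
  also have "norm \<dots> \<le> B * norm (gs_residue vs v)" by (rule B[OF rE])
  finally have "gram_vol (map T (v # vs)) \<le> (B * norm (gs_residue vs v)) * (B ^ length vs * gram_vol vs)"
    using Cons by (auto intro!: mult_mono gram_vol_nonneg mult_nonneg_nonneg E)
  then show ?case by (simp add: mult_ac)
qed simp

text \<open>Bounding all vectors but \<open>w\<close> by \<open>B\<close> isolates
  \<open>norm (T w)\<close>. In this way a large expansion of volume becomes a lower bound for a
  single vector.\<close>

lemma gram_vol_image_snoc_le:
  assumes T: "linear T" and B: "\<And>v. v \<in> E \<Longrightarrow> norm (T v) \<le> B * norm v" and E: "subspace E" "set vs \<subseteq> E" "0 \<le> B"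
    and w: "w \<in> E"
  shows "gram_vol (map T (vs @ [w])) * norm w \<le> B ^ length vs * gram_vol (vs @ [w]) * norm (T w)"
  using E(2)
proof (induction vs)
  case (Cons v vs)
  define us where "us = vs @ [w]"
  have us: "set us \<subseteq> E" using Cons.prems w by (auto simp: us_def)
  have span: "T s \<in> span (set (map T us))" if "s \<in> span (set us)" for s
    using that linear_span_image[OF T, of "set us"] by auto
  define s where "s = v - gs_residue us v"
  have s: "s \<in> span (set us)" unfolding s_def by (rule gs_residue_diff_span)
  have rE: "gs_residue us v \<in> E"
  proof -
    have "s \<in> E" using s us span_minimal[OF _ E(1), of "set us"] by auto
    then have "v - s \<in> E" using Cons.prems by (intro subspace_diff E(1)) auto
    then show ?thesis by (simp add: s_def)
  qed
  have "norm (gs_residue (map T us) (T v)) \<le> norm (T v - T s)"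
    by (intro norm_gs_residue_le span s)
  also have "T v - T s = T (gs_residue us v)"
    by (simp add: s_def linear_diff[OF T])
  also have "norm \<dots> \<le> B * norm (gs_residue us v)" by (rule B[OF rE])
  finally have "norm (gs_residue (map T us) (T v)) * (gram_vol (map T us) * norm w)
      \<le> (B * norm (gs_residue us v)) * (B ^ length vs * gram_vol us * norm (T w))"
    using Cons by (auto simp: us_def intro!: mult_mono gram_vol_nonneg mult_nonneg_nonneg E)
  then show ?case by (simp add: us_def[symmetric] mult_ac)
qed simp

text \<open>Steinitz exchange; the factor by which the volume changes does not depend on the linear
  map applied afterwards.\<close>

lemma gram_vol_exchange:
  assumes "w \<in> span (set vs)" "w \<noteq> 0"
  shows "\<exists>us c. Suc (length us) = length vs \<and> c > 0 \<and> set us \<subseteq> set vs \<and>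
           span (set (w # us)) = span (set vs) \<and>
           (\<forall>T :: 'a::real_inner \<Rightarrow> 'b::real_inner. linear T \<longrightarrow> gram_vol (map T (w # us)) = c * gram_vol (map T vs)) \<and>
           gram_vol (w # us) = c * gram_vol vs"
  using assms(1)
proof (induction vs)
  case Nil
  then show ?case using assms(2) by simp
next
  case (Cons v vs)
  obtain k where k: "w - k *\<^sub>R v \<in> span (set vs)"
    using Cons.prems by (auto simp: span_insert)
  show ?case
  proof (cases "k = 0")
    case False
    define s where "s = w - k *\<^sub>R v"
    have w: "w = k *\<^sub>R v + s" and s: "s \<in> span (set vs)" using k by (auto simp: s_def)
    have "gram_vol (map T (w # vs)) = \<bar>k\<bar> * gram_vol (map T (v # vs))" if T: "linear T" for T :: "'a \<Rightarrow> 'b"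
    proof -
      have "T s \<in> span (set (map T vs))"
        using s linear_span_image[OF T, of "set vs"] by auto
      then show ?thesis
        by (simp add: w linear_add[OF T] linear_cmul[OF T] gs_residue_scale_add)
    qed
    moreover have "gram_vol (w # vs) = \<bar>k\<bar> * gram_vol (v # vs)"
      using s by (simp add: w gs_residue_scale_add)
    moreover have "span (set (w # vs)) = span (set (v # vs))"
    proof -
      have "span (insert w (set vs)) = span (insert v (set vs))"
      proof (rule span_eq[THEN iffD2], intro conjI)
        show "insert w (set vs) \<subseteq> span (insert v (set vs))"
          using Cons.prems by (auto intro: span_base)
        have "v = (1 / k) *\<^sub>R (w - s)" using False by (simp add: w)
        also have "\<dots> \<in> span (insert w (set vs))"
          using s span_mono[of "set vs" "insert w (set vs)"] by (intro span_scale span_diff) (auto intro: span_base)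
        finally show "insert v (set vs) \<subseteq> span (insert w (set vs))" by (auto intro: span_base)
      qed
      then show ?thesis by simp
    qed
    ultimately show ?thesis using False by (intro exI[of _ vs] exI[of _ "\<bar>k\<bar>"]) auto
  next
    case True
    then have "w \<in> span (set vs)" using k by simp
    then obtain us c where IH: "Suc (length us) = length vs" "c > 0" "set us \<subseteq> set vs" "span (set (w # us)) = span (set vs)"
      "\<And>T :: 'a \<Rightarrow> 'b. linear T \<Longrightarrow> gram_vol (map T (w # us)) = c * gram_vol (map T vs)"
      "gram_vol (w # us) = c * gram_vol vs"
      using Cons.IH by blast
    have "gram_vol (map T (w # v # us)) = c * gram_vol (map T (v # vs))" if T: "linear T" for T :: "'a \<Rightarrow> 'b"
    proof -
      have "span (set (map T (w # us))) = span (set (map T vs))"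
        using IH(4) linear_span_image[OF T, of "set (w # us)"] linear_span_image[OF T, of "set vs"]
        by (simp only: set_map)
      then have "gs_residue (map T (w # us)) = gs_residue (map T vs)" by (rule gs_residue_cong)
      then have "gram_vol (T v # map T (w # us)) = c * gram_vol (map T (v # vs))"
        using IH(5)[OF T] by (simp del: gs_residue.simps)
      then show ?thesis using gram_vol_swap[of "T w" "T v" "map T us"] by simp
    qed
    moreover have "gram_vol (w # v # us) = c * gram_vol (v # vs)"
      using gs_residue_cong[OF IH(4)] IH(6) gram_vol_swap[of w v us] by simp
    moreover have "span (set (w # v # us)) = span (set (v # vs))"
    proof -
      have "span (insert v (set (w # us))) = span (insert v (set vs))"
        using IH(4) by (auto simp: span_insert)
      then show ?thesis by (simp add: insert_commute)
    qed
    ultimately show ?thesis using IH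
      by (intro exI[of _ "v # us"] exI[of _ c]) auto
  qed
qed

text \<open>Residues are continuous only at nondegenerate frames, where the divisors do not tend to
  0. Both limits are proved together because each induction step divides by residues of the shorter
  list.\<close>

lemma gs_residue_gram_vol_tendsto:
  assumes "list_all2 (\<lambda>s l. s \<longlonglongrightarrow> l) ss ls" "gram_vol ls > 0"
  shows "(\<forall>v l. v \<longlonglongrightarrow> l \<longrightarrow> (\<lambda>n::nat. gs_residue (map (\<lambda>s. s n) ss) (v n)) \<longlonglongrightarrow> gs_residue ls l) \<and>
         (\<lambda>n. gram_vol (map (\<lambda>s. s n) ss)) \<longlonglongrightarrow> gram_vol ls"
  using assms
proof (induction rule: list_all2_induct)
  case (Cons s ss l ls)
  have pos: "gram_vol ls > 0" "gs_residue ls l \<noteq> 0"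
    using Cons.prems gram_vol_nonneg[of ls] by (auto simp: zero_less_mult_iff)
  note IH = Cons.IH[OF pos(1)]
  have s: "(\<lambda>n. gs_residue (map (\<lambda>s. s n) ss) (s n)) \<longlonglongrightarrow> gs_residue ls l"
    using IH Cons.hyps(1) by blast
  have "(\<lambda>n. gs_residue (map (\<lambda>s. s n) (s # ss)) (v n)) \<longlonglongrightarrow> gs_residue (l # ls) k"
    if "v \<longlonglongrightarrow> k" for v k
  proof -
    have "(\<lambda>n. gs_residue (map (\<lambda>s. s n) ss) (v n)) \<longlonglongrightarrow> gs_residue ls k"
      using IH that by blast
    then show ?thesis using s pos(2) by (auto intro!: tendsto_intros)
  qed
  then show ?case using IH s by (auto intro!: tendsto_intros)
qed simp

lemma gram_vol_pos_independent:
  assumes "gram_vol vs > 0"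
  shows "independent (set vs)" and "distinct vs"
proof -
  have "independent (set vs) \<and> distinct vs"
    using assms
  proof (induction vs)
    case (Cons v vs)
    have pos: "gram_vol vs > 0" "gs_residue vs v \<noteq> 0"
      using Cons.prems gram_vol_nonneg[of vs] by (auto simp: zero_less_mult_iff)
    have "v \<notin> span (set vs)"
    proof
      assume "v \<in> span (set vs)"
      then have "norm (gs_residue vs v) \<le> norm (v - v)" by (rule norm_gs_residue_le)
      then show False using pos(2) by simp
    qed
    then show ?case using Cons.IH[OF pos(1)] by (auto simp: independent_insert intro: span_base)
  qed (simp add: independent_empty)
  then show "independent (set vs)" "distinct vs" by auto
qed

section \<open>Countable dense frames and measurability\<close>

definition dense_vecs :: "'a::second_countable_topology set" where
  "dense_vecs = (SOME D. countable D \<and> (\<forall>X. open X \<longrightarrow> X \<noteq> {} \<longrightarrow> (\<exists>d\<in>D. d \<in> X)))"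

lemma dense_vecs: "countable (dense_vecs :: 'a::second_countable_topology set)"
    "open X \<Longrightarrow> X \<noteq> {} \<Longrightarrow> \<exists>d\<in>(dense_vecs :: 'a set). d \<in> X"
proof -
  have "\<exists>D::'a set. countable D \<and> (\<forall>X. open X \<longrightarrow> X \<noteq> {} \<longrightarrow> (\<exists>d\<in>D. d \<in> X))"
    using countable_dense_exists by blast
  then have "countable (dense_vecs :: 'a set) \<and> (\<forall>X. open X \<longrightarrow> X \<noteq> {} \<longrightarrow> (\<exists>d\<in>dense_vecs :: 'a set. d \<in> X))"
    unfolding dense_vecs_def by (rule someI_ex)
  then show "countable (dense_vecs :: 'a set)"
    "open X \<Longrightarrow> X \<noteq> {} \<Longrightarrow> \<exists>d\<in>(dense_vecs :: 'a set). d \<in> X" by auto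
qed

lemma dense_vecs_seq:
  fixes v :: "'a::{second_countable_topology, metric_space}"
  obtains s where "\<And>n::nat. s n \<in> dense_vecs" "s \<longlonglongrightarrow> v"
proof -
  have "v \<in> closure dense_vecs"
    unfolding closure_iff_nhds_not_empty using dense_vecs(2) by fastforce
  then show ?thesis using that by (auto simp: closure_sequential)
qed

lemma borel_measurable_mat_vec [measurable (raw)]:
  fixes F :: "'a \<Rightarrow> real^'n^'m"
  assumes [measurable]: "F \<in> borel_measurable M" "g \<in> borel_measurable M"
  shows "(\<lambda>x. F x *v g x) \<in> borel_measurable M"
  by (rule borel_measurable_continuous_Pair[OF assms])
     (auto simp: matrix_vector_mult_def intro!: continuous_intros)

lemma borel_measurable_mat_mat [measurable (raw)]:
  fixes F :: "'a \<Rightarrow> real^'n^'m" and G :: "'a \<Rightarrow> real^'k^'n"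
  assumes [measurable]: "F \<in> borel_measurable M" "G \<in> borel_measurable M"
  shows "(\<lambda>x. F x ** G x) \<in> borel_measurable M"
  by (rule borel_measurable_continuous_Pair[OF assms])
     (auto simp: matrix_matrix_mult_def intro!: continuous_intros)

text \<open>Where the family is unbounded, the supremum is one fixed junk value, so measurability
  survives there.\<close>

lemma borel_measurable_cSUP_real:
  fixes F :: "_ \<Rightarrow> _ \<Rightarrow> real"
  assumes [simp]: "countable I" and F: "\<And>i. i \<in> I \<Longrightarrow> F i \<in> borel_measurable M"
  shows "(\<lambda>x. SUP i\<in>I. F i x) \<in> borel_measurable M"
proof -
  have "(\<lambda>x. - (INF i\<in>I. - F i x)) \<in> borel_measurable M"
    by (intro borel_measurable_uminus borel_measurable_cINF_real F) auto
  then show ?thesis by (simp add: Inf_real_def image_image)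
qed

lemma gs_residue_measurable:
  fixes gs :: "('a \<Rightarrow> 'b::euclidean_space) list"
  assumes "\<And>g. g \<in> set gs \<Longrightarrow> g \<in> borel_measurable M" "k \<in> borel_measurable M"
  shows "(\<lambda>x. gs_residue (map (\<lambda>g. g x) gs) (k x)) \<in> borel_measurable M"
  using assms
proof (induction gs arbitrary: k)
  case (Cons g gs)
  have 1 [measurable]: "(\<lambda>x. gs_residue (map (\<lambda>g. g x) gs) (k x)) \<in> borel_measurable M"
    using Cons by auto
  have 2 [measurable]: "(\<lambda>x. gs_residue (map (\<lambda>g. g x) gs) (g x)) \<in> borel_measurable M"
    using Cons by auto
  show ?case by simp
qed simp

lemma gram_vol_measurable:
  fixes gs :: "('a \<Rightarrow> 'b::euclidean_space) list"
  assumes "\<And>g. g \<in> set gs \<Longrightarrow> g \<in> borel_measurable M"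
  shows "(\<lambda>x. gram_vol (map (\<lambda>g. g x) gs)) \<in> borel_measurable M"
  using assms
proof (induction gs)
  case (Cons g gs)
  have [measurable]: "(\<lambda>x. gs_residue (map (\<lambda>g. g x) gs) (g x)) \<in> borel_measurable M"
    by (rule gs_residue_measurable) (use Cons in auto)
  have [measurable]: "(\<lambda>x. gram_vol (map (\<lambda>g. g x) gs)) \<in> borel_measurable M"
    using Cons by auto
  show ?case by simp
qed simp

text \<open>The largest factor by which \<open>T\<close> expands \<open>p\<close>-dimensional volumes in the range of the
  projection \<open>P\<close>, i.e. the norm of the \<open>p\<close>-th exterior power of the restriction. The supremum is
  taken over a countable set of frames to make measurability evident; degenerate frames contribute
  \<open>0 / 0 = 0\<close>.\<close>

definition proj_vol :: "nat \<Rightarrow> real^'d^'d \<Rightarrow> real^'d^'d \<Rightarrow> real" where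
  "proj_vol p T P = (SUP vs\<in>{vs \<in> lists dense_vecs. length vs = p}.
     gram_vol (map (\<lambda>w. T *v (P *v w)) vs) / gram_vol (map ((*v) P) vs))"

lemma countable_frames: "countable {vs \<in> lists (dense_vecs :: (real^'d) set). length vs = p}"
  by (rule countable_subset[OF _ countable_lists[OF dense_vecs(1)]]) auto

lemma frames_nonempty: "{vs \<in> lists (dense_vecs :: (real^'d) set). length vs = p} \<noteq> {}"
proof -
  obtain d :: "real^'d" where "d \<in> dense_vecs" using dense_vecs(2)[of UNIV] by auto
  then have "replicate p d \<in> {vs \<in> lists dense_vecs. length vs = p}" by auto
  then show ?thesis by blast
qed

lemma proj_vol_measurable [measurable (raw)]:
  fixes T P :: "'x \<Rightarrow> real^'d^'d"
  assumes [measurable]: "T \<in> borel_measurable M" "P \<in> borel_measurable M"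
  shows "(\<lambda>x. proj_vol p (T x) (P x)) \<in> borel_measurable M"
  unfolding proj_vol_def
proof (rule borel_measurable_cSUP_real[OF countable_frames])
  fix vs :: "(real^'d) list"
  have "(\<lambda>x. gram_vol (map (\<lambda>g. g x) (map (\<lambda>w x. T x *v (P x *v w)) vs))) \<in> borel_measurable M"
    by (rule gram_vol_measurable) auto
  moreover have "(\<lambda>x. gram_vol (map (\<lambda>g. g x) (map (\<lambda>w x. P x *v w) vs))) \<in> borel_measurable M"
    by (rule gram_vol_measurable) auto
  ultimately show "(\<lambda>x. gram_vol (map (\<lambda>w. T x *v (P x *v w)) vs) / gram_vol (map ((*v) (P x)) vs)) \<in> borel_measurable M"
    by (simp add: o_def)
qed

lemma subspace_range_mat: "subspace (range ((*v) (P :: real^'d^'d)))"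
  by (rule linear_subspace_image[OF matrix_vector_mul_linear subspace_UNIV])

lemma norm_mat_vec_le: "norm (T *v v) \<le> onorm ((*v) T) * norm v"
  for T :: "real^'d^'d"
  by (rule onorm[OF matrix_vector_mul_bounded_linear])

lemma onorm_mat_nonneg: "0 \<le> onorm ((*v) T)"
  for T :: "real^'d^'d"
  by (rule onorm_pos_le[OF matrix_vector_mul_bounded_linear])

lemma proj_vol_bdd:
  fixes T P :: "real^'d^'d"
  shows "bdd_above ((\<lambda>vs. gram_vol (map (\<lambda>w. T *v (P *v w)) vs) / gram_vol (map ((*v) P) vs)) `
     {vs \<in> lists dense_vecs. length vs = p})"
proof (rule bdd_aboveI2)
  fix vs :: "(real^'d) list" assume "vs \<in> {vs \<in> lists dense_vecs. length vs = p}"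
  then have p: "length vs = p" by simp
  have "gram_vol (map ((*v) T) (map ((*v) P) vs)) \<le> onorm ((*v) T) ^ length (map ((*v) P) vs) * gram_vol (map ((*v) P) vs)"
    by (rule gram_vol_image_le[where E = UNIV]) (auto simp: norm_mat_vec_le onorm_mat_nonneg)
  then show "gram_vol (map (\<lambda>w. T *v (P *v w)) vs) / gram_vol (map ((*v) P) vs) \<le> onorm ((*v) T) ^ p"
    using gram_vol_nonneg[of "map ((*v) P) vs"] p onorm_mat_nonneg[of T]
    by (cases "gram_vol (map ((*v) P) vs) = 0") (auto simp: o_def pos_divide_le_eq less_le)
qed

lemma proj_vol_nonneg: "0 \<le> proj_vol p T P"
proof -
  obtain vs :: "(real^'a) list" where vs: "vs \<in> {vs \<in> lists dense_vecs. length vs = p}"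
    using frames_nonempty by blast
  have "0 \<le> gram_vol (map (\<lambda>w. T *v (P *v w)) vs) / gram_vol (map ((*v) P) vs)"
    by (simp add: gram_vol_nonneg)
  also have "\<dots> \<le> proj_vol p T P"
    unfolding proj_vol_def by (rule cSUP_upper[OF vs proj_vol_bdd])
  finally show ?thesis .
qed

lemma proj_vol_le:
  assumes "\<And>vs. set vs \<subseteq> range ((*v) P) \<Longrightarrow> length vs = p \<Longrightarrow> gram_vol (map ((*v) T) vs) \<le> c * gram_vol vs" "0 \<le> c"
  shows "proj_vol p T P \<le> c"
  unfolding proj_vol_def
proof (rule cSUP_least[OF frames_nonempty])
  fix vs :: "(real^'a) list" assume "vs \<in> {vs \<in> lists dense_vecs. length vs = p}"
  then have "gram_vol (map ((*v) T) (map ((*v) P) vs)) \<le> c * gram_vol (map ((*v) P) vs)"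
    by (intro assms(1)) auto
  then show "gram_vol (map (\<lambda>w. T *v (P *v w)) vs) / gram_vol (map ((*v) P) vs) \<le> c"
    using gram_vol_nonneg[of "map ((*v) P) vs"] assms(2)
    by (cases "gram_vol (map ((*v) P) vs) = 0") (auto simp: o_def pos_divide_le_eq less_le)
qed

text \<open>Passes from dense frames to all frames in the range. A frame with nondegenerate image is
  itself nondegenerate, so the volume is continuous at both, and images under \<open>P\<close> of
  dense vectors approximate it.\<close>

lemma gram_vol_le_proj_vol:
  fixes T P :: "real^'d^'d"
  assumes vs: "set vs \<subseteq> range ((*v) P)" and len: "length vs = p"
  shows "gram_vol (map ((*v) T) vs) \<le> proj_vol p T P * gram_vol vs"
proof (cases "gram_vol (map ((*v) T) vs) = 0")
  case True
  then show ?thesis by (simp add: proj_vol_nonneg gram_vol_nonneg)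
next
  case False
  then have pos1: "gram_vol (map ((*v) T) vs) > 0"
    using gram_vol_nonneg[of "map ((*v) T) vs"] by simp
  have "gram_vol (map ((*v) T) vs) \<le> onorm ((*v) T) ^ length vs * gram_vol vs"
    by (rule gram_vol_image_le[where E = UNIV]) (auto simp: norm_mat_vec_le onorm_mat_nonneg)
  then have pos2: "gram_vol vs > 0"
    using pos1 gram_vol_nonneg[of vs] by (cases "gram_vol vs = 0") auto
  have "\<exists>ss. list_all2 (\<lambda>s l. (\<forall>n::nat. s n \<in> dense_vecs) \<and> (\<lambda>n. P *v s n) \<longlonglongrightarrow> l) ss vs"
    using vs
  proof (induction vs)
    case (Cons v vs)
    then obtain ss where ss: "list_all2 (\<lambda>s l. (\<forall>n::nat. s n \<in> dense_vecs) \<and> (\<lambda>n. P *v s n) \<longlonglongrightarrow> l) ss vs" by auto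
    obtain w where w: "v = P *v w" using Cons by auto
    obtain s where s: "\<And>n::nat. s n \<in> dense_vecs" "s \<longlonglongrightarrow> w" using dense_vecs_seq by blast
    have "(\<lambda>n. P *v s n) \<longlonglongrightarrow> v"
      unfolding w by (rule bounded_linear.tendsto[OF matrix_vector_mul_bounded_linear s(2)])
    then show ?case using s ss by (intro exI[of _ "s # ss"]) auto
  qed (auto intro: exI[of _ "[]"])
  then obtain ss where ss: "list_all2 (\<lambda>s l. (\<forall>n::nat. s n \<in> dense_vecs) \<and> (\<lambda>n. P *v s n) \<longlonglongrightarrow> l) ss vs" ..
  define fr where "fr n = map (\<lambda>s. s n) ss" for n
  have "set ss \<subseteq> {s. \<forall>n. s n \<in> dense_vecs}"
    using ss by (auto simp: list_all2_conv_all_nth in_set_conv_nth)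
  then have fr: "fr n \<in> {vs \<in> lists dense_vecs. length vs = p}" for n
    using list_all2_lengthD[OF ss] len by (fastforce simp: fr_def)
  have "list_all2 (\<lambda>s l. s \<longlonglongrightarrow> l) (map (\<lambda>s n. P *v s n) ss) vs"
    using ss by (simp add: list_all2_map1 list_all2_mono)
  from conjunct2[OF gs_residue_gram_vol_tendsto[OF this pos2]]
  have l1: "(\<lambda>n. gram_vol (map ((*v) P) (fr n))) \<longlonglongrightarrow> gram_vol vs"
    by (simp add: fr_def o_def)
  have "list_all2 (\<lambda>s l. s \<longlonglongrightarrow> l) (map (\<lambda>s n. T *v (P *v s n)) ss) (map ((*v) T) vs)"
    unfolding list_all2_map1 list_all2_map2
    using ss by (rule list_all2_mono) (auto intro: bounded_linear.tendsto[OF matrix_vector_mul_bounded_linear])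
  from conjunct2[OF gs_residue_gram_vol_tendsto[OF this pos1]]
  have l2: "(\<lambda>n. gram_vol (map (\<lambda>w. T *v (P *v w)) (fr n))) \<longlonglongrightarrow> gram_vol (map ((*v) T) vs)"
    by (simp add: fr_def o_def)
  have "(\<lambda>n. gram_vol (map (\<lambda>w. T *v (P *v w)) (fr n)) / gram_vol (map ((*v) P) (fr n)))
      \<longlonglongrightarrow> gram_vol (map ((*v) T) vs) / gram_vol vs"
    using l1 l2 pos2 by (intro tendsto_divide) auto
  then have "gram_vol (map ((*v) T) vs) / gram_vol vs \<le> proj_vol p T P"
    by (rule LIMSEQ_le_const2) (auto simp: proj_vol_def intro!: exI[of _ 0] cSUP_upper[OF fr proj_vol_bdd])
  then show ?thesis using pos2 by (simp add: pos_divide_le_eq)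
qed

lemma proj_vol_submult:
  fixes S T P P' :: "real^'d^'d"
  assumes "\<And>w. T *v (P *v w) \<in> range ((*v) P')"
  shows "proj_vol p (S ** T) P \<le> proj_vol p S P' * proj_vol p T P"
proof (rule proj_vol_le)
  fix vs assume vs: "set vs \<subseteq> range ((*v) P)" "length vs = p"
  have "gram_vol (map ((*v) (S ** T)) vs) = gram_vol (map ((*v) S) (map ((*v) T) vs))"
    by (simp add: o_def matrix_vector_mul_assoc)
  also have "\<dots> \<le> proj_vol p S P' * gram_vol (map ((*v) T) vs)"
    using vs assms by (intro gram_vol_le_proj_vol) auto
  also have "\<dots> \<le> proj_vol p S P' * (proj_vol p T P * gram_vol vs)"
    by (intro mult_left_mono gram_vol_le_proj_vol vs proj_vol_nonneg)
  finally show "gram_vol (map ((*v) (S ** T)) vs) \<le> proj_vol p S P' * proj_vol p T P * gram_vol vs"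
    by (simp add: mult_ac)
qed (simp add: proj_vol_nonneg)

lemma proj_vol_le_power:
  assumes "\<And>v. v \<in> range ((*v) P) \<Longrightarrow> norm (T *v v) \<le> B * norm v" "0 \<le> B"
  shows "proj_vol p T P \<le> B ^ p"
proof (rule proj_vol_le)
  fix vs assume vs: "set vs \<subseteq> range ((*v) P)" "length vs = p"
  show "gram_vol (map ((*v) T) vs) \<le> B ^ p * gram_vol vs"
    using gram_vol_image_le[OF matrix_vector_mul_linear assms(1) subspace_range_mat vs(1) assms(2)] vs(2) by simp
qed (simp add: assms)

lemma norm_le_proj_vol:
  assumes "v \<in> range ((*v) P)"
  shows "norm (T *v v) \<le> proj_vol 1 T P * norm v"
  using gram_vol_le_proj_vol[of "[v]" P 1 T] assms by simp

lemma proj_vol_mat_1: "proj_vol p (mat 1) P \<le> 1"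
proof -
  have id: "(*v) (mat 1) = (\<lambda>v :: real^'a. v)" by auto
  show ?thesis by (rule proj_vol_le) (auto simp: id)
qed

lemma proj_vol_0 [simp]: "proj_vol 0 T P = 1"
proof (rule antisym)
  show "proj_vol 0 T P \<le> 1" by (rule proj_vol_le) auto
  show "1 \<le> proj_vol 0 T P" using gram_vol_le_proj_vol[of "[]" P 0 T] by simp
qed

lemma proj_vol_eq_0:
  fixes T P :: "real^'d^'d"
  assumes "p > dim (range ((*v) P))"
  shows "proj_vol p T P = 0"
proof -
  have "proj_vol p T P \<le> 0"
  proof (rule proj_vol_le)
    fix vs assume vs: "set vs \<subseteq> range ((*v) P)" "length vs = p"
    have "gram_vol vs = 0"
    proof (rule ccontr)
      assume "gram_vol vs \<noteq> 0"
      then have "gram_vol vs > 0" using gram_vol_nonneg[of vs] by simp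
      then have "independent (set vs)" "card (set vs) = p"
        using gram_vol_pos_independent vs(2) distinct_card by auto
      then show False using independent_card_le_dim[OF vs(1)] assms by simp
    qed
    moreover have "gram_vol (map ((*v) T) vs) \<le> onorm ((*v) T) ^ length vs * gram_vol vs"
      by (rule gram_vol_image_le[where E = UNIV]) (auto simp: norm_mat_vec_le onorm_mat_nonneg)
    ultimately show "gram_vol (map ((*v) T) vs) \<le> 0 * gram_vol vs" by simp
  qed simp
  then show ?thesis using proj_vol_nonneg[of p T P] by simp
qed

text \<open>A frame that almost realizes the maximal expansion spans a fast subspace; its
  \<open>T\<close>-orthogonal complement is slow.\<close>

lemma fast_slow_splitting:
  fixes T P :: "real^'d^'d"
  defines "E \<equiv> range ((*v) P)"
  assumes pos: "proj_vol q T P > 0"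
    and B: "\<And>v. v \<in> E \<Longrightarrow> norm (T *v v) \<le> B * norm v" "0 \<le> B"
  obtains S where "subspace S" "S \<subseteq> E" "dim S = q"
    "\<And>w. w \<in> S \<Longrightarrow> proj_vol q T P * norm w \<le> 2 * B ^ (q - 1) * norm (T *v w)"
    "\<And>e. e \<in> E \<Longrightarrow> \<exists>w\<in>S. (T *v (e - w)) \<bullet> (T *v w) = 0 \<and>
        proj_vol q T P * norm (T *v (e - w)) \<le> 2 * proj_vol (Suc q) T P * norm (e - w)"
proof -
  note subE = subspace_range_mat[of P, folded E_def]
  \<comment> \<open>Some frame exceeds half of the positive supremum; the factors 2 in both
    estimates stem from this.\<close>
  have "proj_vol q T P / 2 < proj_vol q T P" using pos by simp
  moreover have "proj_vol q T P \<le> c"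
    if "\<And>ws. length ws = q \<Longrightarrow> gram_vol (map (\<lambda>w. T *v (P *v w)) ws) / gram_vol (map ((*v) P) ws) \<le> c" for c
    unfolding proj_vol_def by (rule cSUP_least[OF frames_nonempty]) (use that in auto)
  ultimately obtain ws where ws: "length ws = q"
     and gt: "proj_vol q T P / 2 < gram_vol (map (\<lambda>w. T *v (P *v w)) ws) / gram_vol (map ((*v) P) ws)"
    by (meson not_le)
  define vs where "vs = map ((*v) P) ws"
  have vsE: "set vs \<subseteq> E" by (auto simp: vs_def E_def)
  have len: "length vs = q" using ws by (simp add: vs_def)
  have gt: "proj_vol q T P / 2 < gram_vol (map ((*v) T) vs) / gram_vol vs"
    using gt by (simp add: vs_def o_def)
  have vpos: "gram_vol vs > 0"
    using gt pos gram_vol_nonneg[of vs] by (cases "gram_vol vs = 0") auto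
  have Tge: "proj_vol q T P * gram_vol vs \<le> 2 * gram_vol (map ((*v) T) vs)"
    using gt vpos by (simp add: field_simps)
  have Tpos: "gram_vol (map ((*v) T) vs) > 0"
    using Tge pos vpos by (smt (verit) mult_pos_pos)
  define S where "S = span (set vs)"
  have SE: "S \<subseteq> E" unfolding S_def by (rule span_minimal[OF vsE subE])
  have "dim S = q"
    using gram_vol_pos_independent[OF vpos] len distinct_card[of vs]
    by (simp add: S_def dim_eq_card_independent)
  moreover have "proj_vol q T P * norm w \<le> 2 * B ^ (q - 1) * norm (T *v w)" if w: "w \<in> S" for w
  proof (cases "w = 0")
    case False
    \<comment> \<open>Exchange a frame vector for \<open>w\<close>. The factor \<open>c\<close> is
      the same before and after \<open>T\<close>, so the new frame is expanded exactly as much as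
      the old one.\<close>
    obtain us c where us: "Suc (length us) = length vs" "c > 0" "set us \<subseteq> set vs"
      "gram_vol (map ((*v) T) (w # us)) = c * gram_vol (map ((*v) T) vs)"
      "gram_vol (w # us) = c * gram_vol vs"
      using gram_vol_exchange[OF w[unfolded S_def] False, where ?'b = "real^'d"] matrix_vector_mul_linear by metis
    have usE: "set us \<subseteq> E" "w \<in> E" using us(3) vsE w SE by auto
    have "gram_vol (map ((*v) T) (us @ [w])) * norm w \<le> B ^ length us * gram_vol (us @ [w]) * norm (T *v w)"
      by (rule gram_vol_image_snoc_le[OF matrix_vector_mul_linear B(1) subE usE(1) B(2) usE(2)])
    moreover have "gram_vol (map ((*v) T) (us @ [w])) = gram_vol (map ((*v) T) (w # us))"
      using gram_vol_snoc[of "map ((*v) T) us" "T *v w"] by simp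
    ultimately have le: "c * gram_vol (map ((*v) T) vs) * norm w \<le> B ^ (q - 1) * (c * gram_vol vs) * norm (T *v w)"
      using us len by (simp only: gram_vol_snoc) (metis Suc_eq_plus1 add_diff_cancel_right')
    have "(c * gram_vol vs) * (proj_vol q T P * norm w) = c * norm w * (proj_vol q T P * gram_vol vs)"
      by simp
    also have "\<dots> \<le> c * norm w * (2 * gram_vol (map ((*v) T) vs))"
      using us(2) by (intro mult_left_mono Tge) auto
    also have "\<dots> \<le> (c * gram_vol vs) * (2 * B ^ (q - 1) * norm (T *v w))"
      using le by (simp add: mult_ac)
    finally show ?thesis using us(2) vpos by simp
  qed simp
  moreover have "\<exists>w\<in>S. (T *v (e - w)) \<bullet> (T *v w) = 0 \<and>
        proj_vol q T P * norm (T *v (e - w)) \<le> 2 * proj_vol (Suc q) T P * norm (e - w)" if e: "e \<in> E" for e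
  proof -
    define Tvs where "Tvs = map ((*v) T) vs"
    have spT: "span (set Tvs) = (*v) T ` S"
      unfolding Tvs_def S_def by (simp add: linear_span_image)
    \<comment> \<open>\<open>w\<close> is chosen so that \<open>T *v w\<close> is the orthogonal
      projection of \<open>T *v e\<close> onto the image of \<open>S\<close>.\<close>
    obtain w where w: "w \<in> S" "T *v e - gs_residue Tvs (T *v e) = T *v w"
      using gs_residue_diff_span[of "T *v e" Tvs] spT by auto
    have Tu: "T *v (e - w) = gs_residue Tvs (T *v e)"
      using w(2) by (simp add: matrix_vector_mult_diff_distrib algebra_simps)
    have orth: "(T *v (e - w)) \<bullet> s = 0" if "s \<in> span (set Tvs)" for s
      unfolding Tu using that by (rule gs_residue_orthogonal)
    have res: "gs_residue Tvs (T *v (e - w)) = T *v (e - w)"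
      by (rule gs_residue_unique) (auto simp: orth span_zero)
    have uE: "e - w \<in> E" using e w SE by (intro subspace_diff subE) auto
    \<comment> \<open>The image of \<open>e - w\<close> is orthogonal to the image of the frame, so
      the volume of the enlarged image frame is a product.\<close>
    have "norm (T *v (e - w)) * gram_vol Tvs = gram_vol (map ((*v) T) ((e - w) # vs))"
      by (simp add: res[unfolded Tvs_def] Tvs_def)
    also have "\<dots> \<le> proj_vol (Suc q) T P * gram_vol ((e - w) # vs)"
      using vsE uE len unfolding E_def by (intro gram_vol_le_proj_vol) auto
    also have "\<dots> \<le> proj_vol (Suc q) T P * (norm (e - w) * gram_vol vs)"
      using norm_gs_residue_le_norm[of vs "e - w"]
      by (auto intro!: mult_left_mono mult_right_mono proj_vol_nonneg gram_vol_nonneg)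
    finally have le: "norm (T *v (e - w)) * gram_vol Tvs \<le> proj_vol (Suc q) T P * (norm (e - w) * gram_vol vs)" .
    have "gram_vol vs * (proj_vol q T P * norm (T *v (e - w))) = norm (T *v (e - w)) * (proj_vol q T P * gram_vol vs)"
      by simp
    also have "\<dots> \<le> norm (T *v (e - w)) * (2 * gram_vol Tvs)"
      using Tge by (intro mult_left_mono) (auto simp: Tvs_def)
    also have "\<dots> \<le> gram_vol vs * (2 * proj_vol (Suc q) T P * norm (e - w))"
      using le by (simp add: mult_ac)
    finally have "proj_vol q T P * norm (T *v (e - w)) \<le> 2 * proj_vol (Suc q) T P * norm (e - w)"
      using vpos by simp
    moreover have "(T *v (e - w)) \<bullet> (T *v w) = 0"
      using w by (intro orth) (auto simp: spT)
    ultimately show ?thesis using w(1) by blast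
  qed
  ultimately show ?thesis using that[of S] SE by (simp add: S_def)
qed

subsection \<open>Slow vectors\<close>

lemma exp_bound_of_eventually:
  assumes "\<forall>\<^sub>F n in sequentially. g n \<le> exp (\<rho> * real n)"
  obtains C :: real where "C \<ge> 1" "\<And>n. g n \<le> C * exp (\<rho> * real n)"
proof -
  obtain N where N: "\<And>n. n \<ge> N \<Longrightarrow> g n \<le> exp (\<rho> * real n)"
    using assms by (auto simp: eventually_sequentially)
  define C where "C = 1 + (\<Sum>n<N. \<bar>g n\<bar> * exp (- (\<rho> * real n)))"
  have s: "0 \<le> (\<Sum>n<N. \<bar>g n\<bar> * exp (- (\<rho> * real n)))" by (intro sum_nonneg) auto
  have "g n \<le> C * exp (\<rho> * real n)" for n
  proof (cases "n < N")
    case True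
    then have "\<bar>g n\<bar> * exp (- (\<rho> * real n)) \<le> (\<Sum>n<N. \<bar>g n\<bar> * exp (- (\<rho> * real n)))"
      by (intro member_le_sum) auto
    then have "\<bar>g n\<bar> * exp (- (\<rho> * real n)) \<le> C" by (simp add: C_def)
    then have "\<bar>g n\<bar> \<le> C * exp (\<rho> * real n)" by (simp add: exp_minus field_simps)
    then show ?thesis by simp
  next
    case False
    then have "g n \<le> 1 * exp (\<rho> * real n)" using N by simp
    also have "\<dots> \<le> C * exp (\<rho> * real n)" using s by (intro mult_right_mono) (auto simp: C_def)
    finally show ?thesis .
  qed
  with s show ?thesis using that[of C] by (simp add: C_def)
qed

text \<open>Consecutive slow complements differ by a geometrically small angle, so slow vectors can be
  followed to a limit direction.\<close>

lemma slow_vector: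
  fixes T :: "nat \<Rightarrow> real^'d^'d"
  assumes E: "subspace E"
    and S: "\<And>n. n \<ge> n0 \<Longrightarrow> S n \<subseteq> E" "\<And>n. n \<ge> n0 \<Longrightarrow> \<not> E \<subseteq> S n"
    and fast: "\<And>n w. n \<ge> n0 \<Longrightarrow> w \<in> S n \<Longrightarrow> norm w \<le> c n * norm (T n *v w)"
    and slow: "\<And>n e. n \<ge> n0 \<Longrightarrow> e \<in> E \<Longrightarrow>
       \<exists>w\<in>S n. (T n *v (e - w)) \<bullet> (T n *v w) = 0 \<and> norm (T n *v (e - w)) \<le> b n * norm (e - w)"
    and step: "\<And>n v. norm (T (Suc n) *v v) \<le> a n * norm (T n *v v)"
    and nonneg: "\<And>n. 0 \<le> a n" "\<And>n. 0 \<le> b n" "\<And>n. 0 \<le> c n"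
    and decay: "\<And>n. c (Suc n) * (a n * b n) \<le> C * r ^ n" and r: "0 < r" "r < 1"
    and bound: "\<And>n v. v \<in> E \<Longrightarrow> norm (T n *v v) \<le> B n * norm v"
  shows "\<exists>u\<in>E. norm u = 1 \<and> (\<exists>n1 D. \<forall>n\<ge>n1. norm (T n *v u) \<le> b n + D * r ^ n * B n)"
proof -
  have "0 \<le> c (Suc 0) * (a 0 * b 0)" using nonneg by simp
  then have C0: "0 \<le> C" using decay[of 0] by simp
  have "(\<lambda>n. C * r ^ n) \<longlonglongrightarrow> C * 0" using r by (intro tendsto_mult tendsto_const LIMSEQ_realpow_zero) auto
  then have "\<forall>\<^sub>F n in sequentially. C * r ^ n < 1 / 2" by (intro order_tendstoD(2)) auto
  \<comment> \<open>From \<open>N\<close> on the fast components below are shorter than 1, so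
    subtracting them from a unit vector never gives 0.\<close>
  then obtain N where N: "\<And>n. n \<ge> N \<Longrightarrow> C * r ^ n < 1 / 2" by (auto simp: eventually_sequentially)
  define n1 where "n1 = max n0 N"
  define Q where "Q m u \<longleftrightarrow> u \<in> E \<and> norm u = 1 \<and> norm (T m *v u) \<le> b m" for m u
  have normalize: "Q m (u /\<^sub>R norm u)" if "u \<in> E" "u \<noteq> 0" "norm (T m *v u) \<le> b m * norm u" for m u
  proof -
    have "norm (T m *v (u /\<^sub>R norm u)) = norm (T m *v u) / norm u"
      by (simp add: linear_cmul[OF matrix_vector_mul_linear] divide_inverse mult.commute)
    also have "\<dots> \<le> b m" using that by (simp add: pos_divide_le_eq)
    finally show ?thesis using that E by (simp add: Q_def subspace_scale)
  qed
  have start: "\<exists>u. Q n1 u"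
  proof -
    have n1: "n1 \<ge> n0" by (simp add: n1_def)
    then obtain e where e: "e \<in> E" "e \<notin> S n1" using S(2) by blast
    obtain w where w: "w \<in> S n1" "norm (T n1 *v (e - w)) \<le> b n1 * norm (e - w)"
      using slow[OF n1 e(1)] by blast
    have "e - w \<noteq> 0" using e w by auto
    moreover have "e - w \<in> E" using e w S(1)[OF n1] by (intro subspace_diff E) auto
    ultimately show ?thesis using normalize w(2) by blast
  qed
  have next_vec: "\<exists>u'. Q (Suc m) u' \<and> norm (u' - u) \<le> 2 * C * r ^ m" if Q: "Q m u" and m: "m \<ge> n1" for m u
  proof -
    have m': "Suc m \<ge> n0" using m by (simp add: n1_def)
    have u: "u \<in> E" "norm u = 1" "norm (T m *v u) \<le> b m" using Q by (auto simp: Q_def)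
    obtain w where w: "w \<in> S (Suc m)" "(T (Suc m) *v (u - w)) \<bullet> (T (Suc m) *v w) = 0"
      "norm (T (Suc m) *v (u - w)) \<le> b (Suc m) * norm (u - w)"
      using slow[OF m' u(1)] by blast
    \<comment> \<open>By orthogonality the image of the fast component \<open>w\<close> is no longer
      than that of \<open>u\<close>, which is short because \<open>u\<close> was slow one step
      earlier. Since fast vectors with short images are short, \<open>w\<close> is small.\<close>
    have "(norm (T (Suc m) *v u))\<^sup>2 = (norm (T (Suc m) *v (u - w) + T (Suc m) *v w))\<^sup>2"
      by (simp add: matrix_vector_mult_diff_distrib)
    also have "\<dots> = (norm (T (Suc m) *v (u - w)))\<^sup>2 + (norm (T (Suc m) *v w))\<^sup>2"
      by (rule norm_add_Pythagorean) (simp add: orthogonal_def w)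
    finally have "(norm (T (Suc m) *v w))\<^sup>2 \<le> (norm (T (Suc m) *v u))\<^sup>2" by simp
    then have "norm (T (Suc m) *v w) \<le> norm (T (Suc m) *v u)" by (rule power2_le_imp_le) simp
    also have "\<dots> \<le> a m * norm (T m *v u)" by (rule step)
    also have "\<dots> \<le> a m * b m" using u(3) nonneg(1) by (rule mult_left_mono)
    finally have "norm w \<le> c (Suc m) * (a m * b m)"
      using fast[OF m' w(1)] nonneg(3)[of "Suc m"] by (meson mult_left_mono order.trans)
    also have "\<dots> \<le> C * r ^ m" by (rule decay)
    finally have nw: "norm w \<le> C * r ^ m" .
    moreover have "C * r ^ m < 1 / 2" using m N by (simp add: n1_def)
    ultimately have "norm w < 1" by linarith
    then have nz: "u - w \<noteq> 0" using u(2) by auto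
    \<comment> \<open>Removing \<open>w\<close> and renormalizing each move the vector by at most
      \<open>norm w\<close>, whence the factor 2.\<close>
    define d where "d = norm (u - w)"
    have d: "d > 0" "\<bar>1 - d\<bar> \<le> norm w"
      using nz u(2) norm_triangle_ineq3[of u "u - w"] by (auto simp: d_def)
    have "(u - w) /\<^sub>R d - u = (1 / d - 1) *\<^sub>R (u - w) - w"
      by (simp add: scaleR_left_diff_distrib divide_inverse)
    then have "norm ((u - w) /\<^sub>R d - u) \<le> norm ((1 / d - 1) *\<^sub>R (u - w)) + norm w"
      using norm_triangle_ineq4[of "(1 / d - 1) *\<^sub>R (u - w)" w] by metis
    also have "norm ((1 / d - 1) *\<^sub>R (u - w)) = \<bar>1 / d - 1\<bar> * d" by (simp add: d_def)
    also have "\<dots> = \<bar>(1 / d - 1) * d\<bar>" using d by (simp add: abs_mult)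
    also have "(1 / d - 1) * d = 1 - d" using d by (simp add: field_simps)
    finally have "norm ((u - w) /\<^sub>R d - u) \<le> 2 * C * r ^ m" using d nw by linarith
    moreover have "Q (Suc m) ((u - w) /\<^sub>R d)"
      unfolding d_def using nz w u S(1)[OF m'] by (intro normalize subspace_diff E) auto
    ultimately show ?thesis by blast
  qed
  have "\<exists>us. \<forall>k. Q (n1 + k) (us k) \<and> norm (us (Suc k) - us k) \<le> 2 * C * r ^ (n1 + k)"
  proof (rule dependent_nat_choice)
    show "\<exists>u. Q (n1 + 0) u" using start by simp
    show "\<exists>u'. Q (n1 + Suc k) u' \<and> norm (u' - u) \<le> 2 * C * r ^ (n1 + k)" if "Q (n1 + k) u" for k u
      using next_vec[OF that] by simp
  qed
  then obtain us where us: "\<And>k. Q (n1 + k) (us k)" "\<And>k. norm (us (Suc k) - us k) \<le> 2 * C * r ^ (n1 + k)"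
    by blast
  \<comment> \<open>\<open>D * r ^ n\<close> is the tail from \<open>n\<close> on of the geometric
    series with terms \<open>2 * C * r ^ n\<close>.\<close>
  define D where "D = 2 * C / (1 - r)"
  have tel: "norm (us (k + j) - us k) \<le> D * (r ^ (n1 + k) - r ^ (n1 + k + j))" for k j
  proof (induction j)
    case (Suc j)
    have "us (k + Suc j) - us k = (us (Suc (k + j)) - us (k + j)) + (us (k + j) - us k)" by simp
    then have "norm (us (k + Suc j) - us k) \<le> norm (us (Suc (k + j)) - us (k + j)) + norm (us (k + j) - us k)"
      by (metis norm_triangle_ineq)
    also have "\<dots> \<le> 2 * C * r ^ (n1 + k + j) + D * (r ^ (n1 + k) - r ^ (n1 + k + j))"
      using us(2)[of "k + j"] Suc by (simp add: add.assoc)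
    also have "2 * C = D * (1 - r)" using r by (simp add: D_def)
    finally show ?case by (simp add: algebra_simps)
  qed simp
  have D0: "0 \<le> D" using C0 r by (simp add: D_def)
  have "\<forall>k. us k \<in> sphere 0 1" using us(1) by (auto simp: Q_def)
  then obtain l s where l: "l \<in> sphere 0 1" and s: "strict_mono (s :: nat \<Rightarrow> nat)" "(us \<circ> s) \<longlonglongrightarrow> l"
    using compact_sphere[of "0 :: real^'d" 1] unfolding compact_def by meson
  have lE: "l \<in> E"
    by (rule closed_sequentially[OF closed_subspace[OF E] _ s(2)]) (use us(1) in \<open>auto simp: Q_def\<close>)
  have near: "norm (l - us k) \<le> D * r ^ (n1 + k)" for k
  proof (rule LIMSEQ_le_const2)
    show "(\<lambda>j. norm ((us \<circ> s) j - us k)) \<longlonglongrightarrow> norm (l - us k)"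
      by (intro tendsto_intros s(2))
    show "\<exists>N. \<forall>j\<ge>N. norm ((us \<circ> s) j - us k) \<le> D * r ^ (n1 + k)"
    proof (intro exI[of _ k] allI impI)
      fix j assume "k \<le> j"
      then have "k \<le> s j" using seq_suble[OF s(1), of j] by simp
      then have "norm ((us \<circ> s) j - us k) \<le> D * (r ^ (n1 + k) - r ^ (n1 + k + (s j - k)))"
        using tel[of k "s j - k"] by simp
      also have "\<dots> \<le> D * r ^ (n1 + k)" using D0 r by (intro mult_left_mono) auto
      finally show "norm ((us \<circ> s) j - us k) \<le> D * r ^ (n1 + k)" .
    qed
  qed
  have "norm (T n *v l) \<le> b n + D * r ^ n * B n" if n: "n \<ge> n1" for n
  proof -
    define k where "k = n - n1"
    have k: "n = n1 + k" using n by (simp add: k_def)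
    have u: "us k \<in> E" "norm (T n *v us k) \<le> b n" using us(1)[of k] by (auto simp: Q_def k)
    have dE: "l - us k \<in> E" using lE u by (intro subspace_diff E)
    have "l \<noteq> 0" using l by auto
    then have "0 \<le> B n * norm l" using bound[OF lE, of n] norm_ge_zero order.trans by blast
    then have B0: "0 \<le> B n" using \<open>l \<noteq> 0\<close> by (simp add: zero_le_mult_iff)
    have "T n *v l = T n *v us k + T n *v (l - us k)" by (simp add: matrix_vector_mult_diff_distrib)
    then have "norm (T n *v l) \<le> norm (T n *v us k) + norm (T n *v (l - us k))" by (metis norm_triangle_ineq)
    also have "\<dots> \<le> b n + B n * norm (l - us k)" using u bound[OF dE, of n] by simp
    also have "\<dots> \<le> b n + B n * (D * r ^ n)" using near[of k] B0 by (auto simp: k intro: mult_left_mono)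
    finally show ?thesis by (simp add: mult_ac)
  qed
  then show ?thesis using l lE by (intro bexI[of _ l]) auto
qed

text \<open>Meaningful only if \<open>T\<close> is bounded below on the range of \<open>P\<close>: otherwise the supremum is
  junk, and a vector in the kernel of \<open>T\<close> contributes 0.\<close>

definition inv_norm :: "real^'d^'d \<Rightarrow> real^'d^'d \<Rightarrow> real" where
  "inv_norm T P = (SUP w\<in>dense_vecs. norm (P *v w) / norm (T *v (P *v w)))"

lemma inv_norm_measurable [measurable (raw)]:
  fixes T P :: "'x \<Rightarrow> real^'d^'d"
  assumes [measurable]: "T \<in> borel_measurable M" "P \<in> borel_measurable M"
  shows "(\<lambda>x. inv_norm (T x) (P x)) \<in> borel_measurable M"
  unfolding inv_norm_def by (rule borel_measurable_cSUP_real[OF dense_vecs(1)]) measurable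

text \<open>Any a priori constant \<open>c\<close> makes the supremum genuine; by density, the
  supremum is then itself a valid constant.\<close>

lemma inv_norm_le:
  assumes "\<And>v. v \<in> range ((*v) P) \<Longrightarrow> norm v \<le> c * norm (T *v v)" "0 \<le> c"
  shows "inv_norm T P \<le> c" and "v \<in> range ((*v) P) \<Longrightarrow> norm v \<le> inv_norm T P * norm (T *v v)"
proof -
  have le: "norm (P *v w) / norm (T *v (P *v w)) \<le> c" for w
    using assms(1)[of "P *v w"] assms(2)
    by (cases "T *v (P *v w) = 0") (auto simp: pos_divide_le_eq)
  obtain d :: "real^'a" where d: "d \<in> dense_vecs" using dense_vecs(2)[of UNIV] by auto
  show "inv_norm T P \<le> c"
    unfolding inv_norm_def by (rule cSUP_least) (use d le in auto)
  assume "v \<in> range ((*v) P)"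
  then obtain w where w: "v = P *v w" by auto
  obtain s where s: "\<And>n::nat. s n \<in> dense_vecs" "s \<longlonglongrightarrow> w" using dense_vecs_seq by blast
  have l: "(\<lambda>n. P *v s n) \<longlonglongrightarrow> v"
    unfolding w by (rule bounded_linear.tendsto[OF matrix_vector_mul_bounded_linear s(2)])
  have le': "norm (P *v s n) \<le> inv_norm T P * norm (T *v (P *v s n))" for n
  proof (cases "T *v (P *v s n) = 0")
    case True
    then show ?thesis using assms(1)[of "P *v s n"] by simp
  next
    case False
    have "norm (P *v s n) / norm (T *v (P *v s n)) \<le> inv_norm T P"
      unfolding inv_norm_def by (intro cSUP_upper[OF s(1)] bdd_aboveI2[OF le])
    then show ?thesis using False by (simp add: pos_divide_le_eq)
  qed
  have r: "(\<lambda>n. inv_norm T P * norm (T *v (P *v s n))) \<longlonglongrightarrow> inv_norm T P * norm (T *v v)"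
    by (intro tendsto_mult tendsto_const tendsto_norm bounded_linear.tendsto[OF matrix_vector_mul_bounded_linear l])
  show "norm v \<le> inv_norm T P * norm (T *v v)"
    by (rule LIMSEQ_le[OF tendsto_norm[OF l] r]) (use le' in auto)
qed

subsection \<open>Invariant subbundles\<close>

text \<open>Stands in for the operator norm: it dominates it, exceeds it by at most the factor of
  the dimension, and is measurable as a finite sum.\<close>

definition basis_norm :: "real^'d^'d \<Rightarrow> real" where
  "basis_norm B = (\<Sum>b\<in>Basis. norm (B *v b))"

lemma basis_norm_nonneg: "0 \<le> basis_norm B"
  unfolding basis_norm_def by (intro sum_nonneg) auto

lemma norm_le_basis_norm: "norm (B *v v) \<le> basis_norm B * norm v" for B :: "real^'d^'d"
proof -
  have "B *v v = B *v (\<Sum>b\<in>Basis. (v \<bullet> b) *\<^sub>R b)" by (simp add: euclidean_representation)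
  also have "\<dots> = (\<Sum>b\<in>Basis. (v \<bullet> b) *\<^sub>R (B *v b))"
    by (simp add: linear_sum[OF matrix_vector_mul_linear] linear_cmul[OF matrix_vector_mul_linear])
  also have "norm \<dots> \<le> (\<Sum>b\<in>Basis. norm ((v \<bullet> b) *\<^sub>R (B *v b)))" by (rule norm_sum)
  also have "\<dots> \<le> (\<Sum>b\<in>Basis. norm v * norm (B *v b))"
    by (intro sum_mono) (auto intro!: mult_right_mono Basis_le_norm)
  finally show ?thesis by (simp add: basis_norm_def sum_distrib_left[symmetric] mult.commute)
qed

lemma basis_norm_measurable [measurable (raw)]:
  fixes B :: "'x \<Rightarrow> real^'d^'d"
  assumes [measurable]: "B \<in> borel_measurable M"
  shows "(\<lambda>x. basis_norm (B x)) \<in> borel_measurable M"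
  unfolding basis_norm_def by measurable

lemma cocycle_add: "cocycle f A x (n + m) = cocycle f A ((f ^^ n) x) m ** cocycle f A x n"
proof (induction m)
  case (Suc m)
  have "(f ^^ (n + m)) x = (f ^^ m) ((f ^^ n) x)" by (simp add: add.commute[of n m] funpow_add)
  then show ?case using Suc by (simp add: matrix_mul_assoc)
qed simp

lemma cocycle_Suc': "cocycle f A x (Suc n) = cocycle f A (f x) n ** A x"
  using cocycle_add[of f A x 1 n] by simp

text \<open>A measurable invariant subbundle, encoded by projections so that invariance becomes the
  matrix identity \<open>P_equiv\<close>. The dimension of the range may depend on the
  point.\<close>

locale invariant_projection = ergodic_bij M f for M :: "'x measure" and f +
  fixes A P :: "'x \<Rightarrow> real^'d^'d" and h :: "'x \<Rightarrow> real"
  assumes A_meas [measurable]: "A \<in> borel_measurable M"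
    and P_meas [measurable]: "P \<in> borel_measurable M"
    and P_idem: "P x ** P x = P x"
    and P_equiv: "P (f x) ** A x = A x ** P x"
    and h_integrable: "integrable M h"
    and h_nn: "0 \<le> h x"
    and A_le: "norm (A x *v v) \<le> exp (h x) * norm v"
begin

abbreviation "\<A> \<equiv> cocycle f A"

abbreviation "R x \<equiv> range ((*v) (P x))"

lemma P_fix: "v \<in> R x \<Longrightarrow> P x *v v = v"
  using P_idem[of x] by (auto simp: matrix_vector_mul_assoc)

lemma cocycle_meas [measurable]: "(\<lambda>x. \<A> x n) \<in> borel_measurable M"
proof (induction n)
  case (Suc n)
  note Suc [measurable]
  show ?case by simp
qed simp

lemma P_equiv_cocycle: "P ((f ^^ n) x) ** \<A> x n = \<A> x n ** P x"
proof (induction n)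
  case (Suc n)
  have "P ((f ^^ Suc n) x) ** \<A> x (Suc n) = (P (f ((f ^^ n) x)) ** A ((f ^^ n) x)) ** \<A> x n"
    by (simp add: matrix_mul_assoc)
  also have "\<dots> = A ((f ^^ n) x) ** (P ((f ^^ n) x) ** \<A> x n)"
    by (simp add: P_equiv matrix_mul_assoc)
  also have "\<dots> = \<A> x (Suc n) ** P x"
    by (simp add: Suc matrix_mul_assoc)
  finally show ?case .
qed simp

lemma cocycle_range: "v \<in> R x \<Longrightarrow> \<A> x n *v v \<in> R ((f ^^ n) x)"
proof -
  assume v: "v \<in> R x"
  have "P ((f ^^ n) x) *v (\<A> x n *v v) = \<A> x n *v (P x *v v)"
    by (simp add: matrix_vector_mul_assoc P_equiv_cocycle)
  then show ?thesis using P_fix[OF v] by (metis rangeI)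
qed

definition V :: "nat \<Rightarrow> nat \<Rightarrow> 'x \<Rightarrow> real" where
  "V p n x = proj_vol p (\<A> x n) (P x)"

lemma V_submult: "submult_cocycle M f (V p) (\<lambda>x. real p * h x)"
proof
  show "V p n \<in> borel_measurable M" for n unfolding V_def[abs_def] by measurable
  show "0 \<le> V p n x" for n x unfolding V_def by (rule proj_vol_nonneg)
  show "V p 0 x \<le> 1" for x unfolding V_def by (simp add: proj_vol_mat_1)
  show "V p (n + m) x \<le> V p n x * V p m ((f ^^ n) x)" for n m x
    unfolding V_def cocycle_add
    using proj_vol_submult[of "\<A> x n" "P x" "P ((f ^^ n) x)" p "\<A> ((f ^^ n) x) m"] cocycle_range
    by (simp add: mult.commute)
  show "V p 1 x \<le> exp (real p * h x)" for x
    unfolding V_def using proj_vol_le_power[of "P x" "A x" "exp (h x)" p] A_le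
    by (simp add: exp_of_nat_mult)
  show "integrable M (\<lambda>x. real p * h x)" using h_integrable by simp
  show "0 \<le> real p * h x" for x using h_nn[of x] by simp
qed

text \<open>Upper bounds at the images of finitely many basis vectors extend to the whole range by
  linearity. Lower bounds do not, and this asymmetry is what the volume argument overcomes.\<close>

lemma uniform_upper_bound:
  assumes "\<And>v. v \<in> R x \<Longrightarrow> \<forall>\<^sub>F n in sequentially. norm (\<A> x n *v v) \<le> exp (\<rho> * real n)"
  obtains C where "C \<ge> 1" "\<And>n v. v \<in> R x \<Longrightarrow> norm (\<A> x n *v v) \<le> C * exp (\<rho> * real n) * norm v"
proof -
  have "\<exists>C\<ge>1. \<forall>n. norm (\<A> x n *v (P x *v b)) \<le> C * exp (\<rho> * real n)" for b
  proof -
    have "P x *v b \<in> R x" by simp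
    from exp_bound_of_eventually[OF assms[OF this]] show ?thesis by blast
  qed
  then obtain C where C: "\<And>b. C b \<ge> 1" "\<And>b n. norm (\<A> x n *v (P x *v b)) \<le> C b * exp (\<rho> * real n)"
    by metis
  define D where "D = (\<Sum>b\<in>Basis. C b)"
  obtain b0 :: "real^'d" where "b0 \<in> Basis" using nonempty_Basis by blast
  then have "C b0 \<le> D" unfolding D_def using C(1) by (intro member_le_sum) (auto intro: order.trans[OF zero_le_one])
  then have "D \<ge> 1" using C(1)[of b0] by simp
  moreover have "norm (\<A> x n *v v) \<le> D * exp (\<rho> * real n) * norm v" if "v \<in> R x" for n v
  proof -
    have "basis_norm (\<A> x n ** P x) \<le> D * exp (\<rho> * real n)"
      unfolding basis_norm_def D_def sum_distrib_right
      by (intro sum_mono) (use C in \<open>simp flip: matrix_vector_mul_assoc\<close>)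
    moreover have "\<A> x n *v v = (\<A> x n ** P x) *v v"
      by (simp add: P_fix[OF that] flip: matrix_vector_mul_assoc)
    ultimately show ?thesis
      using order.trans[OF norm_le_basis_norm mult_right_mono[OF _ norm_ge_zero]] by metis
  qed
  ultimately show ?thesis using that by blast
qed

text \<open>The best constant for the rate \<open>\<rho>\<close>, raised to at least 1 so that its
  logarithm is nonnegative.\<close>

definition upper_const :: "real \<Rightarrow> 'x \<Rightarrow> real" where
  "upper_const \<rho> x = max 1 (SUP n. V 1 n x * exp (- (\<rho> * real n)))"

lemma upper_const_meas [measurable]: "upper_const \<rho> \<in> borel_measurable M"
proof -
  interpret submult_cocycle M f "V 1" "\<lambda>x. real 1 * h x" by (rule V_submult)
  have "(\<lambda>x. SUP n. V 1 n x * exp (- (\<rho> * real n))) \<in> borel_measurable M"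
    by (intro borel_measurable_cSUP_real borel_measurable_times V_meas borel_measurable_const) simp
  then show ?thesis unfolding upper_const_def[abs_def] by measurable
qed

text \<open>For temperedness, split off the first step: the iterates at \<open>x\<close> factor
  through \<open>f x\<close>, so the constant at \<open>x\<close> is at most the one at
  \<open>f x\<close> times \<open>exp (h x + \<bar>\<rho>\<bar>)\<close>.\<close>

lemma upper_const_bound:
  assumes ev: "\<And>x v. v \<in> R x \<Longrightarrow> \<forall>\<^sub>F n in sequentially. norm (\<A> x n *v v) \<le> exp (\<rho> * real n)"
  shows "v \<in> R x \<Longrightarrow> norm (\<A> x n *v v) \<le> upper_const \<rho> x * exp (\<rho> * real n) * norm v"
    and "AE x in M. tempered f (\<lambda>x. ln (upper_const \<rho> x)) x"
proof -
  interpret submult_cocycle M f "V 1" "\<lambda>x. real 1 * h x" by (rule V_submult)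
  have bdd: "bdd_above (range (\<lambda>n. V 1 n x * exp (- (\<rho> * real n))))" for x
  proof -
    obtain C where C: "C \<ge> 1" "\<And>n v. v \<in> R x \<Longrightarrow> norm (\<A> x n *v v) \<le> C * exp (\<rho> * real n) * norm v"
      using uniform_upper_bound[OF ev] by blast
    have "V 1 n x \<le> C * exp (\<rho> * real n)" for n
      using proj_vol_le_power[of "P x" "\<A> x n" "C * exp (\<rho> * real n)" 1] C by (simp add: V_def)
    then show ?thesis
      by (intro bdd_aboveI2[where M = C]) (simp add: exp_minus field_simps)
  qed
  have le: "V 1 n x \<le> upper_const \<rho> x * exp (\<rho> * real n)" for n x
  proof -
    have "V 1 n x * exp (- (\<rho> * real n)) \<le> upper_const \<rho> x"
      unfolding upper_const_def using cSUP_upper[OF UNIV_I bdd[of x], of n] by simp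
    then show ?thesis by (simp add: exp_minus field_simps)
  qed
  show "norm (\<A> x n *v v) \<le> upper_const \<rho> x * exp (\<rho> * real n) * norm v" if "v \<in> R x"
    using order.trans[OF norm_le_proj_vol[OF that] mult_right_mono[OF le[unfolded V_def] norm_ge_zero]] .
  have up1: "1 \<le> upper_const \<rho> x" for x by (simp add: upper_const_def)
  have rec: "upper_const \<rho> x \<le> upper_const \<rho> (f x) * exp (h x + \<bar>\<rho>\<bar>)" for x
  proof -
    have e1: "1 * 1 \<le> upper_const \<rho> (f x) * exp (h x + \<bar>\<rho>\<bar>)"
      using h_nn[of x] by (intro mult_mono up1) (auto intro: order.trans[OF zero_le_one up1])
    have "V 1 n x * exp (- (\<rho> * real n)) \<le> upper_const \<rho> (f x) * exp (h x + \<bar>\<rho>\<bar>)" for n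
    proof (cases n)
      case 0
      have "V 1 n x * exp (- (\<rho> * real n)) \<le> 1" using V_0[of x] by (simp add: 0)
      then show ?thesis using e1 by linarith
    next
      case (Suc m)
      have "V 1 n x \<le> V 1 1 x * V 1 m (f x)" unfolding Suc by (rule V_Suc)
      also have "\<dots> \<le> exp (h x) * (upper_const \<rho> (f x) * exp (\<rho> * real m))"
        using V_1[of x] by (intro mult_mono le V_nonneg) auto
      finally have "V 1 n x * exp (- (\<rho> * real n)) \<le> exp (h x) * (upper_const \<rho> (f x) * exp (\<rho> * real m)) * exp (- (\<rho> * real n))"
        by (intro mult_right_mono) auto
      also have "\<dots> = upper_const \<rho> (f x) * exp (h x - \<rho>)"
      proof -
        have "exp (h x - \<rho>) = exp (h x) * exp (\<rho> * real m) * exp (- (\<rho> * real n))"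
          unfolding exp_add[symmetric] Suc by (simp add: algebra_simps)
        then show ?thesis by (simp only: mult_ac)
      qed
      also have "\<dots> \<le> upper_const \<rho> (f x) * exp (h x + \<bar>\<rho>\<bar>)"
        using up1[of "f x"] by (intro mult_left_mono) auto
      finally show ?thesis .
    qed
    then show ?thesis using e1 unfolding upper_const_def[of \<rho> x] by (auto intro!: cSUP_least)
  qed
  show "AE x in M. tempered f (\<lambda>x. ln (upper_const \<rho> x)) x"
  proof (rule AE_tempered)
    show "integrable M (\<lambda>x. h x + \<bar>\<rho>\<bar>)" using h_integrable by simp
    show "AE x in M. ln (upper_const \<rho> x) \<le> ln (upper_const \<rho> (f x)) + (h x + \<bar>\<rho>\<bar>)"
    proof (intro AE_I2)
      fix x
      have "ln (upper_const \<rho> x) \<le> ln (upper_const \<rho> (f x) * exp (h x + \<bar>\<rho>\<bar>))"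
        using rec[of x] up1[of x] by (subst ln_le_cancel_iff) auto
      also have "\<dots> = ln (upper_const \<rho> (f x)) + (h x + \<bar>\<rho>\<bar>)"
        using up1[of "f x"] by (subst ln_mult) auto
      finally show "ln (upper_const \<rho> x) \<le> ln (upper_const \<rho> (f x)) + (h x + \<bar>\<rho>\<bar>)" .
    qed
    show "0 \<le> h x + \<bar>\<rho>\<bar>" for x using h_nn[of x] by simp
    show "0 \<le> ln (upper_const \<rho> x)" for x using up1 by simp
  qed measurable
qed

end

text \<open>Every nonzero vector of the range has exponent exactly \<open>\<theta>\<close>; the
  times from which the bounds hold may depend on the vector. Despite the name, uniformity is derived
  and not assumed.\<close>

locale uniform_exponent = invariant_projection M f A P h
  for M :: "'x measure" and f and A P :: "'x \<Rightarrow> real^'d^'d" and h +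
  fixes \<theta> :: real
  assumes upper: "\<And>x v \<rho>. v \<in> R x \<Longrightarrow> \<theta> < \<rho> \<Longrightarrow> \<forall>\<^sub>F n in sequentially. norm (\<A> x n *v v) \<le> exp (\<rho> * real n)"
    and lower: "\<And>x v \<sigma>. v \<in> R x \<Longrightarrow> v \<noteq> 0 \<Longrightarrow> \<sigma> < \<theta> \<Longrightarrow> \<forall>\<^sub>F n in sequentially. exp (\<sigma> * real n) \<le> norm (\<A> x n *v v)"
    and surj: "\<And>x. R (f x) \<subseteq> (*v) (A x) ` R x"
begin

lemma cocycle_injective:
  assumes "v \<in> R x" "\<A> x n *v v = 0"
  shows "v = 0"
proof (rule ccontr)
  assume "v \<noteq> 0"
  then have "\<forall>\<^sub>F m in sequentially. exp ((\<theta> - 1) * real m) \<le> norm (\<A> x m *v v)"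
    by (intro lower assms) auto
  then obtain N where N: "\<And>m. m \<ge> N \<Longrightarrow> exp ((\<theta> - 1) * real m) \<le> norm (\<A> x m *v v)"
    by (auto simp: eventually_sequentially)
  have "\<A> x (n + N) *v v = 0"
    using assms(2) by (simp add: cocycle_add flip: matrix_vector_mul_assoc)
  then show False using N[of "n + N"] by simp
qed

text \<open>Only the lower half of having exponent \<open>q * \<theta>\<close>: the upper half is
  automatic, since the \<open>q\<close>-volume expands by at most the \<open>q\<close>-th power of
  the norm.\<close>

definition vol_exponent :: "nat \<Rightarrow> bool" where
  "vol_exponent q \<longleftrightarrow> (\<forall>\<sigma> < real q * \<theta>. AE x in M. \<forall>\<^sub>F n in sequentially. exp (\<sigma> * real n) \<le> V q n x)"

text \<open>The property holds for order 0 and fails above \<open>CARD('d)\<close>, where volumes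
  vanish. Where it is lost, the dichotomy turns failure into a strictly smaller growth rate almost
  everywhere.\<close>

lemma ex_max_vol_exponent:
  obtains q \<rho> where "vol_exponent q" "\<rho> < real (Suc q) * \<theta>"
    "AE x in M. \<exists>C. \<forall>n. V (Suc q) n x \<le> C * exp (\<rho> * real n)"
proof -
  have 0: "vol_exponent 0"
    by (auto simp: vol_exponent_def V_def mult_nonpos_nonneg)
  have "\<not> vol_exponent (Suc CARD('d))"
  proof
    assume v: "vol_exponent (Suc CARD('d))"
    have "dim (R x) < Suc CARD('d)" for x
      using dim_subset_UNIV[of "R x"] by (simp add: less_Suc_eq_le)
    then have "V (Suc CARD('d)) n x = 0" for n x
      unfolding V_def by (intro proj_vol_eq_0)
    then have "AE x in M. False"
      using v[unfolded vol_exponent_def, rule_format, of "real (Suc CARD('d)) * \<theta> - 1"]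
      by (simp add: not_le[symmetric] del: of_nat_Suc)
    then show False by simp
  qed
  then obtain q where q: "vol_exponent q" "\<not> vol_exponent (Suc q)"
    using 0 by (metis nat_induct)
  then obtain \<sigma> where \<sigma>: "\<sigma> < real (Suc q) * \<theta>"
    "\<not> (AE x in M. \<forall>\<^sub>F n in sequentially. exp (\<sigma> * real n) \<le> V (Suc q) n x)"
    by (auto simp: vol_exponent_def)
  obtain \<rho> where \<rho>: "\<sigma> < \<rho>" "\<rho> < real (Suc q) * \<theta>" using dense[OF \<sigma>(1)] by blast
  interpret submult_cocycle M f "V (Suc q)" "\<lambda>x. real (Suc q) * h x" by (rule V_submult)
  show ?thesis using AE_growth_dichotomy[OF \<rho>(1)] \<sigma>(2) q(1) \<rho>(2) that by blast
qed

text \<open>\<open>h\<close> serves as its own error term, since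
  \<open>h x \<le> h (f x) + h x\<close>.\<close>

lemma h_tempered: "AE x in M. tempered f h x"
  by (rule AE_tempered[where h = h])
     (use h_integrable h_nn borel_measurable_integrable[OF h_integrable] in \<open>auto simp: h_nn\<close>)

lemma norm_cocycle_Suc_le:
  "norm (\<A> x (Suc n) *v v) \<le> exp (h ((f ^^ n) x)) * norm (\<A> x n *v v)"
  using A_le[of "(f ^^ n) x" "\<A> x n *v v"] by (simp flip: matrix_vector_mul_assoc)

text \<open>If the dimension exceeded \<open>q\<close>, the gap between the volume exponents of orders \<open>q\<close> and \<open>q + 1\<close>
  would produce a vector growing at a rate below \<open>\<theta>\<close>.\<close>

lemma dim_le_vol_exponent:
  assumes q: "vol_exponent q" and \<rho>: "\<rho> < real (Suc q) * \<theta>"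
    and grow: "AE x in M. \<exists>C. \<forall>n. V (Suc q) n x \<le> C * exp (\<rho> * real n)"
  shows "AE x in M. dim (R x) \<le> q"
proof -
  define \<eta> where "\<eta> = real (Suc q) * \<theta> - \<rho>"
  \<comment> \<open>The final rate loses \<open>\<epsilon>\<close> exactly \<open>q + 3\<close>
    times: \<open>q\<close> times in \<open>c\<close> and once each in \<open>a\<close>,
    \<open>b\<close> and \<open>B\<close>. Half of the gap \<open>\<eta>\<close> remains.\<close>
  define \<epsilon> where "\<epsilon> = \<eta> / (2 * (real q + 3))"
  have \<eta>: "\<eta> > 0" using \<rho> by (simp add: \<eta>_def)
  then have \<epsilon>: "\<epsilon> > 0" "(real q + 3) * \<epsilon> = \<eta> / 2" by (simp_all add: \<epsilon>_def field_simps)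
  have "AE x in M. \<forall>\<^sub>F n in sequentially. exp ((real q * \<theta> - \<epsilon>) * real n) \<le> V q n x"
    using q \<epsilon> by (auto simp: vol_exponent_def)
  then show ?thesis using grow h_tempered
  proof eventually_elim
    fix x
    assume Vq: "\<forall>\<^sub>F n in sequentially. exp ((real q * \<theta> - \<epsilon>) * real n) \<le> V q n x"
      and "\<exists>C. \<forall>n. V (Suc q) n x \<le> C * exp (\<rho> * real n)" and temp: "tempered f h x"
    then obtain C' where C': "\<And>n. V (Suc q) n x \<le> C' * exp (\<rho> * real n)" by blast
    define C where "C = max 1 C'"
    have C1: "C \<ge> 1" by (simp add: C_def)
    have C: "V (Suc q) n x \<le> C * exp (\<rho> * real n)" for n
      by (rule order.trans[OF C']) (simp add: C_def mult_right_mono)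
    show "dim (R x) \<le> q"
    proof (rule ccontr)
      assume dim: "\<not> dim (R x) \<le> q"
      obtain N where N: "\<And>n. n \<ge> N \<Longrightarrow> exp ((real q * \<theta> - \<epsilon>) * real n) \<le> V q n x"
        using Vq by (auto simp: eventually_sequentially)
      obtain D where D: "\<And>n::int. h (int_iter f n x) - \<epsilon> * \<bar>real_of_int n\<bar> \<le> D"
        using temp \<epsilon>(1) by (auto simp: tempered_def bdd_above_def)
      have hD: "h ((f ^^ n) x) \<le> D + \<epsilon> * real n" for n
        using D[of "int n"] by (simp add: int_iter_def)
      have ev: "\<forall>\<^sub>F n in sequentially. norm (\<A> x n *v v) \<le> exp ((\<theta> + \<epsilon>) * real n)" if "v \<in> R x" for v
        using \<epsilon>(1) by (intro upper that) simp
      obtain L where L: "L \<ge> 1" "\<And>n v. v \<in> R x \<Longrightarrow> norm (\<A> x n *v v) \<le> L * exp ((\<theta> + \<epsilon>) * real n) * norm v"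
        using uniform_upper_bound[OF ev] by blast
      define B where "B n = L * exp ((\<theta> + \<epsilon>) * real n)" for n
      have B0: "B n \<ge> 0" for n using L(1) by (simp add: B_def)
      define a where "a n = exp D * exp (\<epsilon> * real n)" for n
      \<comment> \<open>\<open>b n\<close> is twice the upper bound for \<open>V (Suc q) n\<close>
        over the lower bound for \<open>V q n\<close>; for positive \<open>q\<close>,
        \<open>c n\<close> is \<open>2 * B n ^ (q - 1)\<close> over the latter.\<close>
      define b where "b n = 2 * C * exp ((\<theta> - \<eta> + \<epsilon>) * real n)" for n
      define c where "c n = 2 * L ^ (q - 1) * exp ((- \<theta> + real q * \<epsilon>) * real n)" for n
      define r where "r = exp (- \<eta> + (real q + 2) * \<epsilon>)"
      have "(real q + 2) * \<epsilon> < (real q + 3) * \<epsilon>" using \<epsilon>(1) by simp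
      then have "- \<eta> + (real q + 2) * \<epsilon> < 0" using \<epsilon>(2) \<eta> by linarith
      then have r: "0 < r" "r < 1" by (auto simp: r_def)
      have Vpos: "V q n x > 0" if "n \<ge> N" for n using N[OF that] by (smt (verit) exp_gt_zero)
      have split: "\<exists>S. subspace S \<and> S \<subseteq> R x \<and> dim S = q \<and>
          (\<forall>w\<in>S. norm w \<le> c n * norm (\<A> x n *v w)) \<and>
          (\<forall>e\<in>R x. \<exists>w\<in>S. (\<A> x n *v (e - w)) \<bullet> (\<A> x n *v w) = 0 \<and>
            norm (\<A> x n *v (e - w)) \<le> b n * norm (e - w))" if n: "n \<ge> N" for n
      proof -
        obtain S where S: "subspace S" "S \<subseteq> R x" "dim S = q"
          "\<And>w. w \<in> S \<Longrightarrow> V q n x * norm w \<le> 2 * B n ^ (q - 1) * norm (\<A> x n *v w)"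
          "\<And>e. e \<in> R x \<Longrightarrow> \<exists>w\<in>S. (\<A> x n *v (e - w)) \<bullet> (\<A> x n *v w) = 0 \<and>
            V q n x * norm (\<A> x n *v (e - w)) \<le> 2 * V (Suc q) n x * norm (e - w)"
          using fast_slow_splitting[of q "\<A> x n" "P x" "B n"] Vpos[OF n] L(2)[folded B_def] B0
          unfolding V_def by metis
        have "norm w \<le> c n * norm (\<A> x n *v w)" if w: "w \<in> S" for w
        \<comment> \<open>For \<open>q = 0\<close> the subtraction in \<open>q - 1\<close> is
          truncated, but then \<open>S\<close> is trivial.\<close>
        proof (cases "q = 0")
          case True
          then have "w = 0" using S(3) w by (auto simp: dim_eq_0)
          then show ?thesis by simp
        next
          case False
          have "exp ((real q * \<theta> - \<epsilon>) * real n) * norm w \<le> 2 * B n ^ (q - 1) * norm (\<A> x n *v w)"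
            using S(4)[OF w] N[OF n] by (meson mult_right_mono norm_ge_zero order.trans)
          also have "B n ^ (q - 1) = L ^ (q - 1) * exp ((real q - 1) * ((\<theta> + \<epsilon>) * real n))"
            using False by (simp add: B_def power_mult_distrib exp_of_nat_mult[symmetric] of_nat_diff)
          also have "(real q - 1) * ((\<theta> + \<epsilon>) * real n) = (real q * \<theta> - \<epsilon>) * real n + (- \<theta> + real q * \<epsilon>) * real n"
            by (simp add: algebra_simps)
          finally have "exp ((real q * \<theta> - \<epsilon>) * real n) * norm w
             \<le> exp ((real q * \<theta> - \<epsilon>) * real n) * (c n * norm (\<A> x n *v w))"
            by (simp add: c_def exp_add mult_ac)
          then show ?thesis by simp
        qed
        moreover have "\<exists>w\<in>S. (\<A> x n *v (e - w)) \<bullet> (\<A> x n *v w) = 0 \<and>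
            norm (\<A> x n *v (e - w)) \<le> b n * norm (e - w)" if e: "e \<in> R x" for e
        proof -
          obtain w where w: "w \<in> S" "(\<A> x n *v (e - w)) \<bullet> (\<A> x n *v w) = 0"
            "V q n x * norm (\<A> x n *v (e - w)) \<le> 2 * V (Suc q) n x * norm (e - w)"
            using S(5)[OF e] by blast
          have "exp ((real q * \<theta> - \<epsilon>) * real n) * norm (\<A> x n *v (e - w))
             \<le> 2 * (C * exp (\<rho> * real n)) * norm (e - w)"
            using N[OF n] w(3) C[of n]
            by (smt (verit, best) mult_right_mono norm_ge_zero)
          also have "\<rho> * real n = (real q * \<theta> - \<epsilon>) * real n + (\<theta> - \<eta> + \<epsilon>) * real n"
            by (simp add: \<eta>_def algebra_simps)
          finally have "exp ((real q * \<theta> - \<epsilon>) * real n) * norm (\<A> x n *v (e - w))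
             \<le> exp ((real q * \<theta> - \<epsilon>) * real n) * (b n * norm (e - w))"
            by (simp add: b_def exp_add mult_ac)
          then show ?thesis using w by auto
        qed
        ultimately show ?thesis using S by blast
      qed
      then obtain S where S: "\<And>n. n \<ge> N \<Longrightarrow> subspace (S n) \<and> S n \<subseteq> R x \<and> dim (S n) = q \<and>
          (\<forall>w\<in>S n. norm w \<le> c n * norm (\<A> x n *v w)) \<and>
          (\<forall>e\<in>R x. \<exists>w\<in>S n. (\<A> x n *v (e - w)) \<bullet> (\<A> x n *v w) = 0 \<and>
            norm (\<A> x n *v (e - w)) \<le> b n * norm (e - w))" by metis
      have "\<exists>u\<in>R x. norm u = 1 \<and> (\<exists>n1 D. \<forall>n\<ge>n1. norm (\<A> x n *v u) \<le> b n + D * r ^ n * B n)"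
      proof (rule slow_vector[where S = S and ?n0.0 = N and a = a and c = c])
        show "\<not> R x \<subseteq> S n" if "n \<ge> N" for n
          using S[OF that] dim dim_subset[of "R x" "S n"] by auto
        show "norm (\<A> x (Suc n) *v v) \<le> a n * norm (\<A> x n *v v)" for n v
          using norm_cocycle_Suc_le[of x n v] hD[of n]
          by (smt (verit) a_def exp_add exp_le_cancel_iff mult_right_mono norm_ge_zero)
        show "c (Suc n) * (a n * b n) \<le> (2 * L ^ (q - 1) * exp (- \<theta> + real q * \<epsilon>) * exp D * 2 * C) * r ^ n" for n
        proof -
          have "r ^ n = exp (real n * (- \<eta> + (real q + 2) * \<epsilon>))" unfolding r_def by (rule exp_of_nat_mult[symmetric])
          moreover have "exp ((- \<theta> + real q * \<epsilon>) * real (Suc n)) * (exp (\<epsilon> * real n) * exp ((\<theta> - \<eta> + \<epsilon>) * real n))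
             = exp (- \<theta> + real q * \<epsilon>) * exp (real n * (- \<eta> + (real q + 2) * \<epsilon>))"
            unfolding exp_add[symmetric] by (simp add: algebra_simps)
          ultimately show ?thesis by (simp add: a_def b_def c_def mult_ac)
        qed
        show "0 \<le> a n" "0 \<le> b n" "0 \<le> c n" for n using C1 L(1) by (auto simp: a_def b_def c_def)
        show "norm (\<A> x n *v v) \<le> B n * norm v" if "v \<in> R x" for n v
          using L(2)[OF that] by (simp add: B_def)
      qed (use S r subspace_range_mat in auto)
      then obtain u n1 K where u: "u \<in> R x" "norm u = 1"
        "\<And>n. n \<ge> n1 \<Longrightarrow> norm (\<A> x n *v u) \<le> b n + K * r ^ n * B n" by blast
      have "u \<noteq> 0" using u(2) by auto
      \<comment> \<open>The slow vector grows at most at rate \<open>\<theta> - \<eta> / 2\<close>;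
        any lower rate strictly between this and \<open>\<theta>\<close> gives the
        contradiction.\<close>
      then have "\<forall>\<^sub>F n in sequentially. exp ((\<theta> - \<eta> / 4) * real n) \<le> norm (\<A> x n *v u)"
        using \<eta> by (intro lower u) auto
      then have "\<forall>\<^sub>F n in sequentially. exp ((\<theta> - \<eta> / 4) * real n) \<le> (2 * C + \<bar>K\<bar> * L) * exp ((\<theta> - \<eta> / 2) * real n)"
        using eventually_ge_at_top[of n1]
      proof eventually_elim
        case (elim n)
        have "\<epsilon> \<le> (real q + 3) * \<epsilon>" using \<epsilon>(1) by simp
        then have "\<theta> - \<eta> + \<epsilon> \<le> \<theta> - \<eta> / 2" using \<epsilon>(2) by linarith
        then have b: "b n \<le> 2 * C * exp ((\<theta> - \<eta> / 2) * real n)"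
          using C1 by (auto simp: b_def intro!: mult_left_mono mult_right_mono)
        have "r ^ n * B n = L * (exp (real n * (- \<eta> + (real q + 2) * \<epsilon>)) * exp ((\<theta> + \<epsilon>) * real n))"
          by (simp add: r_def B_def exp_of_nat_mult[symmetric] mult_ac)
        also have "exp (real n * (- \<eta> + (real q + 2) * \<epsilon>)) * exp ((\<theta> + \<epsilon>) * real n)
            = exp ((\<theta> - \<eta> + (real q + 3) * \<epsilon>) * real n)"
          unfolding exp_add[symmetric] by (simp add: algebra_simps)
        also have "\<theta> - \<eta> + (real q + 3) * \<epsilon> = \<theta> - \<eta> / 2" unfolding \<epsilon>(2) by simp
        finally have rB: "r ^ n * B n = L * exp ((\<theta> - \<eta> / 2) * real n)" .
        have "K * (r ^ n * B n) \<le> \<bar>K\<bar> * (r ^ n * B n)"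
          using r B0 by (intro mult_right_mono) auto
        then have "norm (\<A> x n *v u) \<le> 2 * C * exp ((\<theta> - \<eta> / 2) * real n) + \<bar>K\<bar> * (L * exp ((\<theta> - \<eta> / 2) * real n))"
          using u(3)[of n] elim b rB by (simp add: mult.assoc)
        then show ?case using elim by (simp add: algebra_simps)
      qed
      then show False by (rule exp_growth_contradiction) (use \<eta> in auto)
    qed
  qed
qed

text \<open>A fast subspace of dimension \<open>q\<close> inside a range of dimension at most
  \<open>q\<close> is the whole range, so its lower bound holds for every vector.\<close>

lemma V_lower_bound:
  assumes "dim (R x) \<le> q" "V q n x > 0" "\<And>v. v \<in> R x \<Longrightarrow> norm (\<A> x n *v v) \<le> B * norm v" "0 \<le> B" "v \<in> R x"
  shows "V q n x * norm v \<le> 2 * B ^ (q - 1) * norm (\<A> x n *v v)"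
proof -
  obtain S where S: "subspace S" "S \<subseteq> R x" "dim S = q"
    "\<And>w. w \<in> S \<Longrightarrow> V q n x * norm w \<le> 2 * B ^ (q - 1) * norm (\<A> x n *v w)"
    by (rule fast_slow_splitting[OF assms(2)[unfolded V_def] assms(3,4)]) (auto simp: V_def)
  then have "S = R x"
    using assms(1) by (intro subspace_dim_equal subspace_range_mat) auto
  then show ?thesis using S(4) assms(5) by simp
qed

text \<open>For large \<open>n\<close>, dividing the lower bound for \<open>V q n\<close> by the
  upper bound to the power \<open>q - 1\<close> gives the rate. The finitely many earlier iterates
  only require injectivity on a finite-dimensional space.\<close>

lemma AE_uniform_lower_bound:
  assumes "\<sigma> < \<theta>"
  shows "AE x in M. \<exists>C\<ge>0. \<forall>n. \<forall>v\<in>R x. exp (\<sigma> * real n) * norm v \<le> C * norm (\<A> x n *v v)"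
proof -
  obtain q \<rho> where q: "vol_exponent q" and \<rho>: "\<rho> < real (Suc q) * \<theta>"
    "AE x in M. \<exists>C. \<forall>n. V (Suc q) n x \<le> C * exp (\<rho> * real n)"
    by (rule ex_max_vol_exponent)
  \<comment> \<open>The rate obtained is \<open>\<theta> - q * \<epsilon>\<close>, which equals
    \<open>\<sigma> + \<epsilon>\<close>; the denominator \<open>q + 1\<close> also covers
    \<open>q = 0\<close>.\<close>
  define \<epsilon> where "\<epsilon> = (\<theta> - \<sigma>) / (real q + 1)"
  have \<epsilon>: "\<epsilon> > 0" "(real q + 1) * \<epsilon> = \<theta> - \<sigma>" using assms by (simp_all add: \<epsilon>_def)
  have "AE x in M. \<forall>\<^sub>F n in sequentially. exp ((real q * \<theta> - \<epsilon>) * real n) \<le> V q n x"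
    using q \<epsilon> by (auto simp: vol_exponent_def)
  with dim_le_vol_exponent[OF q \<rho>] show ?thesis
  proof eventually_elim
    case (elim x)
    obtain N where N: "\<And>n. n \<ge> N \<Longrightarrow> exp ((real q * \<theta> - \<epsilon>) * real n) \<le> V q n x"
      using elim(2) by (auto simp: eventually_sequentially)
    have ev: "\<forall>\<^sub>F n in sequentially. norm (\<A> x n *v v) \<le> exp ((\<theta> + \<epsilon>) * real n)" if "v \<in> R x" for v
      using \<epsilon>(1) by (intro upper that) simp
    obtain L where L: "L \<ge> 1" "\<And>n v. v \<in> R x \<Longrightarrow> norm (\<A> x n *v v) \<le> L * exp ((\<theta> + \<epsilon>) * real n) * norm v"
      using uniform_upper_bound[OF ev] by blast
    have "\<exists>e>0. \<forall>v\<in>R x. norm (\<A> x n *v v) \<ge> e * norm v" for n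
      using cocycle_injective
      by (intro injective_imp_isometric closed_subspace subspace_range_mat matrix_vector_mul_bounded_linear) auto
    then obtain e where e: "\<And>n. e n > 0" "\<And>n v. v \<in> R x \<Longrightarrow> e n * norm v \<le> norm (\<A> x n *v v)"
      by metis
    define C where "C = 2 * L ^ (q - 1) + (\<Sum>n<N. exp (\<sigma> * real n) / e n)"
    have s0: "0 \<le> (\<Sum>n<N. exp (\<sigma> * real n) / e n)"
      using e(1) by (intro sum_nonneg) (auto intro: less_imp_le)
    have "exp (\<sigma> * real n) * norm v \<le> C * norm (\<A> x n *v v)" if v: "v \<in> R x" for n v
    proof (cases "n < N")
      case True
      have "exp (\<sigma> * real n) * norm v = exp (\<sigma> * real n) / e n * (e n * norm v)"
        using e(1)[of n] by simp
      also have "\<dots> \<le> exp (\<sigma> * real n) / e n * norm (\<A> x n *v v)"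
        using e(1)[of n] by (intro mult_left_mono e(2) v) (auto intro: less_imp_le)
      also have "exp (\<sigma> * real n) / e n \<le> (\<Sum>n<N. exp (\<sigma> * real n) / e n)"
        using True e(1) by (intro member_le_sum) (auto intro: less_imp_le)
      also have "\<dots> \<le> C" using L(1) by (simp add: C_def)
      finally show ?thesis by (simp add: mult_right_mono)
    next
      case False
      show ?thesis
      proof (cases "q = 0")
        case True
        then have "v = 0" using elim(1) v by (auto simp: dim_eq_0)
        then show ?thesis by simp
      next
        case q0: False
        have n: "n \<ge> N" using False by simp
        have Vp: "V q n x > 0" using N[OF n] exp_gt_zero less_le_trans by blast
        define B where "B = L * exp ((\<theta> + \<epsilon>) * real n)"
        have "exp ((real q * \<theta> - \<epsilon>) * real n) * norm v \<le> V q n x * norm v"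
          using N[OF n] by (rule mult_right_mono) simp
        also have "\<dots> \<le> 2 * B ^ (q - 1) * norm (\<A> x n *v v)"
          using L by (intro V_lower_bound[OF elim(1) Vp]) (auto simp: B_def v)
        also have "B ^ (q - 1) = L ^ (q - 1) * exp ((real q - 1) * ((\<theta> + \<epsilon>) * real n))"
          using q0 by (simp add: B_def power_mult_distrib exp_of_nat_mult[symmetric] of_nat_diff)
        also have "(real q - 1) * ((\<theta> + \<epsilon>) * real n) = (real q * \<theta> - \<epsilon>) * real n + - ((\<theta> - real q * \<epsilon>) * real n)"
          by (simp add: algebra_simps)
        finally have "exp ((real q * \<theta> - \<epsilon>) * real n) * norm v
            \<le> exp ((real q * \<theta> - \<epsilon>) * real n) * (exp (- ((\<theta> - real q * \<epsilon>) * real n)) * (2 * L ^ (q - 1) * norm (\<A> x n *v v)))"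
          unfolding exp_add by (simp only: mult_ac)
        then have "norm v \<le> exp (- ((\<theta> - real q * \<epsilon>) * real n)) * (2 * L ^ (q - 1) * norm (\<A> x n *v v))"
          by simp
        then have "exp ((\<theta> - real q * \<epsilon>) * real n) * norm v
            \<le> exp ((\<theta> - real q * \<epsilon>) * real n) * (exp (- ((\<theta> - real q * \<epsilon>) * real n)) * (2 * L ^ (q - 1) * norm (\<A> x n *v v)))"
          by (rule mult_left_mono) simp
        then have "exp ((\<theta> - real q * \<epsilon>) * real n) * norm v \<le> 2 * L ^ (q - 1) * norm (\<A> x n *v v)"
          unfolding mult.assoc[symmetric] exp_add[symmetric] by simp
        moreover have "\<sigma> \<le> \<theta> - real q * \<epsilon>" using \<epsilon> by (simp add: algebra_simps)
        then have "exp (\<sigma> * real n) * norm v \<le> exp ((\<theta> - real q * \<epsilon>) * real n) * norm v"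
          by (intro mult_right_mono) (auto intro: mult_right_mono)
        moreover have "2 * L ^ (q - 1) * norm (\<A> x n *v v) \<le> C * norm (\<A> x n *v v)"
          using s0 by (intro mult_right_mono) (auto simp: C_def)
        ultimately show ?thesis by linarith
      qed
    qed
    moreover have "C \<ge> 0" using s0 L(1) by (simp add: C_def)
    ultimately show ?case by blast
  qed
qed

text \<open>The volume bound for a single step. \<open>H\<close> collects the factor 2, the power of
  \<open>exp (h x)\<close> and the negative part of \<open>ln (V q 1 x)\<close>.\<close>

lemma ex_integrable_step_bound:
  obtains H where "integrable M H" "\<And>x. 0 \<le> H x" "AE x in M. \<forall>v\<in>R x. norm v \<le> exp (H x) * norm (A x *v v)"
proof -
  obtain q \<rho> where q: "vol_exponent q" and \<rho>: "\<rho> < real (Suc q) * \<theta>"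
    "AE x in M. \<exists>C. \<forall>n. V (Suc q) n x \<le> C * exp (\<rho> * real n)"
    by (rule ex_max_vol_exponent)
  interpret S: submult_cocycle M f "V q" "\<lambda>x. real q * h x" by (rule V_submult)
  have ev: "AE x in M. \<forall>\<^sub>F n in sequentially. exp ((real q * \<theta> - 1) * real n) \<le> V q n x"
    using q by (auto simp: vol_exponent_def)
  define u where "u x = max 0 (- ln (V q 1 x))" for x
  have u: "integrable M u" unfolding u_def[abs_def] by (rule S.integrable_neg_log[OF ev])
  define H where "H x = ln 2 + real q * h x + u x" for x
  show ?thesis
  proof (rule that[of H])
    show "integrable M H" unfolding H_def[abs_def] using u h_integrable by simp
    show "0 \<le> H x" for x using h_nn[of x] by (simp add: H_def u_def)
    show "AE x in M. \<forall>v\<in>R x. norm v \<le> exp (H x) * norm (A x *v v)"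
      using dim_le_vol_exponent[OF q \<rho>] ev
    proof eventually_elim
      case (elim x)
      \<comment> \<open>Because \<open>ln 0 = 0\<close>, the function \<open>u\<close> does not
        detect a vanishing volume. By submultiplicativity such a zero would persist for all later
        times.\<close>
      have pos: "V q 1 x > 0"
      proof (rule ccontr)
        assume "\<not> V q 1 x > 0"
        then have "V q 1 x = 0" using S.V_nonneg[of 1 x] by simp
        then have z: "V q (Suc n) x \<le> 0" for n using S.V_Suc[of n x] by simp
        obtain N where "\<And>n. n \<ge> N \<Longrightarrow> exp ((real q * \<theta> - 1) * real n) \<le> V q n x"
          using elim(2) by (auto simp: eventually_sequentially)
        from this[of "Suc N"] show False using z[of N] exp_gt_zero[of "(real q * \<theta> - 1) * real (Suc N)"] by linarith
      qed
      show ?case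
      proof
        fix v assume v: "v \<in> R x"
        have "V q 1 x * norm v \<le> 2 * exp (h x) ^ (q - 1) * norm (\<A> x 1 *v v)"
          by (rule V_lower_bound[OF elim(1) pos _ _ v]) (simp_all add: A_le)
        also have "exp (h x) ^ (q - 1) \<le> exp (real q * h x)"
          using h_nn[of x] by (simp add: exp_of_nat_mult[symmetric] mult_right_mono)
        finally have "V q 1 x * norm v \<le> 2 * exp (real q * h x) * norm (A x *v v)"
          by (simp add: mult_right_mono mult_left_mono)
        moreover have "exp (- u x) \<le> exp (ln (V q 1 x))"
          unfolding exp_le_cancel_iff by (simp add: u_def)
        then have "exp (- u x) \<le> V q 1 x" using pos by (simp only: exp_ln)
        then have "exp (- u x) * norm v \<le> V q 1 x * norm v" by (rule mult_right_mono) simp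
        ultimately have "exp (- u x) * norm v \<le> 2 * exp (real q * h x) * norm (A x *v v)" by linarith
        then have "exp (u x) * (exp (- u x) * norm v) \<le> exp (u x) * (2 * exp (real q * h x) * norm (A x *v v))"
          by (rule mult_left_mono) simp
        then show "norm v \<le> exp (H x) * norm (A x *v v)"
          by (simp add: H_def exp_add exp_minus mult_ac)
      qed
    qed
  qed
qed

lemma P_tempered: "AE x in M. tempered f (\<lambda>x. ln (max 1 (basis_norm (P x)))) x"
proof -
  obtain H where H: "integrable M H" "\<And>x. 0 \<le> H x" "AE x in M. \<forall>v\<in>R x. norm v \<le> exp (H x) * norm (A x *v v)"
    using ex_integrable_step_bound by blast
  define d where "d = real (DIM(real^'d))"
  have d: "d \<ge> 1" unfolding d_def using DIM_positive[where 'a = "real^'d"] by linarith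
  show ?thesis
  proof (rule AE_tempered)
    show "integrable M (\<lambda>x. ln d + H x + h x)" using H(1) h_integrable by simp
    show "0 \<le> ln d + H x + h x" for x using H(2)[of x] h_nn[of x] d by simp
    show "0 \<le> ln (max 1 (basis_norm (P x)))" for x by simp
    show "AE x in M. ln (max 1 (basis_norm (P x))) \<le> ln (max 1 (basis_norm (P (f x)))) + (ln d + H x + h x)"
      using H(3)
    proof eventually_elim
      case (elim x)
      have "norm (P x *v b) \<le> exp (H x) * (basis_norm (P (f x)) * exp (h x))" if b: "b \<in> Basis" for b
      proof -
        have "norm (P x *v b) \<le> exp (H x) * norm (A x *v (P x *v b))" using elim by simp
        also have "A x *v (P x *v b) = P (f x) *v (A x *v b)"
          by (simp add: matrix_vector_mul_assoc P_equiv)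
        also have "norm \<dots> \<le> basis_norm (P (f x)) * norm (A x *v b)" by (rule norm_le_basis_norm)
        also have "norm (A x *v b) \<le> exp (h x)" using A_le[of x b] b by simp
        finally show ?thesis by (simp add: mult_left_mono basis_norm_nonneg)
      qed
      then have "basis_norm (P x) \<le> (\<Sum>b\<in>(Basis :: (real^'d) set). exp (H x) * (basis_norm (P (f x)) * exp (h x)))"
        unfolding basis_norm_def[of "P x"] by (intro sum_mono)
      also have "\<dots> = exp (ln d + H x + h x) * basis_norm (P (f x))"
        using d by (simp add: d_def exp_add mult_ac)
      also have "\<dots> \<le> exp (ln d + H x + h x) * max 1 (basis_norm (P (f x)))"
        by (intro mult_left_mono) auto
      finally have "basis_norm (P x) \<le> exp (ln d + H x + h x) * max 1 (basis_norm (P (f x)))" .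
      moreover have "1 * 1 \<le> exp (ln d + H x + h x) * max 1 (basis_norm (P (f x)))"
        using H(2)[of x] h_nn[of x] d by (intro mult_mono) auto
      ultimately have "max 1 (basis_norm (P x)) \<le> exp (ln d + H x + h x) * max 1 (basis_norm (P (f x)))" by simp
      then have "ln (max 1 (basis_norm (P x))) \<le> ln (exp (ln d + H x + h x) * max 1 (basis_norm (P (f x))))"
        by (subst ln_le_cancel_iff) auto
      also have "\<dots> = ln (max 1 (basis_norm (P (f x)))) + (ln d + H x + h x)"
        by (subst ln_mult) auto
      finally show ?case .
    qed
  qed measurable
qed

text \<open>The counterpart of \<open>upper_const\<close> with the norm of the inverse iterate. It
  is meaningful where a uniform lower bound exists, hence almost everywhere.\<close>

definition lower_const :: "real \<Rightarrow> 'x \<Rightarrow> real" where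
  "lower_const \<sigma> x = max 1 (SUP n. exp (\<sigma> * real n) * inv_norm (\<A> x n) (P x))"

lemma lower_const_meas [measurable]: "lower_const \<sigma> \<in> borel_measurable M"
proof -
  have "(\<lambda>x. SUP n. exp (\<sigma> * real n) * inv_norm (\<A> x n) (P x)) \<in> borel_measurable M"
    by (rule borel_measurable_cSUP_real) auto
  then show ?thesis unfolding lower_const_def[abs_def] by measurable
qed

lemma lower_const_le:
  assumes "\<And>n v. v \<in> R x \<Longrightarrow> exp (\<sigma> * real n) * norm v \<le> C * norm (\<A> x n *v v)" "1 \<le> C"
  shows "lower_const \<sigma> x \<le> C" and "v \<in> R x \<Longrightarrow> exp (\<sigma> * real n) * norm v \<le> lower_const \<sigma> x * norm (\<A> x n *v v)"
proof -
  have b: "norm v \<le> C * exp (- (\<sigma> * real n)) * norm (\<A> x n *v v)" if "v \<in> R x" for n v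
    using assms(1)[OF that, of n] by (simp add: exp_minus field_simps)
  have c: "0 \<le> C * exp (- (\<sigma> * real n))" for n using assms(2) by simp
  have le: "exp (\<sigma> * real n) * inv_norm (\<A> x n) (P x) \<le> C" for n
    using inv_norm_le(1)[OF b c] by (simp add: exp_minus field_simps)
  show "lower_const \<sigma> x \<le> C" using le assms(2) by (auto simp: lower_const_def intro!: cSUP_least)
  assume v: "v \<in> R x"
  have "exp (\<sigma> * real n) * inv_norm (\<A> x n) (P x) \<le> (SUP n. exp (\<sigma> * real n) * inv_norm (\<A> x n) (P x))"
    by (rule cSUP_upper) (auto intro: bdd_aboveI2[OF le])
  then have lower_const: "exp (\<sigma> * real n) * inv_norm (\<A> x n) (P x) \<le> lower_const \<sigma> x" by (simp add: lower_const_def)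
  have "exp (\<sigma> * real n) * norm v \<le> exp (\<sigma> * real n) * (inv_norm (\<A> x n) (P x) * norm (\<A> x n *v v))"
    by (intro mult_left_mono inv_norm_le(2)[OF b c v]) auto
  also have "\<dots> \<le> lower_const \<sigma> x * norm (\<A> x n *v v)"
    unfolding mult.assoc[symmetric] by (intro mult_right_mono lower_const) auto
  finally show "exp (\<sigma> * real n) * norm v \<le> lower_const \<sigma> x * norm (\<A> x n *v v)" .
qed

text \<open>Here the comparison runs from \<open>x\<close> to \<open>f x\<close>: by
  \<open>surj\<close> a vector over \<open>f x\<close> is the image of some \<open>w\<close> over
  \<open>x\<close>, and the bound for \<open>n + 1\<close> steps from \<open>w\<close> gives one for
  \<open>n\<close> steps from the image. This is the case for which the reversed form
  \<open>AE_tempered'\<close> is made.\<close>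

lemma lower_const_bound:
  assumes "\<sigma> < \<theta>"
  shows "AE x in M. \<forall>n. \<forall>v\<in>R x. exp (\<sigma> * real n) * norm v \<le> lower_const \<sigma> x * norm (\<A> x n *v v)"
    and "AE x in M. tempered f (\<lambda>x. ln (lower_const \<sigma> x)) x"
proof -
  show AEb: "AE x in M. \<forall>n. \<forall>v\<in>R x. exp (\<sigma> * real n) * norm v \<le> lower_const \<sigma> x * norm (\<A> x n *v v)"
    using AE_uniform_lower_bound[OF assms]
  proof eventually_elim
    case (elim x)
    then obtain C where C: "C \<ge> 0" "\<And>n v. v \<in> R x \<Longrightarrow> exp (\<sigma> * real n) * norm v \<le> C * norm (\<A> x n *v v)"
      by blast
    have "exp (\<sigma> * real n) * norm v \<le> max 1 C * norm (\<A> x n *v v)" if "v \<in> R x" for n v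
      by (rule order.trans[OF C(2)[OF that]]) (simp add: mult_right_mono)
    from lower_const_le(2)[OF this] show ?case by simp
  qed
  have low1: "1 \<le> lower_const \<sigma> x" for x by (simp add: lower_const_def)
  show "AE x in M. tempered f (\<lambda>x. ln (lower_const \<sigma> x)) x"
  proof (rule AE_tempered')
    show "integrable M (\<lambda>x. h x + \<bar>\<sigma>\<bar>)" using h_integrable by simp
    show "0 \<le> h x + \<bar>\<sigma>\<bar>" for x using h_nn[of x] by simp
    show "0 \<le> ln (lower_const \<sigma> x)" for x using low1 by simp
    show "AE x in M. ln (lower_const \<sigma> (f x)) \<le> ln (lower_const \<sigma> x) + (h x + \<bar>\<sigma>\<bar>)"
      using AEb
    proof eventually_elim
      case (elim x)
      have "lower_const \<sigma> (f x) \<le> exp (h x + \<bar>\<sigma>\<bar>) * lower_const \<sigma> x"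
      proof (rule lower_const_le(1))
        have "1 * 1 \<le> exp (h x + \<bar>\<sigma>\<bar>) * lower_const \<sigma> x"
          using h_nn[of x] by (intro mult_mono low1) auto
        then show "1 \<le> exp (h x + \<bar>\<sigma>\<bar>) * lower_const \<sigma> x" by simp
      next
        fix n v assume "v \<in> R (f x)"
        then obtain w where w: "w \<in> R x" "v = A x *v w" using surj by blast
        have "exp (\<sigma> * real n) * norm v \<le> exp (\<sigma> * real n) * (exp (h x) * norm w)"
          unfolding w(2) by (intro mult_left_mono A_le) auto
        also have "\<dots> = exp (h x - \<sigma>) * (exp (\<sigma> * real (Suc n)) * norm w)"
          by (simp add: exp_diff exp_add algebra_simps)
        also have "\<dots> \<le> exp (h x - \<sigma>) * (lower_const \<sigma> x * norm (\<A> x (Suc n) *v w))"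
          by (intro mult_left_mono elim[rule_format] w) auto
        also have "\<A> x (Suc n) *v w = \<A> (f x) n *v v"
          unfolding cocycle_Suc' w(2) by (simp flip: matrix_vector_mul_assoc)
        also have "exp (h x - \<sigma>) * (lower_const \<sigma> x * norm (\<A> (f x) n *v v))
            \<le> exp (h x + \<bar>\<sigma>\<bar>) * (lower_const \<sigma> x * norm (\<A> (f x) n *v v))"
          using low1[of x] by (intro mult_right_mono) auto
        finally show "exp (\<sigma> * real n) * norm v \<le> exp (h x + \<bar>\<sigma>\<bar>) * lower_const \<sigma> x * norm (\<A> (f x) n *v v)"
          by (simp add: mult.assoc)
      qed
      then have "ln (lower_const \<sigma> (f x)) \<le> ln (exp (h x + \<bar>\<sigma>\<bar>) * lower_const \<sigma> x)"
        using low1[of x] low1[of "f x"] by (subst ln_le_cancel_iff) auto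
      also have "\<dots> = ln (lower_const \<sigma> x) + (h x + \<bar>\<sigma>\<bar>)"
        using low1[of x] by (subst ln_mult) auto
      finally show ?case .
    qed
  qed measurable
qed

end

subsection \<open>Estimates for the splitting\<close>

text \<open>At tempered points, the smallest function above \<open>exp g\<close> along the orbit
  that changes by at most a factor \<open>exp (\<epsilon> * |n|)\<close> under \<open>n\<close>
  steps in either direction.\<close>

definition tempered_envelope :: "('x \<Rightarrow> 'x) \<Rightarrow> ('x \<Rightarrow> real) \<Rightarrow> real \<Rightarrow> 'x \<Rightarrow> real" where
  "tempered_envelope f g \<epsilon> x = exp (SUP n::int. g (int_iter f n x) - \<epsilon> * \<bar>real_of_int n\<bar>)"

lemma tempered_envelope_pos: "0 < tempered_envelope f g \<epsilon> x"
  by (simp add: tempered_envelope_def)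

context ergodic_bij
begin

lemma tempered_envelope_meas [measurable (raw)]:
  assumes [measurable]: "g \<in> borel_measurable M"
  shows "tempered_envelope f g \<epsilon> \<in> borel_measurable M"
proof -
  have "(\<lambda>x. SUP n::int. g (int_iter f n x) - \<epsilon> * \<bar>real_of_int n\<bar>) \<in> borel_measurable M"
    by (rule borel_measurable_cSUP_real) auto
  then show ?thesis unfolding tempered_envelope_def[abs_def] by measurable
qed

lemma le_tempered_envelope:
  assumes "tempered f g x" "0 < \<epsilon>"
  shows "exp (g x) \<le> tempered_envelope f g \<epsilon> x"
proof -
  have "g (int_iter f 0 x) - \<epsilon> * \<bar>real_of_int 0\<bar> \<le> (SUP n::int. g (int_iter f n x) - \<epsilon> * \<bar>real_of_int n\<bar>)"
    by (rule cSUP_upper) (use assms in \<open>auto simp: tempered_def\<close>)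
  then show ?thesis by (simp add: tempered_envelope_def)
qed

lemma ln_le_tempered_envelope:
  assumes "tempered f (\<lambda>x. ln (g x)) x" "0 < \<epsilon>" "0 < g x"
  shows "g x \<le> tempered_envelope f (\<lambda>x. ln (g x)) \<epsilon> x"
  using le_tempered_envelope[OF assms(1,2)] assms(3) by simp

lemma tempered_envelope_int_iter:
  assumes "tempered f g x" "0 < \<epsilon>"
  shows "tempered_envelope f g \<epsilon> (int_iter f n x) \<le> tempered_envelope f g \<epsilon> x * exp (\<epsilon> * \<bar>real_of_int n\<bar>)"
proof -
  define s where "s = (SUP n::int. g (int_iter f n x) - \<epsilon> * \<bar>real_of_int n\<bar>)"
  have "g (int_iter f m (int_iter f n x)) - \<epsilon> * \<bar>real_of_int m\<bar> \<le> s + \<epsilon> * \<bar>real_of_int n\<bar>" for m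
  proof -
    have "g (int_iter f (m + n) x) - \<epsilon> * \<bar>real_of_int (m + n)\<bar> \<le> s"
      unfolding s_def by (rule cSUP_upper) (use assms in \<open>auto simp: tempered_def\<close>)
    moreover have "\<epsilon> * \<bar>real_of_int (m + n)\<bar> \<le> \<epsilon> * \<bar>real_of_int m\<bar> + \<epsilon> * \<bar>real_of_int n\<bar>"
      unfolding distrib_left[symmetric] using assms(2) by (intro mult_left_mono) auto
    ultimately show ?thesis by (simp add: int_iter_add)
  qed
  then have "(SUP m::int. g (int_iter f m (int_iter f n x)) - \<epsilon> * \<bar>real_of_int m\<bar>) \<le> s + \<epsilon> * \<bar>real_of_int n\<bar>"
    by (intro cSUP_least) auto
  then show ?thesis
    unfolding tempered_envelope_def s_def[symmetric] exp_add[symmetric] by simp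
qed

end

text \<open>Separates what requires a finite exponent (\<open>unif\<close>) from what also holds for
  the exponent \<open>- \<infinity>\<close> (\<open>growth\<close>).\<close>

locale oseledets_projections = ergodic_bij M f for M :: "'x measure" and f +
  fixes A :: "'x \<Rightarrow> real^'d^'d" and h :: "'x \<Rightarrow> real" and k :: nat and lam :: "nat \<Rightarrow> ereal"
    and P :: "nat \<Rightarrow> 'x \<Rightarrow> real^'d^'d"
  assumes proj: "j \<in> {1..k} \<Longrightarrow> invariant_projection M f A (P j) h"
    and unif: "j \<in> {1..k} \<Longrightarrow> - \<infinity> < lam j \<Longrightarrow> uniform_exponent M f A (P j) h (real_of_ereal (lam j))"
    and growth: "j \<in> {1..k} \<Longrightarrow> lam j < ereal \<rho> \<Longrightarrow> v \<in> range ((*v) (P j x)) \<Longrightarrow>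
      \<forall>\<^sub>F n in sequentially. norm (cocycle f A x n *v v) \<le> exp (\<rho> * real n)"
    and lam_mono: "strict_mono_on {1..k} lam"
    and lam_less: "j \<in> {1..k} \<Longrightarrow> lam j < \<infinity>"
begin

abbreviation "\<A> \<equiv> cocycle f A"
abbreviation "upper_at j \<equiv> invariant_projection.upper_const f A (P j)"
abbreviation "lower_at j \<equiv> uniform_exponent.lower_const f A (P j)"
abbreviation "proj_env j \<equiv> tempered_envelope f (\<lambda>x. ln (max 1 (basis_norm (P j x))))"
abbreviation "upper_env j \<rho> \<equiv> tempered_envelope f (\<lambda>x. ln (upper_at j \<rho> x))"
abbreviation "lower_env j \<sigma> \<equiv> tempered_envelope f (\<lambda>x. ln (lower_at j \<sigma> x))"

text \<open>Only rational rates occur, so that countably many null sets suffice and one set of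
  points serves every \<open>\<epsilon>\<close>.\<close>

definition regular :: "'x \<Rightarrow> bool" where
  "regular x \<longleftrightarrow> (\<forall>j\<in>{1..k}.
     (\<forall>\<rho>\<in>\<rat>. lam j < ereal \<rho> \<longrightarrow> tempered f (\<lambda>x. ln (upper_at j \<rho> x)) x) \<and>
     (- \<infinity> < lam j \<longrightarrow> tempered f (\<lambda>x. ln (max 1 (basis_norm (P j x)))) x \<and>
        (\<forall>\<sigma>\<in>\<rat>. ereal \<sigma> < lam j \<longrightarrow> tempered f (\<lambda>x. ln (lower_at j \<sigma> x)) x \<and>
          (\<forall>n. \<forall>v\<in>range ((*v) (P j x)). exp (\<sigma> * real n) * norm v \<le> lower_at j \<sigma> x * norm (\<A> x n *v v)))))"

lemma AE_regular: "AE x in M. regular x"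
proof -
  have 1: "AE x in M. tempered f (\<lambda>x. ln (upper_at j \<rho> x)) x" if "j \<in> {1..k}" "lam j < ereal \<rho>" for j \<rho>
    by (rule invariant_projection.upper_const_bound(2)[OF proj[OF that(1)] growth[OF that]])
  have 2: "AE x in M. tempered f (\<lambda>x. ln (max 1 (basis_norm (P j x)))) x" if "j \<in> {1..k}" "- \<infinity> < lam j" for j
    by (rule uniform_exponent.P_tempered[OF unif[OF that]])
  have 3: "AE x in M. tempered f (\<lambda>x. ln (lower_at j \<sigma> x)) x \<and>
          (\<forall>n. \<forall>v\<in>range ((*v) (P j x)). exp (\<sigma> * real n) * norm v \<le> lower_at j \<sigma> x * norm (\<A> x n *v v))"
    if "j \<in> {1..k}" "- \<infinity> < lam j" "ereal \<sigma> < lam j" for j \<sigma>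
  proof -
    have "\<sigma> < real_of_ereal (lam j)"
      using that lam_less[OF that(1)] by (cases "lam j") auto
    from uniform_exponent.lower_const_bound[OF unif[OF that(1,2)] this] show ?thesis by eventually_elim auto
  qed
  have 4: "AE x in M. \<forall>\<rho>\<in>\<rat>. lam j < ereal \<rho> \<longrightarrow> tempered f (\<lambda>x. ln (upper_at j \<rho> x)) x" if "j \<in> {1..k}" for j
    unfolding AE_ball_countable[OF countable_rat] by (intro ballI AE_impI 1 that)
  have 5: "AE x in M. \<forall>\<sigma>\<in>\<rat>. ereal \<sigma> < lam j \<longrightarrow> tempered f (\<lambda>x. ln (lower_at j \<sigma> x)) x \<and>
          (\<forall>n. \<forall>v\<in>range ((*v) (P j x)). exp (\<sigma> * real n) * norm v \<le> lower_at j \<sigma> x * norm (\<A> x n *v v))"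
    if "j \<in> {1..k}" "- \<infinity> < lam j" for j
    unfolding AE_ball_countable[OF countable_rat] by (intro ballI AE_impI 3 that)
  show ?thesis
    unfolding regular_def
    by (intro AE_finite_allI[OF finite_atLeastAtMost] AE_conjI AE_impI 2 4 5)
qed

definition finite_idx :: "nat set" where
  "finite_idx = {j\<in>{1..k}. - \<infinity> < lam j}"

text \<open>The sum covers the projections with finite exponent. The extra 1 stands for the
  identity, from which a projection with exponent \<open>- \<infinity>\<close> is obtained by
  subtracting the others.\<close>

definition angle_const :: "real \<Rightarrow> 'x \<Rightarrow> real" where
  "angle_const \<delta> x = 1 + (\<Sum>j\<in>finite_idx. proj_env j \<delta> x)"

lemma finite_idx_tail: "j \<in> {1..k} \<Longrightarrow> l \<in> {1..k} \<Longrightarrow> l < j \<Longrightarrow> j \<in> finite_idx"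
  using strict_mono_onD[OF lam_mono, of l j] by (auto simp: finite_idx_def order.strict_trans1)

lemma finite_finite_idx [simp]: "finite finite_idx"
  by (simp add: finite_idx_def)

lemma angle_const_ge_1: "1 \<le> angle_const \<delta> x"
  unfolding angle_const_def by (auto intro!: sum_nonneg less_imp_le[OF tempered_envelope_pos])

lemma angle_const_meas [measurable]: "angle_const \<delta> \<in> borel_measurable M"
proof -
  have [measurable]: "P j \<in> borel_measurable M" if "j \<in> finite_idx" for j
    using invariant_projection.P_meas[OF proj[of j]] that by (simp add: finite_idx_def)
  show ?thesis unfolding angle_const_def[abs_def] by measurable
qed

text \<open>Bounding by \<open>angle_const \<delta> x - 1\<close> leaves room for one further
  \<open>norm v\<close> in \<open>norm_proj_le\<close> and \<open>angle_estimate\<close>.\<close>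

lemma norm_sum_proj_le:
  assumes "regular x" "0 < \<delta>" "J \<subseteq> finite_idx"
  shows "(\<Sum>j\<in>J. norm (P j x *v v)) \<le> (angle_const \<delta> x - 1) * norm v"
proof -
  let ?e = "\<lambda>j. proj_env j \<delta> x"
  have "(\<Sum>j\<in>J. norm (P j x *v v)) \<le> (\<Sum>j\<in>J. ?e j * norm v)"
  proof (rule sum_mono)
    fix j assume "j \<in> J"
    then have "tempered f (\<lambda>x. ln (max 1 (basis_norm (P j x)))) x"
      using assms by (auto simp: regular_def finite_idx_def)
    then have "max 1 (basis_norm (P j x)) \<le> ?e j"
      using assms(2) by (intro ln_le_tempered_envelope) auto
    then have "basis_norm (P j x) * norm v \<le> ?e j * norm v"
      by (intro mult_right_mono) auto
    then show "norm (P j x *v v) \<le> ?e j * norm v"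
      using norm_le_basis_norm[of "P j x" v] by linarith
  qed
  also have "\<dots> \<le> (\<Sum>j\<in>finite_idx. ?e j * norm v)"
    using assms(3) by (intro sum_mono2) (auto intro: mult_nonneg_nonneg less_imp_le[OF tempered_envelope_pos])
  also have "\<dots> = (angle_const \<delta> x - 1) * norm v" by (simp add: angle_const_def sum_distrib_right)
  finally show ?thesis .
qed

text \<open>At most the first exponent is \<open>- \<infinity>\<close>. If \<open>j\<close> is that
  index, \<open>P j\<close> is the identity minus the remaining projections, all of which are
  controlled.\<close>

lemma norm_proj_le:
  assumes reg: "regular x" "0 < \<delta>" and j: "j \<in> {1..k}" and sum: "(\<Sum>j\<in>{1..k}. P j x *v v) = v"
  shows "norm (P j x *v v) \<le> angle_const \<delta> x * norm v"
proof (cases "j \<in> finite_idx")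
  case True
  then have "norm (P j x *v v) \<le> (angle_const \<delta> x - 1) * norm v"
    using norm_sum_proj_le[OF reg, of "{j}" v] by simp
  also have "\<dots> \<le> angle_const \<delta> x * norm v" by (intro mult_right_mono) auto
  finally show ?thesis .
next
  case False
  then have "{1..k} - {j} \<subseteq> finite_idx"
    using j finite_idx_tail by (metis DiffE insertCI linorder_neqE_nat subsetI)
  note le = norm_sum_proj_le[OF reg this, of v]
  have "v = P j x *v v + (\<Sum>l\<in>{1..k} - {j}. P l x *v v)"
    using sum.remove[OF _ j, of "\<lambda>l. P l x *v v"] sum by simp
  then have "P j x *v v = v - (\<Sum>l\<in>{1..k} - {j}. P l x *v v)" by (metis add_diff_cancel_right')
  then have "norm (P j x *v v) \<le> norm v + norm (\<Sum>l\<in>{1..k} - {j}. P l x *v v)"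
    by (metis norm_triangle_ineq4)
  also have "\<dots> \<le> norm v + (\<Sum>l\<in>{1..k} - {j}. norm (P l x *v v))"
    by (intro add_left_mono norm_sum)
  also have "\<dots> \<le> angle_const \<delta> x * norm v" using le by (simp add: algebra_simps)
  finally show ?thesis .
qed

lemma angle_const_int_iter:
  assumes "regular x" "0 < \<delta>"
  shows "angle_const \<delta> (int_iter f n x) \<le> angle_const \<delta> x * exp (\<delta> * \<bar>real_of_int n\<bar>)"
proof -
  have "angle_const \<delta> (int_iter f n x) \<le> 1 * exp (\<delta> * \<bar>real_of_int n\<bar>) +
     (\<Sum>j\<in>finite_idx. proj_env j \<delta> x * exp (\<delta> * \<bar>real_of_int n\<bar>))"
    unfolding angle_const_def
  proof (intro add_mono sum_mono)
    show "1 \<le> 1 * exp (\<delta> * \<bar>real_of_int n\<bar>)" using assms(2) by simp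
  next
    fix j assume "j \<in> finite_idx"
    then show "proj_env j \<delta> (int_iter f n x) \<le>
       proj_env j \<delta> x * exp (\<delta> * \<bar>real_of_int n\<bar>)"
      using assms by (intro tempered_envelope_int_iter) (auto simp: regular_def finite_idx_def)
  qed
  then show ?thesis by (simp add: angle_const_def sum_distrib_right distrib_right)
qed

text \<open>Serves both growth estimates: \<open>angle_const\<close> passes between a vector and its
  components, the sums supply the constants of the summands. As a product of two functions of rate
  \<open>\<delta>\<close> it has rate \<open>2 * \<delta>\<close>.\<close>

definition growth_const :: "nat \<Rightarrow> real \<Rightarrow> real \<Rightarrow> real \<Rightarrow> 'x \<Rightarrow> real" where
  "growth_const i \<rho> \<sigma> \<delta> x = angle_const \<delta> x * (1 + (\<Sum>j\<in>{1..i}. upper_env j \<rho> \<delta> x)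
      + (\<Sum>j\<in>{i+1..k}. lower_env j \<sigma> \<delta> x))"

lemma growth_const_pos: "0 < growth_const i \<rho> \<sigma> \<delta> x"
proof -
  have "0 \<le> (\<Sum>j\<in>{1..i}. upper_env j \<rho> \<delta> x)"
    "0 \<le> (\<Sum>j\<in>{i+1..k}. lower_env j \<sigma> \<delta> x)"
    by (auto intro!: sum_nonneg less_imp_le[OF tempered_envelope_pos])
  then show ?thesis unfolding growth_const_def using angle_const_ge_1[of \<delta> x] by (intro mult_pos_pos) linarith+
qed

context
  fixes i :: nat
  assumes i: "i \<in> {1..k}"
begin

lemma growth_const_meas [measurable]: "growth_const i \<rho> \<sigma> \<delta> \<in> borel_measurable M"
proof -
  have [measurable]: "upper_at j \<rho> \<in> borel_measurable M" if "j \<in> {1..i}" for j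
    using invariant_projection.upper_const_meas[OF proj[of j]] that i by simp
  have [measurable]: "lower_at j \<sigma> \<in> borel_measurable M" if "j \<in> {i+1..k}" for j
    using uniform_exponent.lower_const_meas[OF unif[of j]] finite_idx_tail[of j i] that i by (simp add: finite_idx_def)
  show ?thesis unfolding growth_const_def[abs_def] by measurable
qed

lemma growth_const_int_iter:
  assumes x: "regular x" and \<delta>: "0 < \<delta>" and \<rho>: "\<rho> \<in> \<rat>" "lam i < ereal \<rho>"
    and \<sigma>: "\<sigma> \<in> \<rat>" "i < k \<Longrightarrow> ereal \<sigma> < lam (i + 1)"
  shows "growth_const i \<rho> \<sigma> \<delta> (int_iter f n x) \<le> growth_const i \<rho> \<sigma> \<delta> x * exp (2 * \<delta> * \<bar>real_of_int n\<bar>)"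
proof -
  let ?e = "exp (\<delta> * \<bar>real_of_int n\<bar>)"
  have upt: "tempered f (\<lambda>x. ln (upper_at j \<rho> x)) x" if "j \<in> {1..i}" for j
  proof -
    have "lam j \<le> lam i"
      using strict_mono_onD[OF lam_mono, of j i] that i by (cases "j = i") auto
    then show ?thesis using that i \<rho> x by (auto simp: regular_def)
  qed
  have lowt: "tempered f (\<lambda>x. ln (lower_at j \<sigma> x)) x" if "j \<in> {i+1..k}" for j
  proof -
    have "lam (i + 1) \<le> lam j"
      using strict_mono_onD[OF lam_mono, of "i + 1" j] that i by (cases "j = i + 1") auto
    then have "ereal \<sigma> < lam j" using \<sigma> that by (auto intro: order.strict_trans2)
    then show ?thesis using that i \<sigma> x finite_idx_tail[of j i] by (auto simp: regular_def finite_idx_def)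
  qed
  have "1 + (\<Sum>j\<in>{1..i}. upper_env j \<rho> \<delta> (int_iter f n x))
      + (\<Sum>j\<in>{i+1..k}. lower_env j \<sigma> \<delta> (int_iter f n x))
     \<le> 1 * ?e + (\<Sum>j\<in>{1..i}. upper_env j \<rho> \<delta> x * ?e)
      + (\<Sum>j\<in>{i+1..k}. lower_env j \<sigma> \<delta> x * ?e)"
    using \<delta> by (intro add_mono sum_mono tempered_envelope_int_iter upt lowt) auto
  then have "growth_const i \<rho> \<sigma> \<delta> (int_iter f n x) \<le> (angle_const \<delta> x * ?e) *
      (1 * ?e + (\<Sum>j\<in>{1..i}. upper_env j \<rho> \<delta> x * ?e)
      + (\<Sum>j\<in>{i+1..k}. lower_env j \<sigma> \<delta> x * ?e))"
    unfolding growth_const_def using angle_const_ge_1[of \<delta> x] angle_const_ge_1[of \<delta> "int_iter f n x"]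
    by (intro mult_mono angle_const_int_iter x \<delta>)
       (auto intro!: add_nonneg_nonneg sum_nonneg less_imp_le[OF tempered_envelope_pos])
  also have "\<dots> = growth_const i \<rho> \<sigma> \<delta> x * (?e * ?e)"
    unfolding growth_const_def sum_distrib_right[symmetric] distrib_right[symmetric] by (simp only: mult_ac)
  also have "?e * ?e = exp (2 * \<delta> * \<bar>real_of_int n\<bar>)"
    unfolding exp_add[symmetric] by simp
  finally show ?thesis .
qed

lemma upper_estimate:
  assumes x: "regular x" and \<delta>: "0 < \<delta>" and \<rho>: "\<rho> \<in> \<rat>" "lam i < ereal \<rho>"
    and sum: "(\<Sum>j\<in>{1..k}. P j x *v v) = v" and v: "\<And>j. j \<in> {i+1..k} \<Longrightarrow> P j x *v v = 0"
  shows "norm (\<A> x n *v v) \<le> growth_const i \<rho> \<sigma> \<delta> x * exp (\<rho> * real n) * norm v"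
proof -
  let ?u = "\<lambda>j. upper_env j \<rho> \<delta> x"
  have "(\<Sum>j\<in>{1..k}. P j x *v v) = (\<Sum>j\<in>{1..i}. P j x *v v)"
    using i v by (intro sum.mono_neutral_right) auto
  then have veq: "(\<Sum>j\<in>{1..i}. P j x *v v) = v" using sum by simp
  have "\<A> x n *v v = (\<Sum>j\<in>{1..i}. \<A> x n *v (P j x *v v))"
    using linear_sum[OF matrix_vector_mul_linear, of "\<A> x n" "\<lambda>j. P j x *v v" "{1..i}"] unfolding veq .
  then have "norm (\<A> x n *v v) \<le> (\<Sum>j\<in>{1..i}. norm (\<A> x n *v (P j x *v v)))"
    by (simp add: norm_sum)
  also have "\<dots> \<le> (\<Sum>j\<in>{1..i}. ?u j * (exp (\<rho> * real n) * (angle_const \<delta> x * norm v)))"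
  proof (rule sum_mono)
    fix j assume j: "j \<in> {1..i}"
    then have jk: "j \<in> {1..k}" using i by auto
    have "lam j \<le> lam i"
      using strict_mono_onD[OF lam_mono, of j i] j i by (cases "j = i") auto
    then have lj: "lam j < ereal \<rho>" using \<rho>(2) by simp
    then have t: "tempered f (\<lambda>x. ln (upper_at j \<rho> x)) x" using jk \<rho>(1) x by (auto simp: regular_def)
    have "0 < upper_at j \<rho> x" by (simp add: invariant_projection.upper_const_def[OF proj[OF jk]] less_max_iff_disj)
    then have le: "upper_at j \<rho> x \<le> ?u j" by (intro ln_le_tempered_envelope t \<delta>)
    have "norm (\<A> x n *v (P j x *v v)) \<le> upper_at j \<rho> x * exp (\<rho> * real n) * norm (P j x *v v)"
      by (rule invariant_projection.upper_const_bound(1)[OF proj[OF jk] growth[OF jk lj]]) auto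
    also have "\<dots> \<le> ?u j * exp (\<rho> * real n) * (angle_const \<delta> x * norm v)"
      using norm_proj_le[OF x \<delta> jk sum] le
      by (intro mult_mono) (auto intro!: mult_nonneg_nonneg less_imp_le[OF tempered_envelope_pos])
    finally show "norm (\<A> x n *v (P j x *v v)) \<le> ?u j * (exp (\<rho> * real n) * (angle_const \<delta> x * norm v))"
      by (simp add: mult.assoc)
  qed
  also have "\<dots> = (\<Sum>j\<in>{1..i}. ?u j) * (exp (\<rho> * real n) * (angle_const \<delta> x * norm v))"
    by (simp add: sum_distrib_right)
  also have "\<dots> \<le> (1 + (\<Sum>j\<in>{1..i}. ?u j) + (\<Sum>j\<in>{i+1..k}. lower_env j \<sigma> \<delta> x))
      * (exp (\<rho> * real n) * (angle_const \<delta> x * norm v))"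
    using angle_const_ge_1[of \<delta> x]
    by (intro mult_right_mono) (auto intro!: add_nonneg_nonneg sum_nonneg less_imp_le[OF tempered_envelope_pos])
  finally show ?thesis by (simp add: growth_const_def mult_ac)
qed

text \<open>The components of \<open>v\<close> are bounded below separately. To compare their images
  with the whole image, the projections at \<open>(f ^^ n) x\<close> are used, as these commute with
  the cocycle; the angle there costs the factor \<open>exp (\<delta> * n)\<close>.\<close>

lemma lower_estimate:
  assumes x: "regular x" and \<delta>: "0 < \<delta>" and \<sigma>: "\<sigma> \<in> \<rat>" "i < k \<Longrightarrow> ereal \<sigma> < lam (i + 1)"
    and sum: "(\<Sum>j\<in>{1..k}. P j x *v v) = v" and v: "\<And>j. j \<in> {1..i} \<Longrightarrow> P j x *v v = 0"
    and reg_n: "regular ((f ^^ n) x)"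
  shows "exp (\<sigma> * real n) * norm v \<le> growth_const i \<rho> \<sigma> \<delta> x * exp (\<delta> * real n) * norm (\<A> x n *v v)"
proof -
  let ?l = "\<lambda>j. lower_env j \<sigma> \<delta> x"
  let ?Av = "norm (\<A> x n *v v)"
  have Kn: "angle_const \<delta> ((f ^^ n) x) \<le> angle_const \<delta> x * exp (\<delta> * real n)"
    using angle_const_int_iter[OF x \<delta>, of "int n"] by (simp add: int_iter_def)
  have "(\<Sum>j\<in>{1..k}. P j x *v v) = (\<Sum>j\<in>{i+1..k}. P j x *v v)"
    using i v by (intro sum.mono_neutral_right) auto
  then have veq: "(\<Sum>j\<in>{i+1..k}. P j x *v v) = v" using sum by simp
  have "norm v \<le> (\<Sum>j\<in>{i+1..k}. norm (P j x *v v))"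
    using norm_sum[of "\<lambda>j. P j x *v v" "{i+1..k}"] unfolding veq .
  then have "exp (\<sigma> * real n) * norm v \<le> (\<Sum>j\<in>{i+1..k}. exp (\<sigma> * real n) * norm (P j x *v v))"
    unfolding sum_distrib_left[symmetric] by (intro mult_left_mono) auto
  also have "\<dots> \<le> (\<Sum>j\<in>{i+1..k}. ?l j * (angle_const \<delta> x * exp (\<delta> * real n) * ?Av))"
  proof (rule sum_mono)
    fix j assume j: "j \<in> {i+1..k}"
    then have jk: "j \<in> {1..k}" and jf: "j \<in> finite_idx" using i finite_idx_tail[of j i] by auto
    then have fin: "- \<infinity> < lam j" by (simp add: finite_idx_def)
    have "lam (i + 1) \<le> lam j"
      using strict_mono_onD[OF lam_mono, of "i + 1" j] j i by (cases "j = i + 1") auto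
    then have \<sigma>j: "ereal \<sigma> < lam j" using \<sigma> j by (auto intro: order.strict_trans2)
    have t: "tempered f (\<lambda>x. ln (lower_at j \<sigma> x)) x"
      and b: "\<And>n v. v \<in> range ((*v) (P j x)) \<Longrightarrow> exp (\<sigma> * real n) * norm v \<le> lower_at j \<sigma> x * norm (\<A> x n *v v)"
      using x jk fin \<sigma>j \<sigma>(1) unfolding regular_def by blast+
    have "0 < lower_at j \<sigma> x" by (simp add: uniform_exponent.lower_const_def[OF unif[OF jk fin]] less_max_iff_disj)
    then have le: "lower_at j \<sigma> x \<le> ?l j" by (intro ln_le_tempered_envelope t \<delta>)
    have "\<A> x n *v (P j x *v v) = P j ((f ^^ n) x) *v (\<A> x n *v v)"
      by (simp add: matrix_vector_mul_assoc invariant_projection.P_equiv_cocycle[OF proj[OF jk]])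
    then have "norm (\<A> x n *v (P j x *v v)) \<le> (angle_const \<delta> ((f ^^ n) x) - 1) * ?Av"
      using norm_sum_proj_le[OF reg_n \<delta>, of "{j}" "\<A> x n *v v"] jf by simp
    also have "\<dots> \<le> (angle_const \<delta> x * exp (\<delta> * real n)) * ?Av"
      using Kn by (intro mult_right_mono) auto
    finally have c: "norm (\<A> x n *v (P j x *v v)) \<le> (angle_const \<delta> x * exp (\<delta> * real n)) * ?Av" .
    have "exp (\<sigma> * real n) * norm (P j x *v v) \<le> lower_at j \<sigma> x * norm (\<A> x n *v (P j x *v v))"
      by (rule b) auto
    also have "\<dots> \<le> ?l j * (angle_const \<delta> x * exp (\<delta> * real n) * ?Av)"
      using le c by (intro mult_mono) (auto intro!: less_imp_le[OF tempered_envelope_pos])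
    finally show "exp (\<sigma> * real n) * norm (P j x *v v) \<le> ?l j * (angle_const \<delta> x * exp (\<delta> * real n) * ?Av)" .
  qed
  also have "\<dots> = (\<Sum>j\<in>{i+1..k}. ?l j) * (angle_const \<delta> x * exp (\<delta> * real n) * ?Av)"
    by (simp add: sum_distrib_right)
  also have "\<dots> \<le> (1 + (\<Sum>j\<in>{1..i}. upper_env j \<rho> \<delta> x) + (\<Sum>j\<in>{i+1..k}. ?l j))
      * (angle_const \<delta> x * exp (\<delta> * real n) * ?Av)"
    using angle_const_ge_1[of \<delta> x]
    by (intro mult_right_mono) (auto intro!: add_nonneg_nonneg sum_nonneg less_imp_le[OF tempered_envelope_pos])
  finally show ?thesis by (simp add: growth_const_def mult_ac)
qed

text \<open>\<open>v\<close> is the sum of the projections of \<open>u + v\<close> with index above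
  \<open>i\<close>, all of finite exponent; \<open>u\<close> follows by the triangle inequality. So
  the estimate works even if \<open>u\<close> has components of exponent
  \<open>- \<infinity>\<close>.\<close>

lemma angle_estimate:
  assumes x: "regular x" and \<delta>: "0 < \<delta>" and sum: "\<And>v. (\<Sum>j\<in>{1..k}. P j x *v v) = v"
    and u: "\<And>j. j \<in> {i+1..k} \<Longrightarrow> P j x *v u = 0" and v: "\<And>j. j \<in> {1..i} \<Longrightarrow> P j x *v v = 0"
  shows "norm u \<le> angle_const \<delta> x * norm (u + v)" and "norm v \<le> angle_const \<delta> x * norm (u + v)"
proof -
  have "(\<Sum>j\<in>{i+1..k}. P j x *v (u + v)) = (\<Sum>j\<in>{i+1..k}. P j x *v v)"
    by (intro sum.cong) (auto simp: matrix_vector_right_distrib u)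
  also have "\<dots> = (\<Sum>j\<in>{1..k}. P j x *v v)"
    using i v by (intro sum.mono_neutral_left) auto
  finally have veq: "(\<Sum>j\<in>{i+1..k}. P j x *v (u + v)) = v" using sum by simp
  have "norm v \<le> (\<Sum>j\<in>{i+1..k}. norm (P j x *v (u + v)))"
    using norm_sum[of "\<lambda>j. P j x *v (u + v)" "{i+1..k}"] unfolding veq .
  also have "\<dots> \<le> (angle_const \<delta> x - 1) * norm (u + v)"
    using finite_idx_tail[of _ i] i by (intro norm_sum_proj_le x \<delta>) auto
  finally have le: "norm v \<le> (angle_const \<delta> x - 1) * norm (u + v)" .
  also have "\<dots> \<le> angle_const \<delta> x * norm (u + v)" by (intro mult_right_mono) auto
  finally show "norm v \<le> angle_const \<delta> x * norm (u + v)" .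
  have "norm u \<le> norm (u + v) + norm v" using norm_triangle_ineq4[of "u + v" v] by simp
  then show "norm u \<le> angle_const \<delta> x * norm (u + v)" using le by (simp add: algebra_simps)
qed

end

end

subsection \<open>Measurability of the oblique projections\<close>

definition dsum_proj :: "nat set \<Rightarrow> (nat \<Rightarrow> (real^'d) set) \<Rightarrow> nat \<Rightarrow> real^'d \<Rightarrow> real^'d" where
  "dsum_proj J V j v = (THE w. w \<in> (\<Pi>\<^sub>E j\<in>J. V j) \<and> v = (\<Sum>j\<in>J. w j)) j"

context
  fixes J :: "nat set" and V :: "nat \<Rightarrow> (real^'d) set"
  assumes dsd: "direct_sum_decomp J V" and J: "finite J"
begin

lemma dsum_subspace: "j \<in> J \<Longrightarrow> subspace (V j)"
  using dsd by (simp add: direct_sum_decomp_def)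

lemma dsum_proj_in: "j \<in> J \<Longrightarrow> dsum_proj J V j v \<in> V j"
  and dsum_proj_sum: "(\<Sum>j\<in>J. dsum_proj J V j v) = v"
proof -
  have "\<exists>!w. w \<in> (\<Pi>\<^sub>E j\<in>J. V j) \<and> v = (\<Sum>j\<in>J. w j)"
    using dsd by (simp add: direct_sum_decomp_def)
  note t = theI'[OF this]
  show "j \<in> J \<Longrightarrow> dsum_proj J V j v \<in> V j" using t by (auto simp: dsum_proj_def)
  show "(\<Sum>j\<in>J. dsum_proj J V j v) = v" using t by (auto simp: dsum_proj_def)
qed

lemma dsum_proj_eq:
  assumes "\<And>j. j \<in> J \<Longrightarrow> w j \<in> V j" "(\<Sum>j\<in>J. w j) = v" "l \<in> J"
  shows "dsum_proj J V l v = w l"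
proof -
  have ex1: "\<exists>!w. w \<in> (\<Pi>\<^sub>E j\<in>J. V j) \<and> v = (\<Sum>j\<in>J. w j)"
    using dsd by (simp add: direct_sum_decomp_def)
  have "(THE w. w \<in> (\<Pi>\<^sub>E j\<in>J. V j) \<and> v = (\<Sum>j\<in>J. w j)) = restrict w J"
    by (rule the1_equality[OF ex1]) (use assms(1,2) in auto)
  then show ?thesis using assms(3) by (simp add: dsum_proj_def)
qed

lemma dsum_proj_linear:
  assumes "l \<in> J"
  shows "linear (dsum_proj J V l)"
proof (rule linearI)
  fix u v c
  show "dsum_proj J V l (u + v) = dsum_proj J V l u + dsum_proj J V l v"
    by (rule dsum_proj_eq)
       (auto intro: subspace_add[OF dsum_subspace] dsum_proj_in simp: sum.distrib dsum_proj_sum assms)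
  show "dsum_proj J V l (c *\<^sub>R u) = c *\<^sub>R dsum_proj J V l u"
    by (rule dsum_proj_eq)
       (auto intro: subspace_scale[OF dsum_subspace] dsum_proj_in simp: scaleR_sum_right[symmetric] dsum_proj_sum assms)
qed

lemma dsum_proj_component:
  assumes "j \<in> J" "v \<in> V j" "l \<in> J"
  shows "dsum_proj J V l v = (if l = j then v else 0)"
  by (rule dsum_proj_eq[where w = "\<lambda>l. if l = j then v else 0"])
     (use assms J in \<open>auto intro: subspace_0 dsum_subspace simp: sum.delta\<close>)

lemma dsum_proj_partial_sum:
  assumes "K \<subseteq> J" "v \<in> partial_sum K V" "l \<in> J" "l \<notin> K"
  shows "dsum_proj J V l v = 0"
proof -
  obtain w where w: "\<forall>j\<in>K. w j \<in> V j" "v = (\<Sum>j\<in>K. w j)"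
    using assms(2) by (auto simp: partial_sum_def)
  have "dsum_proj J V l v = (if l \<in> K then w l else 0)"
  proof (rule dsum_proj_eq[where w = "\<lambda>l. if l \<in> K then w l else 0"])
    show "(\<Sum>j\<in>J. if j \<in> K then w j else 0) = v"
      using J assms(1) by (simp add: w(2) sum.If_cases Int_absorb1)
  qed (use w(1) assms(3) in \<open>auto intro: subspace_0 dsum_subspace\<close>)
  then show ?thesis using assms(4) by simp
qed

end

lemma closest_point_subspace:
  fixes V :: "(real^'d) set"
  assumes V: "subspace V"
  shows "closest_point V v \<in> V" and "s \<in> V \<Longrightarrow> (v - closest_point V v) \<bullet> s = 0"
proof -
  have cl: "closed V" "V \<noteq> {}" "convex V"
    using V by (auto intro: closed_subspace subspace_imp_convex simp: subspace_def)
  show in_V: "closest_point V v \<in> V" by (rule closest_point_in_set[OF cl(1,2)])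
  assume s: "s \<in> V"
  have "(v - closest_point V v) \<bullet> ((closest_point V v + s) - closest_point V v) \<le> 0"
    by (rule closest_point_dot[OF cl(3,1)]) (intro subspace_add V in_V s)
  moreover have "(v - closest_point V v) \<bullet> ((closest_point V v - s) - closest_point V v) \<le> 0"
    by (rule closest_point_dot[OF cl(3,1)]) (intro subspace_diff V in_V s)
  ultimately show "(v - closest_point V v) \<bullet> s = 0" by simp
qed

lemma closest_point_eqI:
  fixes V :: "(real^'d) set"
  assumes V: "subspace V" and "y \<in> V" "\<And>s. s \<in> V \<Longrightarrow> (v - y) \<bullet> s = 0"
  shows "closest_point V v = y"
proof -
  define d where "d = y - closest_point V v"
  have d: "d \<in> V" unfolding d_def by (intro subspace_diff V assms closest_point_subspace)
  have "d \<bullet> d = (v - closest_point V v) \<bullet> d - (v - y) \<bullet> d"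
    by (simp add: d_def inner_diff_left)
  also have "\<dots> = 0" using closest_point_subspace(2)[OF V d] assms(3)[OF d] by simp
  finally show ?thesis by (simp add: d_def)
qed

lemma closest_point_linear:
  fixes V :: "(real^'d) set"
  assumes V: "subspace V"
  shows "linear (closest_point V)"
proof (rule linearI)
  note c = closest_point_subspace[OF V]
  fix u v :: "real^'d" and k :: real
  show "closest_point V (u + v) = closest_point V u + closest_point V v"
  proof (rule closest_point_eqI[OF V])
    fix s assume s: "s \<in> V"
    have "(u + v - (closest_point V u + closest_point V v)) \<bullet> s
        = (u - closest_point V u) \<bullet> s + (v - closest_point V v) \<bullet> s"
      by (simp add: inner_diff_left inner_add_left)
    then show "(u + v - (closest_point V u + closest_point V v)) \<bullet> s = 0" using c(2)[OF s] by simp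
  qed (intro subspace_add V c)
  show "closest_point V (k *\<^sub>R u) = k *\<^sub>R closest_point V u"
  proof (rule closest_point_eqI[OF V])
    fix s assume s: "s \<in> V"
    have "(k *\<^sub>R u - k *\<^sub>R closest_point V u) \<bullet> s = k * ((u - closest_point V u) \<bullet> s)"
      by (simp add: inner_diff_left right_diff_distrib)
    then show "(k *\<^sub>R u - k *\<^sub>R closest_point V u) \<bullet> s = 0" using c(2)[OF s] by simp
  qed (intro subspace_scale V c)
qed

definition cramer_solve :: "real^'d^'d \<Rightarrow> real^'d \<Rightarrow> real^'d" where
  "cramer_solve B b = (\<chi> m. det (\<chi> i j. if j = m then b $ i else B $ i $ j) / det B)"

text \<open>The sum of the orthogonal projections is invertible, and its inverse turns them into the
  projections along the other summands. Cramer's rule makes the dependence on the data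
  evidently measurable.\<close>

lemma dsum_proj_cramer:
  fixes V :: "nat \<Rightarrow> (real^'d) set"
  assumes dsd: "direct_sum_decomp J V" and J: "finite J" and l: "l \<in> J"
  shows "dsum_proj J V l b = closest_point (V l) (cramer_solve (\<Sum>j\<in>J. matrix (closest_point (V j))) b)"
proof -
  note sub = dsum_subspace[OF dsd J]
  define B where "B = (\<Sum>j\<in>J. matrix (closest_point (V j)))"
  have Q: "matrix (closest_point (V j)) *v y = closest_point (V j) y" if "j \<in> J" for j y
    using fun_cong[OF matrix_vector_mul(2)[OF closest_point_linear[OF sub[OF that]]]] .
  have msum: "(\<Sum>j\<in>K. F j) *v y = (\<Sum>j\<in>K. F j *v y)" if "finite K" for K and F :: "nat \<Rightarrow> real^'d^'d" and y
    using that by (induction K rule: finite_induct) (auto simp: matrix_vector_mult_add_rdistrib)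
  have B: "B *v y = (\<Sum>j\<in>J. closest_point (V j) y)" for y
    unfolding B_def msum[OF J] by (intro sum.cong refl Q)
  \<comment> \<open>\<open>y \<bullet> (B *v y)\<close> is the sum of the squared norms of the
    orthogonal projections of \<open>y\<close>. If it is 0, then \<open>y\<close> is orthogonal to
    all summands, hence to itself.\<close>
  have inj: "y = 0" if "B *v y = 0" for y
  proof -
    have sq: "y \<bullet> closest_point (V j) y = (norm (closest_point (V j) y))\<^sup>2" if "j \<in> J" for j
      using closest_point_subspace(2)[OF sub[OF that] closest_point_subspace(1)[OF sub[OF that]], of y y]
      by (simp add: inner_diff_left power2_norm_eq_inner)
    have "(\<Sum>j\<in>J. (norm (closest_point (V j) y))\<^sup>2) = y \<bullet> (B *v y)"
      unfolding B inner_sum_right by (intro sum.cong refl sq[symmetric])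
    then have "(\<Sum>j\<in>J. (norm (closest_point (V j) y))\<^sup>2) = 0" using that by simp
    then have z: "closest_point (V j) y = 0" if "j \<in> J" for j
      using that J by (simp add: sum_nonneg_eq_0_iff)
    have "y \<bullet> s = 0" if "j \<in> J" "s \<in> V j" for j s
      using closest_point_subspace(2)[OF sub[OF that(1)] that(2), of y] z[OF that(1)] by simp
    then have "(\<Sum>j\<in>J. y \<bullet> dsum_proj J V j y) = 0"
      using dsum_proj_in[OF dsd J] by (intro sum.neutral) blast
    then have "y \<bullet> y = 0"
      unfolding inner_sum_right[symmetric] dsum_proj_sum[OF dsd J] .
    then show ?thesis by simp
  qed
  have "inj ((*v) B)"
    using inj by (simp add: linear_injective_0)
  then have "det B \<noteq> 0"
    unfolding invertible_det_nz[symmetric] invertible_left_inverse matrix_left_invertible_injective .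
  then have "B *v cramer_solve B b = b"
    unfolding cramer_solve_def by (simp add: cramer)
  \<comment> \<open>The terms of this sum lie in the \<open>V j\<close>, so uniqueness of the
    decomposition identifies them with the components of \<open>b\<close>.\<close>
  then have "(\<Sum>j\<in>J. closest_point (V j) (cramer_solve B b)) = b" unfolding B .
  then show ?thesis
    unfolding B_def[symmetric] using closest_point_subspace(1)[OF sub] l
    by (intro dsum_proj_eq[OF dsd J]) auto
qed

lemma borel_measurable_component [measurable (raw)]:
  fixes F :: "'x \<Rightarrow> ('b::euclidean_space)^'n"
  assumes "F \<in> borel_measurable M"
  shows "(\<lambda>x. F x $ i) \<in> borel_measurable M"
  by (rule borel_measurable_continuous_on[OF _ assms]) (intro continuous_intros)

lemma borel_measurable_vec_lambda:
  fixes F :: "'n::finite \<Rightarrow> 'x \<Rightarrow> 'b::euclidean_space"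
  assumes "\<And>i. F i \<in> borel_measurable M"
  shows "(\<lambda>x. \<chi> i. F i x) \<in> borel_measurable M"
  unfolding borel_measurable_euclidean_space[of "\<lambda>x. \<chi> i. F i x"]
proof
  fix b :: "'b^'n" assume "b \<in> Basis"
  then obtain i u where b: "b = axis i u" by (auto simp: Basis_vec_def)
  show "(\<lambda>x. (\<chi> i. F i x) \<bullet> b) \<in> borel_measurable M"
    using assms[of i] by (simp add: b inner_axis)
qed

lemma borel_measurable_cramer_solve [measurable (raw)]:
  fixes B :: "'x \<Rightarrow> real^'d^'d"
  assumes [measurable]: "B \<in> borel_measurable M"
  shows "(\<lambda>x. cramer_solve (B x) b) \<in> borel_measurable M"
proof -
  have det: "(\<lambda>x. det (F x)) \<in> borel_measurable M"
    if [measurable]: "F \<in> borel_measurable M" for F :: "'x \<Rightarrow> real^'d^'d"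
    unfolding det_def by measurable
  have ent: "(\<lambda>x. if j = m then b $ i else B x $ i $ j) \<in> borel_measurable M" for m i j
    by (cases "j = m") auto
  show ?thesis
    unfolding cramer_solve_def
    by (intro borel_measurable_vec_lambda borel_measurable_divide det ent assms)
qed

lemma borel_measurable_matI:
  fixes F :: "'x \<Rightarrow> real^'d^'d"
  assumes "\<And>b. (\<lambda>x. F x *v b) \<in> borel_measurable M"
  shows "F \<in> borel_measurable M"
proof -
  have "(\<lambda>x. \<chi> i j. (F x *v axis j 1) $ i) \<in> borel_measurable M"
    by (intro borel_measurable_vec_lambda borel_measurable_component assms)
  moreover have "(\<lambda>x. \<chi> i j. (F x *v axis j 1) $ i) = F"
    by (intro ext) (simp add: vec_eq_iff matrix_vector_mul_component flip: cart_eq_inner_axis)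
  ultimately show ?thesis by simp
qed

lemma elog_div_upper:
  assumes "elog r / ereal (real n) < ereal \<rho>" "0 \<le> r" "n > 0"
  shows "r \<le> exp (\<rho> * real n)"
proof (cases "r = 0")
  case False
  then have "ln r / real n < \<rho>" using assms by (simp add: elog_def)
  then have "ln r < \<rho> * real n" using assms(3) by (simp add: pos_divide_less_eq)
  then have "exp (ln r) \<le> exp (\<rho> * real n)" by simp
  then show ?thesis using False assms(2) by simp
qed simp

lemma elog_div_lower:
  assumes "ereal \<sigma> < elog r / ereal (real n)" "0 \<le> r" "n > 0"
  shows "exp (\<sigma> * real n) \<le> r"
proof (cases "r = 0")
  case True
  then show ?thesis using assms by (simp add: elog_def)
next
  case False
  then have "\<sigma> < ln r / real n" using assms by (simp add: elog_def)
  then have "\<sigma> * real n < ln r" using assms(3) by (simp add: pos_less_divide_eq)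
  then have "exp (\<sigma> * real n) \<le> exp (ln r)" by simp
  then show ?thesis using False assms(2) by simp
qed

theorem theorem2:
  fixes M :: "'x::topological_space measure"
    and f :: "'x \<Rightarrow> 'x"
    and A :: "'x \<Rightarrow> real^'d^'d"
    and k i :: nat
    and lam :: "nat \<Rightarrow> ereal"
    and E :: "nat \<Rightarrow> 'x \<Rightarrow> (real^'d) set"
    and E1 E2 :: "'x \<Rightarrow> (real^'d) set"
  assumes "prob_space M" and "sets M = sets borel"
    and "bij f" and "f \<in> measurable M M" and "inv f \<in> measurable M M"
    and "ergodic_pres M f"
    and "A \<in> borel_measurable M"
    and "integrable M (\<lambda>x. log_plus (op_norm (A x)))"
    and "oseledets_splitting M f A k lam E"
    and "i \<in> {1..k}"
    and E1_def: "\<And>x. E1 x = partial_sum {1..i} (\<lambda>j. E j x)"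
    and E2_def: "\<And>x. E2 x = partial_sum {i+1..k} (\<lambda>j. E j x)"
  shows "\<exists>\<Lambda>\<in>sets M. f -` \<Lambda> = \<Lambda> \<and> measure M \<Lambda> = 1 \<and>
    (\<forall>\<epsilon>>0.
      \<exists>K \<in> borel_measurable (restrict_space M \<Lambda>).
        (\<forall>x\<in>\<Lambda>. K x > (0::real)) \<and>
        (\<forall>x\<in>\<Lambda>. \<forall>u\<in>E1 x. \<forall>v\<in>E2 x.
           norm u \<le> K x * norm (u + v) \<and> norm v \<le> K x * norm (u + v)) \<and>
        (\<forall>x\<in>\<Lambda>. \<forall>n::int. K (int_iter f n x) \<le> K x * exp (\<epsilon> * \<bar>real_of_int n\<bar>)) \<and>
        (\<forall>r. admissible_rate k lam i r \<longrightarrow>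
          (\<exists>C \<in> borel_measurable (restrict_space M \<Lambda>).
            (\<forall>x\<in>\<Lambda>. C x > (0::real)) \<and>
            (\<forall>x\<in>\<Lambda>. \<forall>v\<in>E1 x. \<forall>n::nat.
               norm (cocycle f A x n *v v) \<le> C x * exp ((r + \<epsilon>) * real n) * norm v) \<and>
            (i < k \<longrightarrow>
               (\<forall>x\<in>\<Lambda>. \<forall>v\<in>E2 x. \<forall>n::nat.
                  norm (cocycle f A x n *v v)
                    \<ge> 1 / C x * exp ((real_of_ereal (lam (i + 1)) - \<epsilon>) * real n) * norm v)) \<and>
            (\<forall>x\<in>\<Lambda>. \<forall>n::int.
               C (int_iter f n x) \<le> C x * exp (\<epsilon> * \<bar>real_of_int n\<bar>)))))"
proof -
  interpret prob_space M by fact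
  interpret ergodic_bij M f
    by unfold_locales (use assms sets_eq_imp_space_eq[OF \<open>sets M = sets borel\<close>] in auto)
  note A_meas [measurable] = \<open>A \<in> borel_measurable M\<close>
  note i = \<open>i \<in> {1..k}\<close>
  obtain \<Omega> where \<Omega>: "\<Omega> \<in> sets M" "measure M \<Omega> = 1"
    and E_meas: "\<forall>j\<in>{1..k}. measurable_subspaces (restrict_space M \<Omega>) (E j)"
    and \<Omega>_all: "\<forall>x\<in>\<Omega>. direct_sum_decomp {1..k} (\<lambda>j. E j x) \<and>
       (\<forall>j\<in>{1..k}. (*v) (A x) ` E j x \<subseteq> E j (f x) \<and>
          (lam j > - \<infinity> \<longrightarrow> (*v) (A x) ` E j x = E j (f x)) \<and>
          (\<forall>v \<in> E j x - {0}.
             (\<lambda>n. elog (norm (cocycle f A x n *v v)) / ereal (real n)) \<longlonglongrightarrow> lam j))"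
    using assms(9) unfolding oseledets_splitting_def by (elim conjE bexE) (rule that)
  have dsd: "direct_sum_decomp {1..k} (\<lambda>j. E j x)" if "x \<in> \<Omega>" for x
    using bspec[OF \<Omega>_all that] by (rule conjunct1)
  note \<Omega>_j = bspec[OF conjunct2[OF bspec[OF \<Omega>_all]]]
  have A_sub: "(*v) (A x) ` E j x \<subseteq> E j (f x)" if "x \<in> \<Omega>" "j \<in> {1..k}" for x j
    using \<Omega>_j[OF that] by (rule conjunct1)
  have A_eq: "(*v) (A x) ` E j x = E j (f x)" if "x \<in> \<Omega>" "j \<in> {1..k}" "lam j > - \<infinity>" for x j
    using conjunct1[OF conjunct2[OF \<Omega>_j[OF that(1,2)]]] that(3) by (rule mp)
  have lim: "(\<lambda>n. elog (norm (cocycle f A x n *v v)) / ereal (real n)) \<longlonglongrightarrow> lam j"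
    if "x \<in> \<Omega>" "j \<in> {1..k}" "v \<in> E j x" "v \<noteq> 0" for x j v
    using conjunct2[OF conjunct2[OF \<Omega>_j[OF that(1,2)]]] that(3,4) by simp
  have lam_mono: "strict_mono_on {1..k} lam" and lam_less: "\<And>j. j \<in> {1..k} \<Longrightarrow> lam j < \<infinity>"
    using assms(9) unfolding oseledets_splitting_def by blast+
  have "AE x in M. x \<in> \<Omega>" using prob_eq_1[OF \<Omega>(1)] \<Omega>(2) by simp
  \<comment> \<open>\<open>\<Omega>\<close> need not be invariant, while equivariance of projections
    cut off outside a set requires \<open>x\<close> and \<open>f x\<close> to belong to it
    together.\<close>
  then obtain L where L [measurable]: "L \<in> sets M" and L_inv: "\<And>x. f x \<in> L \<longleftrightarrow> x \<in> L"
    and AE_L: "AE x in M. x \<in> L" and L\<Omega>: "\<And>x. x \<in> L \<Longrightarrow> x \<in> \<Omega>"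
    by (rule AE_invariant_set) blast
  \<comment> \<open>Zero off \<open>L\<close>, so that idempotence and equivariance hold at every point.\<close>
  define P where "P j x = (if x \<in> L then matrix (dsum_proj {1..k} (\<lambda>j. E j x) j) else 0)" for j x
  note dsdL = dsd[OF L\<Omega>]
  have P_L: "P j x *v v = dsum_proj {1..k} (\<lambda>j. E j x) j v" if "x \<in> L" "j \<in> {1..k}" for x j v
    using that fun_cong[OF matrix_vector_mul(2)[OF dsum_proj_linear[OF dsdL[OF that(1)] _ that(2)]]]
    by (simp add: P_def)
  have P_nL: "P j x *v v = 0" if "x \<notin> L" for x j v using that by (simp add: P_def)
  have P_range: "range ((*v) (P j x)) = (if x \<in> L then E j x else {0})" if j: "j \<in> {1..k}" for j x
  proof (cases "x \<in> L")
    case True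
    have "v \<in> range ((*v) (P j x))" if "v \<in> E j x" for v
    proof -
      have "P j x *v v = v"
        using P_L[OF True j, of v] dsum_proj_component[OF dsdL[OF True] finite_atLeastAtMost j that j] by simp
      then show ?thesis by (metis rangeI)
    qed
    moreover have "P j x *v v \<in> E j x" for v
      using P_L[OF True j, of v] dsum_proj_in[OF dsdL[OF True] _ j, of v] by simp
    ultimately show ?thesis using True by auto
  next
    case False
    then show ?thesis using P_nL[OF False] by auto
  qed
  \<comment> \<open>The splitting is measurable in terms of orthogonal projections; the oblique ones
    are recovered from these by \<open>dsum_proj_cramer\<close>.\<close>
  define Q where "Q j x = (if x \<in> L then matrix (closest_point (E j x)) else 0)" for j x
  have sub: "subspace (E j x)" if "x \<in> L" "j \<in> {1..k}" for j x
    using dsum_subspace[OF dsdL[OF that(1)] _ that(2)] by simp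
  have Q_L: "Q j x *v v = closest_point (E j x) v" if "x \<in> L" "j \<in> {1..k}" for x j v
    using fun_cong[OF matrix_vector_mul(2)[OF closest_point_linear[OF sub[OF that]]]] that(1) by (simp add: Q_def)
  have Q_meas [measurable]: "Q j \<in> borel_measurable M" if j: "j \<in> {1..k}" for j
  proof (rule borel_measurable_matI)
    fix b
    have "(\<lambda>x. closest_point (E j x) b) \<in> borel_measurable (restrict_space M \<Omega>)"
      using bspec[OF E_meas j] by (simp add: measurable_subspaces_def)
    then have "(\<lambda>x. closest_point (E j x) b) \<in> borel_measurable (restrict_space M {x. x \<in> L})"
      by (rule measurable_restrict_mono) (use L\<Omega> in auto)
    then have "(\<lambda>x. if x \<in> L then closest_point (E j x) b else 0) \<in> borel_measurable M"
      using L by (subst measurable_If_restrict_space_iff) (auto simp: space_UNIV)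
    moreover have "Q j x *v b = (if x \<in> L then closest_point (E j x) b else 0)" for x
      using Q_L[OF _ j] by (simp add: Q_def)
    ultimately show "(\<lambda>x. Q j x *v b) \<in> borel_measurable M" by simp
  qed
  have P_meas: "P j \<in> borel_measurable M" if j: "j \<in> {1..k}" for j
  proof (rule borel_measurable_matI)
    fix b
    have "P j x *v b = Q j x *v cramer_solve (\<Sum>j\<in>{1..k}. Q j x) b" for x
    proof (cases "x \<in> L")
      case True
      have "(\<Sum>j\<in>{1..k}. Q j x) = (\<Sum>j\<in>{1..k}. matrix (closest_point (E j x)))"
        using True by (simp add: Q_def)
      then show ?thesis
        using dsum_proj_cramer[OF dsdL[OF True] _ j, of b] P_L[OF True j] Q_L[OF True j] by simp
    qed (simp add: P_def Q_def)
    moreover have "(\<lambda>x. \<Sum>j\<in>{1..k}. Q j x) \<in> borel_measurable M"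
      by (intro borel_measurable_sum Q_meas)
    then have "(\<lambda>x. Q j x *v cramer_solve (\<Sum>j\<in>{1..k}. Q j x) b) \<in> borel_measurable M"
      by (intro borel_measurable_mat_vec Q_meas j borel_measurable_cramer_solve)
    ultimately show "(\<lambda>x. P j x *v b) \<in> borel_measurable M" by simp
  qed
  define h where "h x = log_plus (op_norm (A x))" for x
  have inv_proj: "invariant_projection M f A (P j) h" if j: "j \<in> {1..k}" for j
  proof
    show "P j x ** P j x = P j x" for x
    proof (subst matrix_eq, intro allI)
      fix v
      show "(P j x ** P j x) *v v = P j x *v v"
      proof (cases "x \<in> L")
        case True
        have "P j x *v v \<in> E j x" using P_range[OF j, of x] True by auto
        then show ?thesis
          using dsum_proj_component[OF dsdL[OF True] _ j _ j] P_L[OF True j]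
          by (simp flip: matrix_vector_mul_assoc)
      qed (simp add: P_def)
    qed
    show "P j (f x) ** A x = A x ** P j x" for x
    proof (subst matrix_eq, intro allI)
      fix v
      show "(P j (f x) ** A x) *v v = (A x ** P j x) *v v"
      proof (cases "x \<in> L")
        case True
        then have fL: "f x \<in> L" using L_inv by simp
        have "dsum_proj {1..k} (\<lambda>j. E j (f x)) j (A x *v v) = A x *v dsum_proj {1..k} (\<lambda>j. E j x) j v"
        proof (rule dsum_proj_eq[OF dsdL[OF fL] _ _ _ j])
          show "A x *v dsum_proj {1..k} (\<lambda>j. E j x) l v \<in> E l (f x)" if "l \<in> {1..k}" for l
            using A_sub[OF L\<Omega>[OF True] that] dsum_proj_in[OF dsdL[OF True] _ that] by auto
          show "(\<Sum>l\<in>{1..k}. A x *v dsum_proj {1..k} (\<lambda>j. E j x) l v) = A x *v v"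
            using linear_sum[OF matrix_vector_mul_linear, of "A x" "\<lambda>l. dsum_proj {1..k} (\<lambda>j. E j x) l v" "{1..k}"]
            unfolding dsum_proj_sum[OF dsdL[OF True] finite_atLeastAtMost] by simp
        qed simp
        then show ?thesis by (simp add: P_L[OF True j] P_L[OF fL j] flip: matrix_vector_mul_assoc)
      next
        case False
        then show ?thesis using L_inv by (simp add: P_nL flip: matrix_vector_mul_assoc)
      qed
    qed
    show "integrable M h" unfolding h_def[abs_def] by fact
    show "0 \<le> h x" for x by (simp add: h_def log_plus_def)
    show "norm (A x *v v) \<le> exp (h x) * norm v" for x v
    proof -
      have "op_norm (A x) \<le> exp (h x)"
      proof (cases "op_norm (A x) > 0")
        case True
        then have "op_norm (A x) = exp (ln (op_norm (A x)))" by simp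
        also have "\<dots> \<le> exp (h x)" by (simp only: exp_le_cancel_iff h_def log_plus_def max.cobounded2)
        finally show ?thesis .
      next
        case False
        then show ?thesis using exp_gt_zero[of "h x"] by linarith
      qed
      then show ?thesis
        using norm_mat_vec_le[of "A x" v] unfolding op_norm_def
        by (meson mult_right_mono norm_ge_zero order.trans)
    qed
  qed (use P_meas[OF j] A_meas in auto)
  have growth: "\<forall>\<^sub>F n in sequentially. norm (cocycle f A x n *v v) \<le> exp (\<rho> * real n)"
    if j: "j \<in> {1..k}" and \<rho>: "lam j < ereal \<rho>" and v: "v \<in> range ((*v) (P j x))" for j \<rho> v x
  proof (cases "v = 0")
    case False
    then have x: "x \<in> L" "v \<in> E j x" using v unfolding P_range[OF j] by (auto split: if_splits)
    have "\<forall>\<^sub>F n in sequentially. elog (norm (cocycle f A x n *v v)) / ereal (real n) < ereal \<rho>"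
      using lim[OF L\<Omega>[OF x(1)] j x(2) False] \<rho> by (rule order_tendstoD(2))
    then show ?thesis using eventually_gt_at_top[of 0]
      by eventually_elim (rule elog_div_upper, auto)
  qed simp
  have unif: "uniform_exponent M f A (P j) h (real_of_ereal (lam j))"
    if j: "j \<in> {1..k}" and fin: "- \<infinity> < lam j" for j
  proof -
    interpret invariant_projection M f A "P j" h by (rule inv_proj[OF j])
    have lamj: "lam j = ereal (real_of_ereal (lam j))"
      using fin lam_less[OF j] by (cases "lam j") auto
    show ?thesis
    proof
      show "\<forall>\<^sub>F n in sequentially. norm (cocycle f A x n *v v) \<le> exp (\<rho> * real n)"
        if "v \<in> range ((*v) (P j x))" "real_of_ereal (lam j) < \<rho>" for x v \<rho>
      proof -
        have "lam j < ereal \<rho>" using that(2) by (subst lamj) simp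
        then show ?thesis using that(1) by (rule growth[OF j])
      qed
      show "\<forall>\<^sub>F n in sequentially. exp (\<sigma> * real n) \<le> norm (cocycle f A x n *v v)"
        if v: "v \<in> range ((*v) (P j x))" "v \<noteq> 0" and \<sigma>: "\<sigma> < real_of_ereal (lam j)" for x v \<sigma>
      proof -
        have x: "x \<in> L" "v \<in> E j x" using v unfolding P_range[OF j] by (auto split: if_splits)
        have "ereal \<sigma> < lam j" using \<sigma> by (subst lamj) simp
        with lim[OF L\<Omega>[OF x(1)] j x(2) v(2)]
        have "\<forall>\<^sub>F n in sequentially. ereal \<sigma> < elog (norm (cocycle f A x n *v v)) / ereal (real n)"
          by (rule order_tendstoD(1))
        then show ?thesis using eventually_gt_at_top[of 0]
          by eventually_elim (rule elog_div_lower, auto)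
      qed
      show "range ((*v) (P j (f x))) \<subseteq> (*v) (A x) ` range ((*v) (P j x))" for x
        unfolding P_range[OF j] using A_eq[OF L\<Omega> j fin, of x] L_inv[of x] by auto
    qed
  qed
  interpret oseledets_projections M f A h k lam P
  proof (intro oseledets_projections.intro oseledets_projections_axioms.intro)
    show "ergodic_bij M f" by (rule ergodic_bij_axioms)
  next
    fix j :: nat assume j: "j \<in> {1..k}"
    show "invariant_projection M f A (P j) h" using j by (rule inv_proj)
    show "uniform_exponent M f A (P j) h (real_of_ereal (lam j))" if "- \<infinity> < lam j"
      using j that by (rule unif)
    show "\<forall>\<^sub>F n in sequentially. norm (cocycle f A x n *v v) \<le> exp (\<rho> * real n)"
      if "lam j < ereal \<rho>" "v \<in> range ((*v) (P j x))" for \<rho> v x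
      using j that by (rule growth)
    show "lam j < \<infinity>" using j by (rule lam_less)
  qed (rule lam_mono)
  \<comment> \<open>Invariance also supplies regularity at \<open>(f ^^ n) x\<close>, on which
    \<open>lower_estimate\<close> relies.\<close>
  obtain \<Lambda> where \<Lambda>: "\<Lambda> \<in> sets M" and \<Lambda>_inv: "\<And>x. f x \<in> \<Lambda> \<longleftrightarrow> x \<in> \<Lambda>"
    and AE_\<Lambda>: "AE x in M. x \<in> \<Lambda>" and \<Lambda>_reg: "\<And>x. x \<in> \<Lambda> \<Longrightarrow> regular x \<and> x \<in> L"
    using AE_conjI[OF AE_regular AE_L] by (rule AE_invariant_set) blast
  have \<Lambda>_iter: "(f ^^ n) x \<in> \<Lambda>" if "x \<in> \<Lambda>" for n x
    using that by (induction n) (auto simp: \<Lambda>_inv)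
  have sum_P: "(\<Sum>j\<in>{1..k}. P j x *v v) = v" if "x \<in> \<Lambda>" for x v
  proof -
    have x: "x \<in> L" using \<Lambda>_reg that by blast
    have "(\<Sum>j\<in>{1..k}. P j x *v v) = (\<Sum>j\<in>{1..k}. dsum_proj {1..k} (\<lambda>j. E j x) j v)"
      by (intro sum.cong refl P_L x)
    then show ?thesis using dsum_proj_sum[OF dsdL[OF x] finite_atLeastAtMost, of v] by simp
  qed
  have P_E1: "P j x *v v = 0" if "x \<in> \<Lambda>" "v \<in> E1 x" "j \<in> {i+1..k}" for x v j
  proof -
    have x: "x \<in> L" using \<Lambda>_reg that by blast
    have j: "j \<in> {1..k}" using that i by auto
    show ?thesis
      unfolding P_L[OF x j]
      by (rule dsum_proj_partial_sum[OF dsdL[OF x] finite_atLeastAtMost _ that(2)[unfolded E1_def] j]) (use that(3) i in auto)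
  qed
  have P_E2: "P j x *v v = 0" if "x \<in> \<Lambda>" "v \<in> E2 x" "j \<in> {1..i}" for x v j
  proof -
    have x: "x \<in> L" using \<Lambda>_reg that by blast
    have j: "j \<in> {1..k}" using that i by auto
    show ?thesis
      unfolding P_L[OF x j]
      by (rule dsum_proj_partial_sum[OF dsdL[OF x] finite_atLeastAtMost _ that(2)[unfolded E2_def] j]) (use that(3) i in auto)
  qed
  show ?thesis
  proof (intro bexI[of _ \<Lambda>] conjI allI impI, goal_cases)
    case 1
    show ?case using \<Lambda>_inv by auto
  next
    case 2
    show ?case using prob_eq_1[OF \<Lambda>] AE_\<Lambda> by simp
  next
    case \<epsilon>: (3 \<epsilon>)
    show ?case
    proof (rule bexI[of _ "angle_const \<epsilon>"], intro conjI allI impI, goal_cases)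
      case 1
      show ?case using angle_const_ge_1 by (auto intro: less_le_trans[OF zero_less_one])
    next
      case 2
      show ?case using angle_estimate[OF i _ \<epsilon> sum_P P_E1 P_E2] \<Lambda>_reg by blast
    next
      case 3
      show ?case using angle_const_int_iter \<Lambda>_reg \<epsilon> by blast
    next
      case r: (4 r)
      \<comment> \<open>A rational rate strictly above \<open>lam i\<close> but below
        \<open>r + \<epsilon>\<close>; if \<open>lam i = - \<infinity>\<close>, every real
        \<open>r\<close> lies above it.\<close>
      obtain \<rho> where \<rho>: "\<rho> \<in> \<rat>" "r < \<rho>" "\<rho> < r + \<epsilon>" using Rats_dense_in_real[of r "r + \<epsilon>"] \<epsilon> by auto
      have "lam i \<le> ereal r" using r by (auto simp: admissible_rate_def split: if_splits)
      then have lam_i: "lam i < ereal \<rho>" using \<rho>(2) by (auto intro: order.strict_trans1)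
      define \<theta> where "\<theta> = real_of_ereal (lam (i + 1))"
      \<comment> \<open>Half of \<open>\<epsilon>\<close> is spent here, the other half on the
        factor \<open>exp (\<epsilon> / 2 * n)\<close> in \<open>lower_estimate\<close>. For
        \<open>i = k\<close> the number \<open>\<theta>\<close> carries no meaning, but then the sum
        over \<open>{i+1..k}\<close> is empty.\<close>
      obtain \<sigma> where \<sigma>: "\<sigma> \<in> \<rat>" "\<theta> - \<epsilon> / 2 < \<sigma>" "\<sigma> < \<theta>"
        using Rats_dense_in_real[of "\<theta> - \<epsilon> / 2" \<theta>] \<epsilon> by auto
      have lam_i1: "ereal \<sigma> < lam (i + 1)" if "i < k"
      proof -
        have "lam (i + 1) = ereal \<theta>"
          using that i strict_mono_onD[OF lam_mono, of i "i + 1"] lam_less[of "i + 1"]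
          by (cases "lam (i + 1)") (auto simp: \<theta>_def)
        then show ?thesis using \<sigma> by simp
      qed
      have \<epsilon>2: "0 < \<epsilon> / 2" using \<epsilon> by simp
      let ?C = "growth_const i \<rho> \<sigma> (\<epsilon> / 2)"
      show ?case
      proof (intro bexI[of _ ?C] conjI ballI allI impI)
        show "?C \<in> borel_measurable (restrict_space M \<Lambda>)"
          by (intro measurable_restrict_space1 growth_const_meas i)
        show "0 < ?C x" for x by (rule growth_const_pos)
        show "norm (cocycle f A x n *v v) \<le> ?C x * exp ((r + \<epsilon>) * real n) * norm v"
          if x: "x \<in> \<Lambda>" and v: "v \<in> E1 x" for x v n
        proof -
          have "norm (cocycle f A x n *v v) \<le> ?C x * exp (\<rho> * real n) * norm v"
            using \<Lambda>_reg[OF x] by (intro upper_estimate[OF i _ \<epsilon>2 \<rho>(1) lam_i sum_P[OF x] P_E1[OF x v]]) auto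
          also have "\<dots> \<le> ?C x * exp ((r + \<epsilon>) * real n) * norm v"
            using \<rho>(3) less_imp_le[OF growth_const_pos] by (intro mult_right_mono mult_left_mono) (auto intro: mult_right_mono)
          finally show ?thesis .
        qed
        show "1 / ?C x * exp ((real_of_ereal (lam (i + 1)) - \<epsilon>) * real n) * norm v \<le> norm (cocycle f A x n *v v)"
          if "i < k" and x: "x \<in> \<Lambda>" and v: "v \<in> E2 x" for x v n
        proof -
          have "exp (\<sigma> * real n) * norm v \<le> ?C x * exp (\<epsilon> / 2 * real n) * norm (cocycle f A x n *v v)"
            using \<Lambda>_reg[OF x] \<Lambda>_reg[OF \<Lambda>_iter[OF x]]
            by (intro lower_estimate[OF i _ \<epsilon>2 \<sigma>(1) lam_i1 sum_P[OF x] P_E2[OF x v]]) auto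
          moreover have "(\<theta> - \<epsilon>) * real n + \<epsilon> / 2 * real n \<le> \<sigma> * real n"
            unfolding distrib_right[symmetric] using \<sigma>(2) by (intro mult_right_mono) auto
          then have "exp (\<epsilon> / 2 * real n) * exp ((\<theta> - \<epsilon>) * real n) * norm v \<le> exp (\<sigma> * real n) * norm v"
            unfolding exp_add[symmetric] by (intro mult_right_mono) (auto simp: add.commute)
          ultimately have "exp (\<epsilon> / 2 * real n) * (exp ((\<theta> - \<epsilon>) * real n) * norm v)
              \<le> exp (\<epsilon> / 2 * real n) * (?C x * norm (cocycle f A x n *v v))"
            by (simp only: mult_ac)
          then have "exp ((\<theta> - \<epsilon>) * real n) * norm v \<le> ?C x * norm (cocycle f A x n *v v)" by simp
          then show ?thesis using growth_const_pos[of i \<rho> \<sigma> "\<epsilon> / 2" x]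
            by (simp add: \<theta>_def pos_divide_le_eq mult.commute)
        qed
        show "?C (int_iter f n x) \<le> ?C x * exp (\<epsilon> * \<bar>real_of_int n\<bar>)" if x: "x \<in> \<Lambda>" for x n
          using growth_const_int_iter[OF i conjunct1[OF \<Lambda>_reg[OF x]] \<epsilon>2 \<rho>(1) lam_i \<sigma>(1) lam_i1, of n] by simp
      qed
    next
      case 5
      show ?case by (intro measurable_restrict_space1 angle_const_meas)
    qed
  qed fact
qed

end
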